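(* Let $\tau_1$ be a Penrose tiling of $\mathbb{R}^2$ by kites and darts with edges of lengths $1$ and $\phi=\frac{1+\sqrt5}{2}$, and let $Y\subseteq\mathbb{R}^2$ be a separated net created by $\tau_1$. Then $Y$ is biLipschitz to $\mathbb{Z}^2$; that is, there exist a bijection $f:Y\to\mathbb{Z}^2$ and a constant $L\ge 1$ such that $\frac1L d(x,y)\le d(f(x),f(y))\le L\,d(x,y)$ for all $x,y\in Y$, where $d$ is the Euclidean distance.
   Context: Kites and darts: let $\phi=\frac{1+\sqrt5}{2}$. The kite is the convex quadrilateral with consecutive edge lengths $\phi,1,1,\phi$ and angles $72^\circ$ at the tip (where the two long edges meet), $72^\circ$ at each of the two wings (where a long and a short edge meet), and $144^\circ$ at the tail (where the two short edges meet). The dart is the non-convex quadrilateral with consecutive edge lengths $\phi,1,1,\phi$ and angles $72^\circ$ at the tip (where the two long edges meet), $36^\circ$ at each of the two wings, and $216^\circ$ at the reflex vertex (where the two short edges meet). Label by $H$ the two wings of the kite and the tip and reflex vertex of the dart; label by $T$ the tip and tail of the kite and the two wings of the dart. A Penrose tiling of $\mathbb{R}^2$ (with kites and darts) is a tiling of the plane by congruent copies of the kite and the dart, meeting edge to edge, such that at every vertex of the tiling all the tile corners meeting there carry the same label. A separated net is a discrete set $Y\subseteq\mathbb{R}^2$ for which there are $c_1,c_2>0$ such that $d(x,y)\ge c_1$ for all distinct $x,y\in Y$, and for every $x\in\mathbb{R}^2$ there is $y\in Y$ with $d(x,y)\le c_2$. A separated net created by a tiling (with tiles of bounded diameter) is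 a set obtained by placing exactly one point in each tile, so that the points of different tiles are at distance at least some fixed $c_1>0$. *)

theory Defs
  imports "HOL-Analysis.Analysis"
begin

section \<open>The two prototiles\<close>

definition golden :: real where
  "golden = (1 + sqrt 5) / 2"

datatype tile_kind = Kite | Dart

datatype corner_label = Label_H | Label_T

text \<open>
  Both prototiles have their tip at the origin and the first coordinate axis as axis of symmetry.
  The long edges make the angle 36 degrees with it. Solving the triangle tip--wing--inner vertex
  puts the tail of the kite at distance \<^term>\<open>golden\<close> and the reflex vertex of the dart at
  distance 1 from the tip; the prescribed edge lengths and angles are checked below.
\<close>

definition tip :: "real^2" where
  "tip = vector [0, 0]"

definition wing1 :: "real^2" where
  "wing1 = golden *\<^sub>R vector [cos (pi/5), sin (pi/5)]"

definition wing2 :: "real^2" where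
  "wing2 = golden *\<^sub>R vector [cos (pi/5), - sin (pi/5)]"

definition kite_tail :: "real^2" where
  "kite_tail = vector [golden, 0]"

definition dart_reflex :: "real^2" where
  "dart_reflex = vector [1, 0]"

text \<open>The labelled corners, in cyclic order.\<close>

fun corners :: "tile_kind \<Rightarrow> ((real^2) \<times> corner_label) list" where
  "corners Kite = [(tip, Label_T), (wing1, Label_H), (kite_tail, Label_T), (wing2, Label_H)]"
| "corners Dart = [(tip, Label_H), (wing1, Label_T), (dart_reflex, Label_H), (wing2, Label_T)]"

text \<open>The dart is cut along its axis into two triangles, since it is not convex.\<close>

fun prototile :: "tile_kind \<Rightarrow> (real^2) set" where
  "prototile Kite = convex hull {tip, wing1, kite_tail, wing2}"
| "prototile Dart = convex hull {tip, wing1, dart_reflex} \<union> convex hull {tip, wing2, dart_reflex}"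


section \<open>Copies of the prototiles\<close>

definition plane_isometry :: "(real^2 \<Rightarrow> real^2) \<Rightarrow> bool" where
  "plane_isometry f \<longleftrightarrow> (\<forall>x y. dist (f x) (f y) = dist x y)"

definition is_copy :: "tile_kind \<Rightarrow> (real^2 \<Rightarrow> real^2) \<Rightarrow> (real^2) set \<Rightarrow> bool" where
  "is_copy k f S \<longleftrightarrow> plane_isometry f \<and> S = f ` prototile k"

text \<open>
  A tile is a closed region of the plane. The isometry carrying the prototile to it is unique only
  up to the reflection of the prototile in its axis; that reflection preserves corners, labels and
  edges, so the following notions depend on the region only.
\<close>

definition has_corner :: "(real^2) set \<Rightarrow> real^2 \<Rightarrow> corner_label \<Rightarrow> bool" where
  "has_corner S v l \<longleftrightarrow> (\<exists>k f x. is_copy k f S \<and> (x, l) \<in> set (corners k) \<and> v = f x)"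

definition tile_vertices :: "(real^2) set \<Rightarrow> (real^2) set" where
  "tile_vertices S = {v. \<exists>l. has_corner S v l}"

definition tile_edges :: "(real^2) set \<Rightarrow> (real^2) set set" where
  "tile_edges S =
     {closed_segment (f (fst (corners k ! i))) (f (fst (corners k ! ((i + 1) mod 4)))) | k f i.
        is_copy k f S \<and> i < 4}"


section \<open>Penrose tilings\<close>

definition plane_tiling :: "(real^2) set set \<Rightarrow> bool" where
  "plane_tiling \<tau> \<longleftrightarrow>
     \<Union>\<tau> = UNIV \<and> (\<forall>S\<in>\<tau>. \<forall>S'\<in>\<tau>. S \<noteq> S' \<longrightarrow> interior S \<inter> interior S' = {})"

text \<open>
  Edge to edge: two different tiles meet exactly in their common vertices and common (entire)
  edges, and nowhere else.
\<close>

definition edge_to_edge :: "(real^2) set set \<Rightarrow> bool" where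
  "edge_to_edge \<tau> \<longleftrightarrow>
     (\<forall>S\<in>\<tau>. \<forall>S'\<in>\<tau>. S \<noteq> S' \<longrightarrow>
        S \<inter> S' = (tile_vertices S \<inter> tile_vertices S') \<union> \<Union>(tile_edges S \<inter> tile_edges S'))"

definition labels_match :: "(real^2) set set \<Rightarrow> bool" where
  "labels_match \<tau> \<longleftrightarrow>
     (\<forall>S\<in>\<tau>. \<forall>S'\<in>\<tau>. \<forall>v l l'. has_corner S v l \<and> has_corner S' v l' \<longrightarrow> l = l')"

definition penrose_tiling :: "(real^2) set set \<Rightarrow> bool" where
  "penrose_tiling \<tau> \<longleftrightarrow>
     (\<forall>S\<in>\<tau>. \<exists>k f. is_copy k f S) \<and> plane_tiling \<tau> \<and> edge_to_edge \<tau> \<and> labels_match \<tau>"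


section \<open>Separated nets\<close>

definition separated_net :: "(real^2) set \<Rightarrow> bool" where
  "separated_net Y \<longleftrightarrow>
     (\<exists>c1>0. \<forall>x\<in>Y. \<forall>y\<in>Y. x \<noteq> y \<longrightarrow> c1 \<le> dist x y) \<and>
     (\<exists>c2>0. \<forall>x. \<exists>y\<in>Y. dist x y \<le> c2)"

text \<open>
  The chosen points may lie on the boundary of their tiles. The set obtained is a separated net
  as soon as the tiles cover the plane and have bounded diameter, as proved below.
\<close>

definition net_created_by :: "(real^2) set set \<Rightarrow> (real^2) set \<Rightarrow> bool" where
  "net_created_by \<tau> Y \<longleftrightarrow>
     (\<exists>p. (\<forall>S\<in>\<tau>. p S \<in> S) \<and> Y = p ` \<tau> \<and>
        (\<exists>c1>0. \<forall>S\<in>\<tau>. \<forall>S'\<in>\<tau>. S \<noteq> S' \<longrightarrow> c1 \<le> dist (p S) (p S')))"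

definition integer_lattice :: "(real^2) set" where
  "integer_lattice = {v. \<forall>i. v $ i \<in> \<int>}"


section \<open>Consistency checks\<close>

definition corner_angle :: "real^2 \<Rightarrow> real^2 \<Rightarrow> real^2 \<Rightarrow> real" where
  "corner_angle a b c = arccos ((a - b) \<bullet> (c - b) / (dist a b * dist c b))"

lemma golden_pos: "golden > 1"
  unfolding golden_def by (simp add: real_less_rsqrt)

lemma golden_sq: "golden * golden = golden + 1"
  unfolding golden_def by (simp add: field_simps)

lemma cos_pi_5: "cos (pi/5) = golden / 2"
proof -
  define c where "c = cos (pi/5)"
  have c0: "c > 0" unfolding c_def by (intro cos_gt_zero) auto
  have "3 * (pi/5) = pi - 2 * (pi/5)" by simp
  hence "cos (3 * (pi/5)) = - cos (2 * (pi/5))" by (simp only: cos_pi_minus)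
  hence "4 * c^3 - 3 * c = - (2 * c^2 - 1)"
    unfolding c_def by (simp only: cos_treble_cos cos_double_cos)
  hence "(c + 1) * (4 * c^2 - 2 * c - 1) = 0" by algebra
  hence "4 * c^2 - 2 * c - 1 = 0" using c0 by simp
  moreover have "4 * (golden/2)^2 - 2 * (golden/2) - 1 = 0"
    using golden_sq by (simp add: power2_eq_square field_simps)
  ultimately have "(c - golden/2) * (4 * c + 2 * golden - 2) = 0"
    by (simp add: algebra_simps power2_eq_square)
  moreover have "4 * c + 2 * golden - 2 > 0" using c0 golden_pos by simp
  ultimately show ?thesis unfolding c_def by simp
qed

lemma cos_2pi_5: "cos (2*pi/5) = (golden - 1) / 2"
  using cos_double_cos[of "pi/5"] golden_sq by (simp add: cos_pi_5 power2_eq_square)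

lemma cos_4pi_5: "cos (4*pi/5) = - golden / 2"
proof -
  have "4*pi/5 = pi - pi/5" by simp
  thus ?thesis by (simp only: cos_pi_minus cos_pi_5)
qed

lemma sin_sq_pi_5: "4 * (sin (pi/5) * sin (pi/5)) = 3 - golden"
  using sin_squared_eq[of "pi/5"] golden_sq by (simp add: cos_pi_5 power2_eq_square field_simps)

lemma dist_eqI: "dist x y = r" if "(x - y) \<bullet> (x - y) = r * r" "r \<ge> 0" for x y :: "real^2"
  using that by (simp add: dist_norm norm_eq_sqrt_inner)

lemma corner_angleI:
  "corner_angle a b c = t"
  if "(a - b) \<bullet> (c - b) = cos t * (dist a b * dist c b)" "dist a b > 0" "dist c b > 0" "0 \<le> t" "t \<le> pi"
  using that by (simp add: corner_angle_def arccos_cos)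

lemmas plane_simps = tip_def wing1_def wing2_def kite_tail_def dart_reflex_def
  inner_vec_def sum_2 cos_pi_5

lemma edge_lengths:
  "dist tip wing1 = golden" "dist tip wing2 = golden"
  "dist wing1 kite_tail = 1" "dist wing2 kite_tail = 1"
  "dist wing1 dart_reflex = 1" "dist wing2 dart_reflex = 1"
proof -
  note facts = golden_sq sin_sq_pi_5
  show "dist tip wing1 = golden"
    by (rule dist_eqI, simp add: plane_simps field_simps, use facts in algebra, use golden_pos in simp)
  show "dist tip wing2 = golden"
    by (rule dist_eqI, simp add: plane_simps field_simps, use facts in algebra, use golden_pos in simp)
  show "dist wing1 kite_tail = 1"
    by (rule dist_eqI, simp add: plane_simps field_simps, use facts in algebra, simp)
  show "dist wing2 kite_tail = 1"
    by (rule dist_eqI, simp add: plane_simps field_simps, use facts in algebra, simp)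
  show "dist wing1 dart_reflex = 1"
    by (rule dist_eqI, simp add: plane_simps field_simps, use facts in algebra, simp)
  show "dist wing2 dart_reflex = 1"
    by (rule dist_eqI, simp add: plane_simps field_simps, use facts in algebra, simp)
qed

text \<open>
  \<^const>\<open>corner_angle\<close> takes values up to 180 degrees, so at the reflex vertex of the dart it
  gives the exterior angle 144 = 360 - 216.
\<close>

lemma corner_angles:
  "corner_angle wing1 tip wing2 = 2*pi/5"
  "corner_angle tip wing1 kite_tail = 2*pi/5"
  "corner_angle tip wing2 kite_tail = 2*pi/5"
  "corner_angle wing1 kite_tail wing2 = 4*pi/5"
  "corner_angle tip wing1 dart_reflex = pi/5"
  "corner_angle tip wing2 dart_reflex = pi/5"
  "corner_angle wing1 dart_reflex wing2 = 4*pi/5"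
proof -
  note facts = golden_sq sin_sq_pi_5
  note lens = edge_lengths trans[OF dist_commute edge_lengths(1)] trans[OF dist_commute edge_lengths(2)]
    trans[OF dist_commute edge_lengths(3)] trans[OF dist_commute edge_lengths(4)]
    trans[OF dist_commute edge_lengths(5)] trans[OF dist_commute edge_lengths(6)]
  have pos: "golden > 0" using golden_pos by simp
  note simps = lens cos_2pi_5 cos_4pi_5
  show "corner_angle wing1 tip wing2 = 2*pi/5"
    by (rule corner_angleI, simp only: simps, simp add: plane_simps field_simps, use facts in algebra,
        simp_all add: lens pos)
  show "corner_angle tip wing1 kite_tail = 2*pi/5"
    by (rule corner_angleI, simp only: simps, simp add: plane_simps field_simps, use facts in algebra,
        simp_all add: lens pos)
  show "corner_angle tip wing2 kite_tail = 2*pi/5"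
    by (rule corner_angleI, simp only: simps, simp add: plane_simps field_simps, use facts in algebra,
        simp_all add: lens pos)
  show "corner_angle wing1 kite_tail wing2 = 4*pi/5"
    by (rule corner_angleI, simp only: simps, simp add: plane_simps field_simps, use facts in algebra,
        simp_all add: lens pos)
  show "corner_angle tip wing1 dart_reflex = pi/5"
    by (rule corner_angleI, simp only: simps, simp add: plane_simps field_simps, use facts in algebra,
        simp_all add: lens pos)
  show "corner_angle tip wing2 dart_reflex = pi/5"
    by (rule corner_angleI, simp only: simps, simp add: plane_simps field_simps, use facts in algebra,
        simp_all add: lens pos)
  show "corner_angle wing1 dart_reflex wing2 = 4*pi/5"
    by (rule corner_angleI, simp only: simps, simp add: plane_simps field_simps, use facts in algebra,
        simp_all add: lens pos)
qed

lemma net_created_by_imp_separated_net: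
  assumes "net_created_by \<tau> Y" "\<Union>\<tau> = UNIV"
    and diam: "\<And>S x y. S \<in> \<tau> \<Longrightarrow> x \<in> S \<Longrightarrow> y \<in> S \<Longrightarrow> dist x y \<le> D"
  shows "separated_net Y"
proof -
  obtain p c where p: "\<And>S. S \<in> \<tau> \<Longrightarrow> p S \<in> S" and Y: "Y = p ` \<tau>" and c: "c > 0"
    and sep: "\<And>S S'. S \<in> \<tau> \<Longrightarrow> S' \<in> \<tau> \<Longrightarrow> S \<noteq> S' \<Longrightarrow> c \<le> dist (p S) (p S')"
    using assms(1) unfolding net_created_by_def by metis
  have 1: "\<forall>x\<in>Y. \<forall>y\<in>Y. x \<noteq> y \<longrightarrow> c \<le> dist x y"
    unfolding Y using sep by blast
  have 2: "\<exists>y\<in>Y. dist x y \<le> max D 1" for x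
  proof -
    obtain S where "S \<in> \<tau>" "x \<in> S" using assms(2) by blast
    hence "dist x (p S) \<le> D" using diam p by blast
    thus ?thesis using \<open>S \<in> \<tau>\<close> unfolding Y by (intro bexI[of _ "p S"]) auto
  qed
  have "max D 1 > 0" by simp
  with 1 2 c show ?thesis unfolding separated_net_def by blast
qed

end

theory Submission
  imports Defs
begin

text \<open>
  The matching rules force the tiles to group into kites and darts larger by the factor \<open>\<phi>\<close>, which
  obey the same rules. Put the charge \<open>1\<close> on kites and \<open>-\<phi>\<close> on darts: the total charge of a tile of the
  \<open>n\<close>-th generation is \<open>\<phi> ^ (-2n)\<close> times its own charge, so carrying all charges up the generations needs only
  a flow of size \<open>O(M)\<close> through the sides of the squares of a grid of mesh \<open>M\<close>. As the number of
  tiles is a combination of charge and area, every square contains \<open>\<alpha> M\<^sup>2\<close> tiles up to the divergence of a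
  flow of size \<open>O(M)\<close>. For large \<open>M\<close> this is small compared to \<open>\<alpha> M\<^sup>2\<close>, so that after
  rounding the flow, the points can be moved between neighbouring squares until each contains
  exactly \<open>\<alpha> M\<^sup>2\<close> of them. Hence \<open>Y\<close> is a bounded displacement of a lattice, and a bounded
  displacement between separated sets is biLipschitz.
\<close>

section \<open>Half tiles in complex coordinates\<close>

text \<open>Frequencies of the two tiles do not suffice: the number of tiles in every block must be
  known up to an error of the order of its boundary. On half tiles the substitution has the matrix
  with rows (2,1), (1,1), with eigenvalues \<phi>^2 and \<phi>^(-2); area is the eigenvector for the
  former, charge for the latter. Area is balanced by moves of bounded length. Charge has to travel
  distances of order \<phi>^n in generation n, but only O(M / \<phi>^n + 1) half tiles are that near
  to a side of a block. So each generation costs O(M) before its factor \<phi>^(-2n), and the costs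
  form a geometric series.

  No tile of a finite generation is assumed to contain a given bounded region, so the transport need
  not end after finitely many generations. Instead the charge left in a block after n generations is
  at most O(M^2) \<phi>^(-2n) and vanishes in the limit.

  Half tiles carry the hierarchy because the two halves of a dart can belong to different larger
  tiles.\<close>

abbreviation G :: complex where "G \<equiv> complex_of_real golden"

definition turns :: "complex set" where
  "turns = {cis (pi/5), cnj (cis (pi/5))}"

text \<open>
  The tile \<open>(k, z, w)\<close> has its tip at \<open>z\<close>; its axis leaves the tip in direction \<open>w\<close>, and \<open>norm w\<close> is its
  scale. Its wings are \<open>z + G w \<eta>\<close> with \<open>\<eta> \<in> turns\<close>, its remaining vertex is \<open>z + G w\<close> for a kite and
  \<open>z + w\<close> for a dart. The cell of \<open>\<eta>\<close> is the half of the tile on the side of the wing \<open>z + G w \<eta>\<close>.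
  Since \<open>\<eta>\<^sup>2 = G \<eta> - 1\<close> and \<open>G\<^sup>2 = G + 1\<close>, all positions that occur are of the form
  \<open>z + w (p + q \<eta>)\<close> with \<open>p, q \<in> \<int>[G]\<close>, and \<open>G - \<eta>\<close> is the inverse of \<open>\<eta>\<close>.
\<close>

type_synonym tile = "tile_kind \<times> complex \<times> complex"

text \<open>With coordinates a along the axis and b along the wing direction, the short edge lies on
  the line \<open>slope k * a + b = golden\<close>. It ends at the wing, b = golden, and at the
  inner vertex, a = golden for a kite and a = 1 for a dart.\<close>

fun slope :: "tile_kind \<Rightarrow> real" where
  "slope Kite = 1" | "slope Dart = golden"

fun cell :: "tile \<Rightarrow> complex \<Rightarrow> complex set" where
  "cell (k, z, w) \<eta> =
     {z + w * (of_real a + of_real b * \<eta>) | a b. 0 \<le> a \<and> 0 \<le> b \<and> slope k * a + b \<le> golden}"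

fun open_cell :: "tile \<Rightarrow> complex \<Rightarrow> complex set" where
  "open_cell (k, z, w) \<eta> =
     {z + w * (of_real a + of_real b * \<eta>) | a b. 0 < a \<and> 0 < b \<and> slope k * a + b < golden}"

lemma golden_bounds: "1.6 < golden" "golden < 1.62"
proof -
  have "2.2 < sqrt 5" by (rule real_less_rsqrt) (simp add: power2_eq_square)
  moreover have "sqrt 5 < 2.24" by (rule real_less_lsqrt) (simp_all add: power2_eq_square)
  ultimately show "1.6 < golden" "golden < 1.62" unfolding golden_def by simp_all
qed

lemma slope_pos: "slope k > 0"
  using golden_pos by (cases k) auto

lemma G_sq: "G * G = G + 1"
  using golden_sq by (metis of_real_1 of_real_add of_real_mult)

lemma G_nonzero: "G \<noteq> 0"
  using golden_pos by simp

lemma turn_Re: "\<eta> \<in> turns \<Longrightarrow> Re \<eta> = golden / 2"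
  unfolding turns_def by (auto simp: cos_pi_5)

lemma turn_Im: "\<eta> \<in> turns \<Longrightarrow> 4 * (Im \<eta> * Im \<eta>) = 3 - golden"
  unfolding turns_def using sin_sq_pi_5 by auto

lemma turn_norm: "\<eta> \<in> turns \<Longrightarrow> norm \<eta> = 1"
  unfolding turns_def by auto

lemma turn_Im_abs: assumes "\<eta> \<in> turns" shows "1/2 < \<bar>Im \<eta>\<bar>"
proof -
  have "(1/2)\<^sup>2 < (Im \<eta>)\<^sup>2" using turn_Im[OF assms] golden_bounds by (simp add: power2_eq_square)
  thus ?thesis by (metis abs_le_square_iff abs_of_pos half_gt_zero_iff less_numeral_extra(1) linorder_not_less)
qed

lemma turn_Im_nonzero: "\<eta> \<in> turns \<Longrightarrow> Im \<eta> \<noteq> 0"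
  using turn_Im_abs by fastforce

lemma turn_nonzero: "\<eta> \<in> turns \<Longrightarrow> \<eta> \<noteq> 0"
  using turn_norm by force

lemma turn_sq: assumes "\<eta> \<in> turns" shows "\<eta> * \<eta> = G * \<eta> - 1"
proof -
  have "Re \<eta> * Re \<eta> - Im \<eta> * Im \<eta> = golden * Re \<eta> - 1"
    using turn_Im[OF assms] golden_sq unfolding turn_Re[OF assms] by (simp add: field_simps)
  moreover have "2 * (Re \<eta> * Im \<eta>) = golden * Im \<eta>" unfolding turn_Re[OF assms] by simp
  ultimately show ?thesis by (simp add: complex_eq_iff)
qed

lemma golden_rules: "golden * golden = golden + 1" "golden * (golden * x) = golden * x + x"
  using golden_sq by (simp, metis (no_types) distrib_right mult.assoc mult_1)

text \<open>Used as rewrite rules, the quadratic relations reduce polynomial expressions in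
  \<open>\<eta>\<close> and \<open>G\<close> to degree at most one in each, so that identities
  between positions become visible. The variants with a trailing \<open>x\<close> serve products
  nested to the right by \<open>algebra_simps\<close>.\<close>

lemma turn_rules:
  assumes "\<eta> \<in> turns"
  shows "\<eta> * \<eta> = G * \<eta> - 1" "\<eta> * (\<eta> * x) = G * (\<eta> * x) - x"
    "G * G = G + 1" "G * (G * x) = G * x + x"
  by (simp_all add: turn_sq[OF assms] G_sq left_diff_distrib distrib_right mult.assoc flip: mult.assoc)

lemma turn_cnj: assumes "\<eta> \<in> turns" shows "cnj \<eta> = G - \<eta>"
  using turn_Re[OF assms] by (auto simp: complex_eq_iff)

lemma turn_other: assumes "\<eta> \<in> turns" shows "G - \<eta> \<in> turns" "G - \<eta> \<noteq> \<eta>"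
proof -
  show "G - \<eta> \<in> turns" using assms unfolding turn_cnj[OF assms, symmetric] turns_def by auto
  show "G - \<eta> \<noteq> \<eta>" unfolding turn_cnj[OF assms, symmetric]
    using turn_Im_nonzero[OF assms] by (auto simp: complex_eq_iff)
qed

lemma turn_cases: assumes "\<eta> \<in> turns" "\<theta> \<in> turns" shows "\<theta> = \<eta> \<or> \<theta> = G - \<eta>"
  using assms unfolding turn_cnj[OF assms(1), symmetric] turns_def by auto

lemma ball_turns: assumes "\<eta> \<in> turns" shows "(\<forall>\<theta>\<in>turns. Q \<theta>) \<longleftrightarrow> Q \<eta> \<and> Q (G - \<eta>)"
  using turn_cases[OF assms] turn_other[OF assms] assms by blast

lemma turns_eq: assumes "\<eta> \<in> turns" shows "turns = {\<eta>, G - \<eta>}"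
  using turn_cases[OF assms] turn_other[OF assms] assms by blast

lemma finite_turns: "finite turns" "card turns = 2"
proof -
  have "cis (pi/5) \<in> turns" by (simp add: turns_def)
  note * = turns_eq[OF this] turn_other(2)[OF this]
  show "finite turns" unfolding *(1) by simp
  show "card turns = 2" unfolding *(1) using *(2) by simp
qed

section \<open>Cells\<close>

lemma cell_coords:
  assumes "w \<noteq> 0" "\<eta> \<in> turns"
  shows "x = z + w * (of_real a + of_real b * \<eta>) \<longleftrightarrow>
    b = Im ((x - z) / w) / Im \<eta> \<and> a = Re ((x - z) / w) - Im ((x - z) / w) / Im \<eta> * Re \<eta>"
proof -
  define y where "y = (x - z) / w"
  have "x = z + w * (of_real a + of_real b * \<eta>) \<longleftrightarrow> y = of_real a + of_real b * \<eta>"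
    unfolding y_def using assms(1) by (auto simp: field_simps)
  also have "\<dots> \<longleftrightarrow> b = Im y / Im \<eta> \<and> a = Re y - Im y / Im \<eta> * Re \<eta>"
  proof -
    define i where "i = Im \<eta>"
    have "i \<noteq> 0" using turn_Im_nonzero[OF assms(2)] by (simp add: i_def)
    hence "Im y = b * i \<longleftrightarrow> b = Im y / i" by (auto simp: field_simps)
    thus ?thesis by (auto simp: complex_eq_iff i_def)
  qed
  finally show ?thesis unfolding y_def .
qed

lemma coords_inj:
  assumes "w \<noteq> 0" "\<eta> \<in> turns"
    "z + w * (of_real a + of_real b * \<eta>) = z + w * (of_real a' + of_real b' * \<eta>)"
  shows "a = a'" "b = b'"
  using cell_coords[OF assms(1,2), of "z + w * (of_real a + of_real b * \<eta>)" z a b]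
    cell_coords[OF assms(1,2), of "z + w * (of_real a + of_real b * \<eta>)" z a' b'] assms(3) by auto

lemma cell_alt:
  assumes "w \<noteq> 0" "\<eta> \<in> turns"
  shows "cell (k, z, w) \<eta> = {x. 0 \<le> Re ((x - z) / w) - Im ((x - z) / w) / Im \<eta> * Re \<eta> \<and>
      0 \<le> Im ((x - z) / w) / Im \<eta> \<and>
      slope k * (Re ((x - z) / w) - Im ((x - z) / w) / Im \<eta> * Re \<eta>) + Im ((x - z) / w) / Im \<eta> \<le> golden}"
    "open_cell (k, z, w) \<eta> = {x. 0 < Re ((x - z) / w) - Im ((x - z) / w) / Im \<eta> * Re \<eta> \<and>
      0 < Im ((x - z) / w) / Im \<eta> \<and>
      slope k * (Re ((x - z) / w) - Im ((x - z) / w) / Im \<eta> * Re \<eta>) + Im ((x - z) / w) / Im \<eta> < golden}"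
  unfolding cell.simps open_cell.simps cell_coords[OF assms] by auto

lemma closed_cell: assumes "w \<noteq> 0" "\<eta> \<in> turns" shows "closed (cell (k, z, w) \<eta>)"
  unfolding cell_alt[OF assms] using assms(1)
  by (intro closed_Collect_conj closed_Collect_le continuous_intros) (use turn_Im_nonzero[OF assms(2)] in auto)

lemma open_open_cell: assumes "w \<noteq> 0" "\<eta> \<in> turns" shows "open (open_cell (k, z, w) \<eta>)"
  unfolding cell_alt[OF assms] using assms(1)
  by (intro open_Collect_conj open_Collect_less continuous_intros) (use turn_Im_nonzero[OF assms(2)] in auto)

lemma open_cell_interior: 
  assumes "w \<noteq> 0" "\<eta> \<in> turns" shows "open_cell (k, z, w) \<eta> \<subseteq> interior (cell (k, z, w) \<eta>)"
  by (rule interior_maximal[OF _ open_open_cell[OF assms]]) fastforce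

section \<open>Matched families of tiles\<close>


lemma mem_cong: "(k, z, w) \<in> P \<Longrightarrow> z = z' \<Longrightarrow> w = w' \<Longrightarrow> (k, z', w') \<in> P"
  by simp

text \<open>Disjointness is imposed on halves, including the two halves of one tile, because the
  hierarchy and the counting of tiles work with half tiles.\<close>

locale packed =
  fixes r :: real and P :: "tile set"
  assumes r_pos: "r > 0"
    and size: "(k, z, w) \<in> P \<Longrightarrow> norm w = r"
    and disjoint: "T \<in> P \<Longrightarrow> T' \<in> P \<Longrightarrow> \<eta> \<in> turns \<Longrightarrow> \<theta> \<in> turns \<Longrightarrow> (T, \<eta>) \<noteq> (T', \<theta>) \<Longrightarrow>
      interior (cell T \<eta>) \<inter> interior (cell T' \<theta>) = {}"
begin

lemma w_nonzero: "(k, z, w) \<in> P \<Longrightarrow> w \<noteq> 0"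
  using size r_pos by force

lemma overlap_False:
  assumes "(k, z, w) \<in> P" "(k', z', w') \<in> P" "\<eta> \<in> turns" "\<theta> \<in> turns" "(k, z, w, \<eta>) \<noteq> (k', z', w', \<theta>)"
    and a: "0 < a" "0 < b" "slope k * a + b < golden" and a': "0 < a'" "0 < b'" "slope k' * a' + b' < golden"
    and eq: "z + w * (of_real a + of_real b * \<eta>) = z' + w' * (of_real a' + of_real b' * \<theta>)"
  shows False
proof -
  let ?x = "z + w * (of_real a + of_real b * \<eta>)"
  have "?x \<in> open_cell (k, z, w) \<eta>" using a by auto
  moreover have "?x \<in> open_cell (k', z', w') \<theta>" unfolding eq using a' by auto
  ultimately have "?x \<in> interior (cell (k, z, w) \<eta>) \<inter> interior (cell (k', z', w') \<theta>)"
    using open_cell_interior w_nonzero[OF assms(1)] w_nonzero[OF assms(2)] assms(3,4) by blast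
  with disjoint[OF assms(1-4)] assms(5) show False by blast
qed

text \<open>
  The coordinates below are those of a common interior point of two tiles that would overlap.
\<close>

lemma no_overlap_long:
  assumes t: "\<eta> \<in> turns" and m: "(Kite, z, w * \<eta> * \<eta>) \<in> P" "(Dart, z + G * w * \<eta>, - w) \<in> P"
  shows False
  by (rule overlap_False[OF m turn_other(1)[OF t] turn_other(1)[OF t], of "1" "2 - golden" "2 - golden" "2 - golden"])
    (use golden_bounds in \<open>simp_all add: field_simps golden_rules turn_rules[OF t]\<close>)

text \<open>The two possible neighbours of a kite across a short edge exclude each other; the
  uniqueness of parents rests on this.\<close>

lemma no_overlap_short:
  assumes t: "\<eta> \<in> turns" and m: "(Kite, z + G * w + G * w * \<eta>, - w * \<eta>) \<in> P" "(Dart, z + G * G * w * \<eta>, - w * \<eta>) \<in> P"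
  shows False
  by (rule overlap_False[OF m turn_other(1)[OF t] t, of "golden - 3/2" "golden - 1/2" "golden/2 - 1/2" "1/2"])
    (use golden_bounds in \<open>simp_all add: field_simps golden_rules turn_rules[OF t]\<close>)

lemma no_overlap_dart_dart:
  assumes t: "\<eta> \<in> turns" and m: "(Dart, z, w) \<in> P" "(Dart, z + w + w * (G - \<eta>), - w * (G - \<eta>)) \<in> P"
  shows False
  by (rule overlap_False[OF m turn_other(1)[OF t] t, of "4/3 - 2/3 * golden" "2/3" "1/3" "2/3 * golden - 1/3"])
    (use golden_bounds turn_other(2)[OF t] in \<open>simp_all add: field_simps golden_rules turn_rules[OF t]\<close>)

text \<open>Both kites would be neighbours of the kite \<open>(Kite, z, w)\<close> across its short
  edges, so that three angles of 144 degrees would meet at a common tail.\<close>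

lemma no_overlap_three_kites:
  assumes t: "\<eta> \<in> turns" and m: "(Kite, z + G * w + G * w * \<eta>, - w * \<eta>) \<in> P" "(Kite, z + G * w + G * w * (G - \<eta>), - w * (G - \<eta>)) \<in> P"
  shows False
  by (rule overlap_False[OF m t turn_other(1)[OF t], of "1" "2 - golden" "1" "2 - golden"])
    (use golden_bounds turn_other(2)[OF t] in \<open>simp_all add: field_simps golden_rules turn_rules[OF t]\<close>)

text \<open>The tail of one kite is the tip of the other. There the angles of 144 and 72 degrees
  overlap, since their bisectors are only 72 degrees apart.\<close>

lemma no_overlap_kite_tip_tail:
  assumes t: "\<eta> \<in> turns" and m: "(Kite, z + G * G * w * \<eta> - G * w, w) \<in> P" "(Kite, z + G * G * w * \<eta>, - (w * \<eta> * \<eta>)) \<in> P"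
  shows False
  by (rule overlap_False[OF m turn_other(1)[OF t] turn_other(1)[OF t], of "golden/2 - 1/2" "golden - 1/2" "1/2" "golden/2 - 1/2"])
    (use golden_bounds G_nonzero w_nonzero[OF m(1)] in \<open>simp_all add: field_simps golden_rules turn_rules[OF t]\<close>)

lemma no_overlap_wing_tail:
  assumes t: "\<eta> \<in> turns" and m: "(Kite, z + G * G * w * \<eta> - G * G * w * \<eta> * \<eta> * \<eta>, w * \<eta> * \<eta> * \<eta> * \<eta>) \<in> P" "(Dart, z + G * G * w * (G - \<eta>), - (w * (G - \<eta>))) \<in> P"
  shows False
  by (rule overlap_False[OF m t turn_other(1)[OF t], of "golden - 1" "2 * golden - 5/2" "1 - golden/2" "5/2 - golden"])
    (use golden_bounds in \<open>simp_all add: field_simps golden_rules turn_rules[OF t]\<close>)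

text \<open>A common edge alone leaves open on which side of it the second tile lies. Here, and in
  the companion for short edges, the wrong side is excluded for a kite and a dart.\<close>

lemma no_overlap_same_side_long:
  assumes t: "\<eta> \<in> turns" and m: "(Kite, z, w) \<in> P" "(Dart, z + G * w * \<eta>, - (w * \<eta> * \<eta>)) \<in> P"
  shows False
  by (rule overlap_False[OF m t turn_other(1)[OF t], of "1/2" "1/2" "1/2" "golden/2 - 1/2"])
    (use golden_bounds in \<open>simp_all add: field_simps golden_rules turn_rules[OF t]\<close>)

lemma no_overlap_same_side_short:
  assumes t: "\<eta> \<in> turns" and m: "(Kite, z, w) \<in> P" "(Dart, z + G * w * \<eta> - w, w) \<in> P"
  shows False
  by (rule overlap_False[OF m t turn_other(1)[OF t], of "1/2" "1" "1/2" "golden - 1"])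
    (use golden_bounds in \<open>simp_all add: field_simps golden_rules turn_rules[OF t]\<close>)

end

section \<open>Inflation\<close>

text \<open>
  A kite of scale \<open>G |u|\<close> consists of two kites of scale \<open>|u|\<close> whose tips are its wings, and of
  two half darts at its tip; a dart of scale \<open>G |u|\<close> consists of a kite with the same tip and of two half darts
  whose tips are its wings. The half darts of an inflated kite are forced by its kites.
\<close>

definition inflate :: "tile set \<Rightarrow> tile set" where
  "inflate P =
     {(Kite, z, G * u) | z u. \<forall>\<eta>\<in>turns. (Kite, z + G * G * u * \<eta>, - (u * \<eta> * \<eta>)) \<in> P} \<union>
     {(Dart, z, G * u) | z u. (Kite, z, u) \<in> P \<and> (\<forall>\<eta>\<in>turns. (Dart, z + G * G * u * \<eta>, - (u * \<eta>)) \<in> P)}"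

lemma inflate_kite:
  "(Kite, z, G * u) \<in> inflate P \<longleftrightarrow> (\<forall>\<eta>\<in>turns. (Kite, z + G * G * u * \<eta>, - (u * \<eta> * \<eta>)) \<in> P)"
  unfolding inflate_def using G_nonzero by auto

lemma inflate_dart:
  "(Dart, z, G * u) \<in> inflate P \<longleftrightarrow>
     (Kite, z, u) \<in> P \<and> (\<forall>\<eta>\<in>turns. (Dart, z + G * G * u * \<eta>, - (u * \<eta>)) \<in> P)"
  unfolding inflate_def using G_nonzero by auto

lemma inflate_kiteI:
  assumes "\<eta> \<in> turns" "(Kite, z + G * G * u * \<eta>, - (u * \<eta> * \<eta>)) \<in> P"
    "(Kite, z + G * G * u * (G - \<eta>), - (u * (G - \<eta>) * (G - \<eta>))) \<in> P" "W = G * u"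
  shows "(Kite, z, W) \<in> inflate P"
  unfolding assms(4) inflate_kite ball_turns[OF assms(1)] using assms by simp

lemma inflate_dartI:
  assumes "\<eta> \<in> turns" "(Kite, z, u) \<in> P" "(Dart, z + G * G * u * \<eta>, - (u * \<eta>)) \<in> P"
    "(Dart, z + G * G * u * (G - \<eta>), - (u * (G - \<eta>))) \<in> P" "W = G * u"
  shows "(Dart, z, W) \<in> inflate P"
  unfolding assms(5) inflate_dart ball_turns[OF assms(1)] using assms by simp

lemma scale_G: "\<exists>u. W = G * u"
  using G_nonzero by (intro exI[of _ "W / G"]) simp

text \<open>
  The neighbours of a tile across an edge, as allowed by the labels: across the long edge with wing
  \<open>\<eta>\<close>, and across the short edge with that wing. Two darts cannot share a short edge, since their
  angles of 216 degrees overlap.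
\<close>

locale matched = packed +
  assumes kite_long: "(Kite, z, w) \<in> P \<Longrightarrow> \<eta> \<in> turns \<Longrightarrow>
      (Kite, z, w * \<eta> * \<eta>) \<in> P \<or> (Dart, z + G * w * \<eta>, - w) \<in> P"
    and dart_long: "(Dart, z, w) \<in> P \<Longrightarrow> \<eta> \<in> turns \<Longrightarrow>
      (Dart, z, w * \<eta> * \<eta>) \<in> P \<or> (Kite, z + G * w * \<eta>, - w) \<in> P"
    and kite_short: "(Kite, z, w) \<in> P \<Longrightarrow> \<eta> \<in> turns \<Longrightarrow>
      (Kite, z + G * w + G * w * \<eta>, - w * \<eta>) \<in> P \<or> (Dart, z + G * G * w * \<eta>, - w * \<eta>) \<in> P"
    and dart_short: "(Dart, z, w) \<in> P \<Longrightarrow> \<eta> \<in> turns \<Longrightarrow> (Kite, z + G * G * w, - w * (G - \<eta>)) \<in> P"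
begin

section \<open>Inheritance of the matching rules by the inflated family\<close>

lemma kite_two_shorts:
  assumes "(Kite, z, w) \<in> P" "\<eta> \<in> turns" "(Kite, z + G * w + G * w * \<eta>, - w * \<eta>) \<in> P"
  shows "(Dart, z + G * G * w * (G - \<eta>), - w * (G - \<eta>)) \<in> P"
  using kite_short[OF assms(1) turn_other(1)[OF assms(2)]] no_overlap_three_kites[OF assms(2,3)] by blast

text \<open>The two kites of an inflated kite share a short edge, so by
  \<open>kite_two_shorts\<close> each has a dart across its other short edge. The tip of that dart
  is the tip of the inflated kite.\<close>

lemma inflate_kite_dart:
  assumes t: "\<eta> \<in> turns" and m: "(Kite, z, G * u) \<in> inflate P"
  shows "(Dart, z, u * \<eta>) \<in> P"
proof -
  have k: "(Kite, z + G * G * u * \<eta>, - (u * \<eta> * \<eta>)) \<in> P"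
    "(Kite, z + G * G * u * (G - \<eta>), - (u * (G - \<eta>) * (G - \<eta>))) \<in> P"
    using m t turn_other(1)[OF t] unfolding inflate_kite by blast+
  have "(Dart, z + G * G * u * \<eta> + G * G * (- (u * \<eta> * \<eta>)) * (G - \<eta>), - (- (u * \<eta> * \<eta>)) * (G - \<eta>)) \<in> P"
    by (rule kite_two_shorts[OF k(1) t mem_cong[OF k(2)]]; simp add: algebra_simps turn_rules[OF t])
  thus ?thesis by (rule mem_cong; simp add: algebra_simps turn_rules[OF t])
qed

text \<open>The dart that straddles the long side of the inflated kite has a kite \<open>k\<close>
  beyond it. The tile across the other short edge of \<open>k\<close> decides: a dart makes
  \<open>k\<close> the kite of an inflated dart, a kite makes the pair an inflated kite. The long
  side of an inflated dart is treated in the same way.\<close>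

lemma inflate_kite_long:
  assumes m: "(Kite, z, W) \<in> inflate P" and t: "\<eta> \<in> turns"
  shows "(Kite, z, W * \<eta> * \<eta>) \<in> inflate P \<or> (Dart, z + G * W * \<eta>, - W) \<in> inflate P"
proof -
  obtain u where W: "W = G * u" using scale_G by blast
  note t' = turn_other(1)[OF t] and R = turn_rules[OF t]
  have d: "(Dart, z, u * \<eta>) \<in> P" using inflate_kite_dart[OF t] m W by simp
  have k: "(Kite, z + G * G * u * \<eta>, - u) \<in> P"
    by (rule mem_cong[OF dart_short[OF d t]]; simp add: algebra_simps R)
  from kite_short[OF k t'] show ?thesis
  proof
    assume a: "(Dart, z + G * G * u * \<eta> + G * G * - u * (G - \<eta>), - (- u) * (G - \<eta>)) \<in> P"
    have "(Dart, z + G * G * u * \<eta>, - W) \<in> inflate P"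
      by (rule inflate_dartI[OF t k mem_cong[OF d] mem_cong[OF a]]; simp add: algebra_simps R W)
    thus ?thesis using W by (simp add: algebra_simps)
  next
    assume a: "(Kite, z + G * G * u * \<eta> + G * - u + G * - u * (G - \<eta>), - (- u) * (G - \<eta>)) \<in> P"
    have "(Kite, z, W * \<eta> * \<eta>) \<in> inflate P"
      by (rule inflate_kiteI[OF t mem_cong[OF a] mem_cong[OF k], of _ "u * \<eta> * \<eta>"]; simp add: algebra_simps R W)
    thus ?thesis ..
  qed
qed

lemma inflate_dart_long:
  assumes m: "(Dart, z, W) \<in> inflate P" and t: "\<eta> \<in> turns"
  shows "(Dart, z, W * \<eta> * \<eta>) \<in> inflate P \<or> (Kite, z + G * W * \<eta>, - W) \<in> inflate P"
proof -
  obtain u where W: "W = G * u" using scale_G by blast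
  note t' = turn_other(1)[OF t] and R = turn_rules[OF t]
  have d: "(Dart, z + G * G * u * \<eta>, - (u * \<eta>)) \<in> P" using m t unfolding W inflate_dart by blast
  have k: "(Kite, z, u * \<eta> * \<eta>) \<in> P"
    by (rule mem_cong[OF dart_short[OF d t']]; simp add: algebra_simps R)
  from kite_short[OF k t] show ?thesis
  proof
    assume a: "(Dart, z + G * G * (u * \<eta> * \<eta>) * \<eta>, - (u * \<eta> * \<eta>) * \<eta>) \<in> P"
    have "(Dart, z, W * \<eta> * \<eta>) \<in> inflate P"
      by (rule inflate_dartI[OF t k mem_cong[OF a] mem_cong[OF d]]; simp add: algebra_simps R W)
    thus ?thesis ..
  next
    assume a: "(Kite, z + G * (u * \<eta> * \<eta>) + G * (u * \<eta> * \<eta>) * \<eta>, - (u * \<eta> * \<eta>) * \<eta>) \<in> P"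
    have "(Kite, z + G * W * \<eta>, - W) \<in> inflate P"
      by (rule inflate_kiteI[OF t mem_cong[OF k] mem_cong[OF a], of _ "- u"]; simp add: algebra_simps R W)
    thus ?thesis ..
  qed
qed

text \<open>The short side of an inflated kite is a long edge of its kite \<open>k(1)\<close>. The
  kite and the dart that \<open>kite_long\<close> allows there lead to the two alternatives of the
  conclusion.\<close>

lemma inflate_kite_short:
  assumes m: "(Kite, z, W) \<in> inflate P" and t: "\<eta> \<in> turns"
  shows "(Kite, z + G * W + G * W * \<eta>, - W * \<eta>) \<in> inflate P \<or> (Dart, z + G * G * W * \<eta>, - W * \<eta>) \<in> inflate P"
proof -
  obtain u where W: "W = G * u" using scale_G by blast
  note t' = turn_other(1)[OF t] and R = turn_rules[OF t]
  have k: "(Kite, z + G * G * u * \<eta>, - (u * \<eta> * \<eta>)) \<in> P"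
    "(Kite, z + G * G * u * (G - \<eta>), - (u * (G - \<eta>) * (G - \<eta>))) \<in> P"
    using m t t' unfolding inflate_kite W by blast+
  from kite_long[OF k(1) t] show ?thesis
  proof
    assume "(Kite, z + G * G * u * \<eta>, - (u * \<eta> * \<eta>) * \<eta> * \<eta>) \<in> P"
    hence a: "(Kite, z + G * G * u * \<eta>, u * (G - \<eta>)) \<in> P"
      by (rule mem_cong; simp add: algebra_simps R)
    from kite_short[OF a t'] have "(Kite, z + G * G * u * \<eta> + G * (u * (G - \<eta>)) + G * (u * (G - \<eta>)) * (G - \<eta>), - (u * (G - \<eta>)) * (G - \<eta>)) \<in> P"
    proof
      \<comment> \<open>A dart here would be the other candidate across the short edge of
        \<open>k(1)\<close> that already has \<open>k(2)\<close> behind it.\<close>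
      assume b: "(Dart, z + G * G * u * \<eta> + G * G * (u * (G - \<eta>)) * (G - \<eta>), - (u * (G - \<eta>)) * (G - \<eta>)) \<in> P"
      have False
        by (rule no_overlap_short[OF t mem_cong[OF k(2)] mem_cong[OF b], of "z + G * G * u * \<eta>" "- (u * \<eta> * \<eta>)"]; simp add: algebra_simps R)
      thus ?thesis ..
    qed
    note b = this
    have "(Kite, z + G * W + G * W * \<eta>, - W * \<eta>) \<in> inflate P"
      by (rule inflate_kiteI[OF t mem_cong[OF b] mem_cong[OF a], of _ "- (u * \<eta>)"]; simp add: algebra_simps R W)
    thus ?thesis ..
  next
    assume "(Dart, z + G * G * u * \<eta> + G * - (u * \<eta> * \<eta>) * \<eta>, - (- (u * \<eta> * \<eta>))) \<in> P"
    hence a: "(Dart, z + G * G * u, u * \<eta> * \<eta>) \<in> P"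
      by (rule mem_cong; simp add: algebra_simps R)
    have b: "(Kite, z + G * G * G * u * \<eta>, - (u * \<eta>)) \<in> P"
      by (rule mem_cong[OF dart_short[OF a t]]; simp add: algebra_simps R)
    from kite_short[OF b t'] have "(Dart, z + G * G * G * u * \<eta> + G * G * - (u * \<eta>) * (G - \<eta>), - (- (u * \<eta>)) * (G - \<eta>)) \<in> P"
    proof
      \<comment> \<open>A kite here would have its tail at the tip of \<open>k(1)\<close>.\<close>
      assume c: "(Kite, z + G * G * G * u * \<eta> + G * - (u * \<eta>) + G * - (u * \<eta>) * (G - \<eta>), - (- (u * \<eta>)) * (G - \<eta>)) \<in> P"
      have False
        by (rule no_overlap_kite_tip_tail[OF t mem_cong[OF c] k(1)]; simp add: algebra_simps R)
      thus ?thesis ..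
    qed
    note c = this
    have "(Dart, z + G * G * W * \<eta>, - W * \<eta>) \<in> inflate P"
      by (rule inflate_dartI[OF t mem_cong[OF b] mem_cong[OF a] mem_cong[OF c], of _ "- (u * \<eta>)"]; simp add: algebra_simps R W)
    thus ?thesis ..
  qed
qed

text \<open>The short side of an inflated dart is a long edge of the dart \<open>d(1)\<close> at its
  wing. A dart beyond this edge, or a dart beyond the short edge considered next, is impossible:
  \<open>dart_short\<close> would supply a kite overlapping \<open>d(2)\<close> or
  \<open>d(1)\<close>.\<close>

lemma inflate_dart_short:
  assumes m: "(Dart, z, W) \<in> inflate P" and t: "\<eta> \<in> turns"
  shows "(Kite, z + G * G * W, - W * (G - \<eta>)) \<in> inflate P"
proof -
  obtain u where W: "W = G * u" using scale_G by blast
  note t' = turn_other(1)[OF t] and R = turn_rules[OF t]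
  have d: "(Dart, z + G * G * u * \<eta>, - (u * \<eta>)) \<in> P"
    "(Dart, z + G * G * u * (G - \<eta>), - (u * (G - \<eta>))) \<in> P" using m t t' unfolding W inflate_dart by blast+
  from dart_long[OF d(1) t] have "(Kite, z + G * G * u * \<eta> + G * - (u * \<eta>) * \<eta>, - (- (u * \<eta>))) \<in> P"
  proof
    assume a: "(Dart, z + G * G * u * \<eta>, - (u * \<eta>) * \<eta> * \<eta>) \<in> P"
    have False
      by (rule no_overlap_wing_tail[OF t mem_cong[OF dart_short[OF a t']] d(2)]; simp add: algebra_simps R)
    thus ?thesis ..
  qed
  hence a: "(Kite, z + G * u, u * \<eta>) \<in> P" by (rule mem_cong; simp add: algebra_simps R)
  from kite_short[OF a t] have "(Kite, z + G * u + G * (u * \<eta>) + G * (u * \<eta>) * \<eta>, - (u * \<eta>) * \<eta>) \<in> P"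
  proof
    assume b: "(Dart, z + G * u + G * G * (u * \<eta>) * \<eta>, - (u * \<eta>) * \<eta>) \<in> P"
    have False
      by (rule no_overlap_long[OF t mem_cong[OF dart_short[OF b t']] mem_cong[OF d(1)], of "z + G * u" "u * \<eta>"]; simp add: algebra_simps R)
    thus ?thesis ..
  qed
  note b = this
  show ?thesis
    by (rule inflate_kiteI[OF t mem_cong[OF a] mem_cong[OF b], of _ "- (u * (G - \<eta>))"]; simp add: algebra_simps R W)
qed

end

section \<open>Parents and children\<close>

text \<open>A half kite contains a half dart and both halves of one kite; a half dart contains a
  half kite and a half dart. In the kite clause, \<open>G - \<eta>\<close> selects the half of the
  dart on the inner side of the long edge.\<close>

fun children :: "tile \<Rightarrow> complex \<Rightarrow> (tile \<times> complex) set" where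
  "children (Kite, z, W) \<eta> = (let u = W / G in
     {((Dart, z, u * \<eta>), G - \<eta>),
      ((Kite, z + G * G * u * \<eta>, - (u * \<eta> * \<eta>)), \<eta>),
      ((Kite, z + G * G * u * \<eta>, - (u * \<eta> * \<eta>)), G - \<eta>)})"
| "children (Dart, z, W) \<eta> = (let u = W / G in
     {((Kite, z, u), \<eta>), ((Dart, z + G * G * u * \<eta>, - (u * \<eta>)), \<eta>)})"

lemma children_G:
  "children (Kite, z, G * u) \<eta> =
     {((Dart, z, u * \<eta>), G - \<eta>),
      ((Kite, z + G * G * u * \<eta>, - (u * \<eta> * \<eta>)), \<eta>),
      ((Kite, z + G * G * u * \<eta>, - (u * \<eta> * \<eta>)), G - \<eta>)}"
  "children (Dart, z, G * u) \<eta> = {((Kite, z, u), \<eta>), ((Dart, z + G * G * u * \<eta>, - (u * \<eta>)), \<eta>)}"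
  using G_nonzero by (auto simp: Let_def)

lemma finite_children: "finite (children V \<eta>)"
  by (cases "(V, \<eta>)" rule: children.cases) (auto simp: Let_def)

lemma cell_memI:
  assumes "0 \<le> a" "0 \<le> b" "slope k * a + b \<le> golden" "x = z + w * (of_real a + of_real b * \<eta>)"
  shows "x \<in> cell (k, z, w) \<eta>"
  using assms by auto

text \<open>This inclusion is what traces an overlap of two larger half tiles back to an overlap of
  two smaller ones.\<close>

lemma cell_subset_children:
  assumes t: "\<eta> \<in> turns"
  shows "cell V \<eta> \<subseteq> (\<Union>(T, \<theta>)\<in>children V \<eta>. cell T \<theta>)"
proof
  fix x assume x: "x \<in> cell V \<eta>"
  note R = turn_rules[OF t]
  obtain k z W where V: "V = (k, z, W)" by (cases V)
  obtain u where W: "W = G * u" using scale_G by blast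
  from x V obtain a b where ab: "x = z + W * (of_real a + of_real b * \<eta>)" "0 \<le> a" "0 \<le> b" "slope k * a + b \<le> golden"
    by auto
  define A where "A = golden * a"
  define B where "B = golden * b"
  have AB: "0 \<le> A" "0 \<le> B" "slope k * A + B \<le> golden + 1"
    using ab golden_pos mult_left_mono[OF ab(4), of golden] by (auto simp: A_def B_def algebra_simps golden_sq)
  have x: "x = z + u * (of_real A + of_real B * \<eta>)" unfolding ab W A_def B_def by (simp add: algebra_simps)
  show "x \<in> (\<Union>(T, \<theta>)\<in>children V \<eta>. cell T \<theta>)"
  proof (cases k)
    case Kite
    \<comment> \<open>The line \<open>golden * B + A = golden\<close> carries the short edge of the
      half dart, the line \<open>golden * A + B = golden + 1\<close> the axis of the small
      kite.\<close>
    consider "golden * B + A \<le> golden" | "golden * B + A \<ge> golden" "golden * A + B \<ge> golden + 1"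
      | "golden * B + A \<ge> golden" "golden * A + B \<le> golden + 1" by linarith
    thus ?thesis
    proof cases
      case 1
      have "x \<in> cell (Dart, z, u * \<eta>) (G - \<eta>)"
        by (rule cell_memI[of B A]) (use AB 1 in \<open>simp_all add: x algebra_simps R\<close>)
      thus ?thesis unfolding V Kite W children_G by simp
    next
      case 2
      have "x \<in> cell (Kite, z + G * G * u * \<eta>, - (u * \<eta> * \<eta>)) \<eta>"
      proof (rule cell_memI)
        show "0 \<le> golden * (golden + 1 - A - B)" using AB Kite golden_pos by simp
        show "0 \<le> golden * A + B - (golden + 1)" using 2 by simp
        have "0 \<le> (golden - 1) * B" using AB golden_pos by simp
        thus "slope Kite * (golden * (golden + 1 - A - B)) + (golden * A + B - (golden + 1)) \<le> golden"
          by (simp add: algebra_simps golden_rules)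
      qed (simp add: x algebra_simps R)
      thus ?thesis unfolding V Kite W children_G by simp
    next
      case 3
      have "x \<in> cell (Kite, z + G * G * u * \<eta>, - (u * \<eta> * \<eta>)) (G - \<eta>)"
      proof (rule cell_memI)
        show "0 \<le> A" "0 \<le> golden + 1 - B - golden * A" using AB 3 by simp_all
        have "(golden - 1) * golden \<le> (golden - 1) * (golden * B + A)" using 3 golden_pos by simp
        thus "slope Kite * A + (golden + 1 - B - golden * A) \<le> golden"
          by (simp add: algebra_simps golden_rules)
      qed (simp add: x algebra_simps R)
      thus ?thesis unfolding V Kite W children_G by simp
    qed
  next
    case Dart
    show ?thesis
    proof (cases "A + B \<le> golden")
      case True
      have "x \<in> cell (Kite, z, u) \<eta>"
        by (rule cell_memI[of A B]) (use AB True in \<open>simp_all add: x\<close>)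
      thus ?thesis unfolding V Dart W children_G by simp
    next
      case False
      have "x \<in> cell (Dart, z + G * G * u * \<eta>, - (u * \<eta>)) \<eta>"
      proof (rule cell_memI)
        show "0 \<le> golden + 1 - B - golden * A" "0 \<le> A" using AB Dart by simp_all
        have "golden * golden \<le> golden * (A + B)" using False golden_pos by simp
        thus "slope Dart * (golden + 1 - B - golden * A) + A \<le> golden"
          by (simp add: algebra_simps golden_rules)
      qed (simp add: x algebra_simps R)
      thus ?thesis unfolding V Dart W children_G by simp
    qed
  qed
qed

text \<open>A finite Baire argument: either \<open>U\<close> lies in \<open>C i\<close>, or the open
  set \<open>U - C i\<close> is nonempty and covered by the remaining sets.\<close>

lemma open_meets_interior:
  fixes U :: "'a::topological_space set"
  assumes "finite I" "open U" "U \<noteq> {}" "U \<subseteq> (\<Union>i\<in>I. C i)" "\<And>i. i \<in> I \<Longrightarrow> closed (C i)"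
  shows "\<exists>i\<in>I. U \<inter> interior (C i) \<noteq> {}"
  using assms
proof (induction I arbitrary: U rule: finite_induct)
  case (insert i I)
  show ?case
  proof (cases "U \<subseteq> C i")
    case True
    hence "U \<subseteq> interior (C i)" using insert by (intro interior_maximal)
    thus ?thesis using insert by blast
  next
    case False
    have "\<exists>j\<in>I. (U - C i) \<inter> interior (C j) \<noteq> {}"
      by (rule insert.IH) (use insert False in auto)
    thus ?thesis by blast
  qed
qed auto

section \<open>Existence and uniqueness of the parent of a half tile\<close>

context matched
begin

lemma children_in:
  assumes V: "V \<in> inflate P" and t: "\<eta> \<in> turns" and c: "(T, \<theta>) \<in> children V \<eta>"
  shows "T \<in> P" "\<theta> \<in> turns"
proof -
  note t' = turn_other(1)[OF t]
  obtain k z W where V': "V = (k, z, W)" by (cases V)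
  obtain u where W: "W = G * u" using scale_G by blast
  have "T \<in> P \<and> \<theta> \<in> turns"
  proof (cases k)
    case Kite
    with V c t t' inflate_kite_dart[OF t, of z u] show ?thesis
      unfolding V' W Kite children_G by (auto simp: inflate_kite)
  next
    case Dart
    with V c t t' show ?thesis unfolding V' W Dart children_G by (auto simp: inflate_dart)
  qed
  thus "T \<in> P" "\<theta> \<in> turns" by auto
qed

text \<open>Darts across both short edges place the kite in an inflated dart; a kite across one of
  them is its partner in an inflated kite.\<close>

lemma parent_exists_kite:
  assumes m: "(Kite, z, w) \<in> P" and s: "\<theta> \<in> turns"
  shows "\<exists>V\<in>inflate P. \<exists>\<eta>\<in>turns. ((Kite, z, w), \<theta>) \<in> children V \<eta>"
proof (cases "\<forall>\<eta>\<in>turns. (Dart, z + G * G * w * \<eta>, - w * \<eta>) \<in> P")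
  case True
  hence "(Dart, z, G * w) \<in> inflate P" using m unfolding inflate_dart by simp
  thus ?thesis using s by (intro bexI[of _ "(Dart, z, G * w)"] bexI[of _ \<theta>]) (simp_all add: children_G del: children.simps)
next
  case False
  then obtain \<eta> where t: "\<eta> \<in> turns" and k: "(Kite, z + G * w + G * w * \<eta>, - w * \<eta>) \<in> P"
    using kite_short[OF m] by blast
  note R = turn_rules[OF t]
  define u where "u = - (w * (G - \<eta>) * (G - \<eta>))"
  define p where "p = z + G * G * w * (G - \<eta>)"
  have V: "(Kite, p, G * u) \<in> inflate P"
    by (rule inflate_kiteI[where u = u, OF t mem_cong[OF m] mem_cong[OF k]]; simp add: p_def u_def algebra_simps R)
  have "(Kite, z, w) = (Kite, p + G * G * u * \<eta>, - (u * \<eta> * \<eta>))"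
    by (simp add: p_def u_def algebra_simps R)
  hence "((Kite, z, w), \<theta>) \<in> children (Kite, p, G * u) \<eta>"
    using turn_cases[OF t s] unfolding children_G by auto
  thus ?thesis using V t by blast
qed

text \<open>For half a dart one looks past the kite across its short edge: the tile across the other
  short edge of that kite is a dart or a kite, and yields an inflated dart or an inflated kite
  accordingly.\<close>

lemma parent_exists:
  assumes m: "T \<in> P" and s: "\<theta> \<in> turns"
  shows "\<exists>V\<in>inflate P. \<exists>\<eta>\<in>turns. (T, \<theta>) \<in> children V \<eta>"
proof -
  obtain k z w where T: "T = (k, z, w)" by (cases T)
  show ?thesis
  proof (cases k)
    case Kite
    thus ?thesis using parent_exists_kite m s T by simp
  next
    case Dart
    note s' = turn_other(1)[OF s] and R = turn_rules[OF s]
    have d: "(Dart, z, w) \<in> P" using m T Dart by simp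
    have k: "(Kite, z + G * G * w, - w * (G - \<theta>)) \<in> P" using dart_short[OF d s] .
    from kite_short[OF k s'] show ?thesis
    proof
      assume a: "(Dart, z + G * G * w + G * G * (- w * (G - \<theta>)) * (G - \<theta>), - (- w * (G - \<theta>)) * (G - \<theta>)) \<in> P"
      have V: "(Dart, z + G * G * w, G * (- w * (G - \<theta>))) \<in> inflate P"
        by (rule inflate_dartI[OF s k mem_cong[OF d] mem_cong[OF a]]; simp add: algebra_simps R)
      have "((Dart, z, w), \<theta>) \<in> children (Dart, z + G * G * w, G * (- w * (G - \<theta>))) \<theta>"
        unfolding children_G by (simp add: algebra_simps R)
      thus ?thesis using V s T Dart by blast
    next
      assume a: "(Kite, z + G * G * w + G * (- w * (G - \<theta>)) + G * (- w * (G - \<theta>)) * (G - \<theta>), - (- w * (G - \<theta>)) * (G - \<theta>)) \<in> P"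
      have V: "(Kite, z, G * (w * \<theta>)) \<in> inflate P"
        by (rule inflate_kiteI[where u = "w * \<theta>", OF s mem_cong[OF a] mem_cong[OF k]]; simp add: algebra_simps R)
      have "((Dart, z, w), \<theta>) \<in> children (Kite, z, G * (w * \<theta>)) (G - \<theta>)"
        unfolding children_G by (simp add: algebra_simps R)
      thus ?thesis using V s' T Dart by blast
    qed
  qed
qed

lemma kite_parent_cases:
  assumes V: "V \<in> inflate P" and t: "\<eta> \<in> turns" and c: "((Kite, z, w), \<theta>) \<in> children V \<eta>"
  obtains "V = (Dart, z, G * w)" "\<eta> = \<theta>" "\<And>\<iota>. \<iota> \<in> turns \<Longrightarrow> (Dart, z + G * G * w * \<iota>, - w * \<iota>) \<in> P"
  | "V = (Kite, z + G * G * w * (G - \<eta>), - (G * (w * (G - \<eta>) * (G - \<eta>))))"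
    "(Kite, z + G * w + G * w * \<eta>, - w * \<eta>) \<in> P"
proof -
  note R = turn_rules[OF t]
  obtain k p W where V': "V = (k, p, W)" by (cases V)
  obtain u where W: "W = G * u" using scale_G by blast
  show ?thesis
  proof (cases k)
    case Dart
    thus ?thesis using c V that(1) unfolding V' W Dart children_G inflate_dart by auto
  next
    case Kite
    have e: "z = p + G * G * u * \<eta>" "w = - (u * \<eta> * \<eta>)" using c unfolding V' W Kite children_G by auto
    have m: "(Kite, p + G * G * u * (G - \<eta>), - (u * (G - \<eta>) * (G - \<eta>))) \<in> P"
      using V turn_other(1)[OF t] unfolding V' W Kite inflate_kite by blast
    show ?thesis
      by (rule that(2), simp add: V' W Kite e algebra_simps R)
        (rule mem_cong[OF m]; simp add: e algebra_simps R)
  qed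
qed

lemma kite_parent_unique:
  assumes "V \<in> inflate P" "\<eta> \<in> turns" "((Kite, z, w), \<theta>) \<in> children V \<eta>"
    "V' \<in> inflate P" "\<eta>' \<in> turns" "((Kite, z, w), \<theta>') \<in> children V' \<eta>'"
  shows "V = V'" "\<theta> = \<theta>' \<Longrightarrow> \<eta> = \<eta>'"
proof -
  have "V = V' \<and> (\<theta> = \<theta>' \<longrightarrow> \<eta> = \<eta>')"
  proof (cases rule: kite_parent_cases[OF assms(1-3)])
    case 1
    note V = this
    show ?thesis
    proof (cases rule: kite_parent_cases[OF assms(4-6)])
      case 2
      from no_overlap_short[OF assms(5) this(2)] V(3)[OF assms(5)] show ?thesis by blast
    qed (use V in auto)
  next
    case 2
    note V = this
    show ?thesis
    proof (cases rule: kite_parent_cases[OF assms(4-6)])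
      case 1
      from no_overlap_short[OF assms(2) V(2)] 1(3)[OF assms(2)] show ?thesis by blast
    next
      case 2
      have "\<eta> = \<eta>'"
        using turn_cases[OF assms(2,5)] no_overlap_three_kites[OF assms(2) V(2)] 2(2) by blast
      thus ?thesis using V 2 by simp
    qed
  qed
  thus "V = V'" "\<theta> = \<theta>' \<Longrightarrow> \<eta> = \<eta>'" by auto
qed

lemma dart_parent_cases:
  assumes V: "V \<in> inflate P" and t: "\<eta> \<in> turns" and c: "((Dart, z, w), \<theta>) \<in> children V \<eta>"
  obtains "V = (Kite, z, G * (w * \<theta>))" "\<eta> = G - \<theta>"
  | "V = (Dart, z + G * G * w, - (G * (w * (G - \<theta>))))" "\<eta> = \<theta>"
proof -
  note R = turn_rules[OF t]
  obtain k p W where V': "V = (k, p, W)" by (cases V)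
  obtain u where W: "W = G * u" using scale_G by blast
  show ?thesis
  proof (cases k)
    case Kite
    have e: "z = p" "w = u * \<eta>" "\<theta> = G - \<eta>" using c unfolding V' W Kite children_G by auto
    show ?thesis by (rule that(1)) (simp_all add: V' W Kite e algebra_simps R)
  next
    case Dart
    have e: "z = p + G * G * u * \<eta>" "w = - (u * \<eta>)" "\<theta> = \<eta>" using c unfolding V' W Dart children_G by auto
    show ?thesis by (rule that(2)) (simp_all add: V' W Dart e algebra_simps R)
  qed
qed

text \<open>Both candidates would have the kite across the short edge as a child, but a kite has
  only one parent.\<close>

lemma dart_parent_not_both:
  assumes s: "\<theta> \<in> turns" and V: "(Kite, z, G * (w * \<theta>)) \<in> inflate P"
    and V': "(Dart, z + G * G * w, - (G * (w * (G - \<theta>)))) \<in> inflate P"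
  shows False
proof -
  note R = turn_rules[OF s]
  have "((Kite, z + G * G * w, - (w * (G - \<theta>))), \<theta>) \<in> children (Kite, z, G * (w * \<theta>)) (G - \<theta>)"
    unfolding children_G by (simp add: algebra_simps R)
  moreover have "((Kite, z + G * G * w, - (w * (G - \<theta>))), \<theta>) \<in> children (Dart, z + G * G * w, G * (- (w * (G - \<theta>)))) \<theta>"
    unfolding children_G by simp
  moreover have "(Dart, z + G * G * w, G * (- (w * (G - \<theta>)))) \<in> inflate P" using V' by simp
  ultimately have "(Kite, z, G * (w * \<theta>)) = (Dart, z + G * G * w, G * (- (w * (G - \<theta>))))"
    using kite_parent_unique(1)[OF V turn_other(1)[OF s] _ _ s] by blast
  thus False by simp
qed

lemma parent_unique:
  assumes "V \<in> inflate P" "\<eta> \<in> turns" "(T, \<theta>) \<in> children V \<eta>"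
    "V' \<in> inflate P" "\<eta>' \<in> turns" "(T, \<theta>) \<in> children V' \<eta>'"
  shows "V = V'" "\<eta> = \<eta>'"
proof -
  obtain k z w where T: "T = (k, z, w)" by (cases T)
  have s: "\<theta> \<in> turns" using children_in[OF assms(1-3)] by simp
  have "V = V' \<and> \<eta> = \<eta>'"
  proof (cases k)
    case Kite
    note c = assms(3)[unfolded T Kite] and c' = assms(6)[unfolded T Kite]
    from kite_parent_unique[OF assms(1,2) c assms(4,5) c'] show ?thesis by simp
  next
    case Dart
    note c = assms(3)[unfolded T Dart] and c' = assms(6)[unfolded T Dart]
    let ?K = "(Kite, z, G * (w * \<theta>))" and ?D = "(Dart, z + G * G * w, - (G * (w * (G - \<theta>))))"
    have 1: "V = ?K \<and> \<eta> = G - \<theta> \<or> V = ?D \<and> \<eta> = \<theta>"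
      by (rule dart_parent_cases[OF assms(1,2) c]) blast+
    have 2: "V' = ?K \<and> \<eta>' = G - \<theta> \<or> V' = ?D \<and> \<eta>' = \<theta>"
      by (rule dart_parent_cases[OF assms(4,5) c']) blast+
    from 1 2 assms(1,4) dart_parent_not_both[OF s, of z w] show ?thesis by metis
  qed
  thus "V = V'" "\<eta> = \<eta>'" by auto
qed

lemma inflate_size: "(k, z, W) \<in> inflate P \<Longrightarrow> norm W = golden * r"
proof -
  assume m: "(k, z, W) \<in> inflate P"
  obtain u where W: "W = G * u" using scale_G by blast
  have t: "cis (pi/5) \<in> turns" by (simp add: turns_def)
  have "norm u = r"
  proof (cases k)
    case Kite
    from m t have "(Kite, z + G * G * u * cis (pi/5), - (u * cis (pi/5) * cis (pi/5))) \<in> P"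
      unfolding W Kite inflate_kite by blast
    from size[OF this] show ?thesis by (simp add: norm_mult)
  next
    case Dart
    from m have "(Kite, z, u) \<in> P" unfolding W Dart inflate_dart by blast
    from size[OF this] show ?thesis by simp
  qed
  thus ?thesis using golden_pos by (simp add: W norm_mult)
qed

text \<open>The overlap is refined twice, to a child of \<open>V\<close> and then to a child of
  \<open>V'\<close>. These children overlap, hence coincide, and uniqueness of the parent identifies
  the parents.\<close>

lemma inflate_disjoint:
  assumes V: "V \<in> inflate P" "V' \<in> inflate P" "\<eta> \<in> turns" "\<eta>' \<in> turns" "(V, \<eta>) \<noteq> (V', \<eta>')"
  shows "interior (cell V \<eta>) \<inter> interior (cell V' \<eta>') = {}"
proof (rule ccontr)
  assume ne: "interior (cell V \<eta>) \<inter> interior (cell V' \<eta>') \<noteq> {}"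
  have cl: "closed (case c of (T, \<theta>) \<Rightarrow> cell T \<theta>)" if "c \<in> children U \<iota>" "U \<in> inflate P" "\<iota> \<in> turns" for c U \<iota>
  proof -
    obtain T \<theta> where c: "c = (T, \<theta>)" by (cases c)
    obtain k z w where T: "T = (k, z, w)" by (cases T)
    from children_in[OF that(2,3) that(1)[unfolded c]] show ?thesis
      unfolding c T by (simp add: closed_cell[OF w_nonzero] del: cell.simps)
  qed
  have "\<exists>c\<in>children V \<eta>. (interior (cell V \<eta>) \<inter> interior (cell V' \<eta>')) \<inter> interior (case c of (T, \<theta>) \<Rightarrow> cell T \<theta>) \<noteq> {}"
    using cell_subset_children[OF V(3), of V] interior_subset[of "cell V \<eta>"]
    by (intro open_meets_interior[OF finite_children] open_Int open_interior ne cl[OF _ V(1,3)])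
      (simp_all add: le_infI1 order_trans[of "interior (cell V \<eta>)"])
  then obtain T \<theta> where c: "(T, \<theta>) \<in> children V \<eta>"
    and ne: "interior (cell V \<eta>) \<inter> interior (cell V' \<eta>') \<inter> interior (cell T \<theta>) \<noteq> {}"
    by (fastforce simp del: cell.simps)
  have "\<exists>c\<in>children V' \<eta>'. (interior (cell V \<eta>) \<inter> interior (cell V' \<eta>') \<inter> interior (cell T \<theta>)) \<inter> interior (case c of (T, \<theta>) \<Rightarrow> cell T \<theta>) \<noteq> {}"
    using cell_subset_children[OF V(4), of V'] interior_subset[of "cell V' \<eta>'"]
    by (intro open_meets_interior[OF finite_children] open_Int open_interior ne cl[OF _ V(2,4)])
      (simp_all add: le_infI1 le_infI2 order_trans[of "interior (cell V' \<eta>')"])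
  then obtain T' \<theta>' where c': "(T', \<theta>') \<in> children V' \<eta>'"
    and ne: "interior (cell T \<theta>) \<inter> interior (cell T' \<theta>') \<noteq> {}"
    by (fastforce simp del: cell.simps)
  have "T = T'" "\<theta> = \<theta>'"
    using disjoint ne children_in[OF V(1,3) c] children_in[OF V(2,4) c'] by blast+
  with parent_unique[OF V(1,3) c V(2,4)] c' V(5) show False by blast
qed

lemma matched_inflate: "matched (golden * r) (inflate P)"
proof
  show "golden * r > 0" using golden_pos r_pos by simp
qed (fact inflate_size, fact inflate_disjoint, fact inflate_kite_long, fact inflate_dart_long,
    fact inflate_kite_short, fact inflate_dart_short)

end

section \<open>Packing\<close>

lemma floor_eq_close:
  fixes x y :: real
  assumes "\<lfloor>x / d\<rfloor> = \<lfloor>y / d\<rfloor>" "d > 0"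
  shows "\<bar>x - y\<bar> < d"
proof -
  have "\<bar>x / d - y / d\<bar> < 1" using assms(1) by linarith
  hence "\<bar>x - y\<bar> / d < 1" using assms(2) by (simp add: diff_divide_distrib[symmetric])
  thus ?thesis using assms(2) by simp
qed

text \<open>Pigeonhole on a grid of mesh d / 2: two points in one square differ by less than d / 2
  in each coordinate, hence have distance less than d.\<close>

lemma packing:
  fixes c :: "'i \<Rightarrow> complex"
  assumes d: "d > 0" and sep: "\<And>i j. i \<in> I \<Longrightarrow> j \<in> I \<Longrightarrow> i \<noteq> j \<Longrightarrow> d \<le> dist (c i) (c j)"
    and box: "\<And>i. i \<in> I \<Longrightarrow> x \<le> Re (c i) \<and> Re (c i) \<le> x + a \<and> y \<le> Im (c i) \<and> Im (c i) \<le> y + b"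
    and ab: "0 \<le> a" "0 \<le> b"
  shows "finite I" "real (card I) \<le> (2 * a / d + 1) * (2 * b / d + 1)"
proof -
  let ?h = "d / 2"
  define f where "f i = (\<lfloor>(Re (c i) - x) / ?h\<rfloor>, \<lfloor>(Im (c i) - y) / ?h\<rfloor>)" for i
  let ?B = "{0..\<lfloor>2 * a / d\<rfloor>} \<times> {0..\<lfloor>2 * b / d\<rfloor>}"
  have inj: "inj_on f I"
  proof (rule inj_onI, rule ccontr)
    fix i j assume i: "i \<in> I" "j \<in> I" "f i = f j" "i \<noteq> j"
    hence "\<bar>(Re (c i) - x) - (Re (c j) - x)\<bar> < ?h" "\<bar>(Im (c i) - y) - (Im (c j) - y)\<bar> < ?h"
      unfolding f_def using d by (intro floor_eq_close; simp)+
    moreover have "dist (c i) (c j) \<le> \<bar>Re (c i - c j)\<bar> + \<bar>Im (c i - c j)\<bar>"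
      unfolding dist_norm by (rule cmod_le)
    ultimately show False using sep[OF i(1,2,4)] by simp
  qed
  have sub: "f ` I \<subseteq> ?B"
  proof
    fix u assume "u \<in> f ` I"
    then obtain i where i: "i \<in> I" "u = f i" by auto
    have "(Re (c i) - x) / ?h \<le> 2 * a / d" "(Im (c i) - y) / ?h \<le> 2 * b / d"
      using box[OF i(1)] d divide_right_mono[of "2 * (Re (c i) - x)" "2 * a" d]
        divide_right_mono[of "2 * (Im (c i) - y)" "2 * b" d] by (auto simp: mult.commute)
    thus "u \<in> ?B" using box[OF i(1)] d unfolding i(2) f_def by (auto intro: floor_mono)
  qed
  have fin: "finite ?B" by simp
  show "finite I" using inj sub fin by (metis finite_imageD finite_subset)
  have "card I \<le> card ?B" using card_inj_on_le[OF inj sub fin] .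
  also have "real (card ?B) = real_of_int (\<lfloor>2 * a / d\<rfloor> + 1) * real_of_int (\<lfloor>2 * b / d\<rfloor> + 1)"
    using ab d by (simp add: card_cartesian_product)
  also have "\<dots> \<le> (2 * a / d + 1) * (2 * b / d + 1)"
    using ab d by (intro mult_mono) auto
  finally show "real (card I) \<le> (2 * a / d + 1) * (2 * b / d + 1)" by simp
qed

text \<open>The coordinates (1/4, 1/4) lie deep enough inside a half tile of either kind for a disc
  of radius \<open>norm w / 20\<close>. Tips cannot serve as packing points, since several tiles may
  share one.\<close>

definition centre :: "tile \<Rightarrow> complex \<Rightarrow> complex" where
  "centre T \<eta> = (case T of (k, z, w) \<Rightarrow> z + w * (1/4 + \<eta> / 4))"

definition tip_of :: "tile \<Rightarrow> complex" where
  "tip_of T = fst (snd T)"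

lemma ball_subset_cell:
  assumes t: "\<eta> \<in> turns" and w: "w \<noteq> 0"
  shows "ball (centre (k, z, w) \<eta>) (norm w / 20) \<subseteq> interior (cell (k, z, w) \<eta>)"
proof (rule order_trans[OF _ open_cell_interior[OF w t]], rule subsetI)
  fix x assume "x \<in> ball (centre (k, z, w) \<eta>) (norm w / 20)"
  hence *: "norm (x - (z + w * (1/4 + \<eta> / 4))) < norm w / 20" by (simp add: centre_def dist_norm norm_minus_commute)
  define e where "e = (x - (z + w * (1/4 + \<eta> / 4))) / w"
  have e: "norm e < 1/20" unfolding e_def norm_divide using * w by (simp add: field_simps)
  define b where "b = Im e / Im \<eta>"
  define a where "a = Re e - b * Re \<eta>"
  have i: "Im \<eta> \<noteq> 0" using turn_Im_nonzero[OF t] .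
  have ee: "e = of_real a + of_real b * \<eta>"
    using i by (simp add: complex_eq_iff a_def b_def)
  have x: "x = z + w * (1/4 + \<eta> / 4) + w * e" using w by (simp add: e_def)
  have "\<bar>b\<bar> = \<bar>Im e\<bar> / \<bar>Im \<eta>\<bar>" by (simp add: b_def abs_divide)
  also have "\<dots> \<le> (1/20) / (1/2)"
    using turn_Im_abs[OF t] e abs_Im_le_cmod[of e] by (intro frac_le) auto
  finally have b: "\<bar>b\<bar> \<le> 1/10" by simp
  have "\<bar>a\<bar> \<le> \<bar>Re e\<bar> + \<bar>b * Re \<eta>\<bar>" unfolding a_def by (rule abs_triangle_ineq4)
  also have "\<bar>b * Re \<eta>\<bar> \<le> (1/10) * 0.81" unfolding abs_mult turn_Re[OF t]
    using b golden_bounds by (intro mult_mono) auto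
  finally have a: "\<bar>a\<bar> \<le> 0.14" using e abs_Re_le_cmod[of e] by simp
  have "golden * (1/4 + a) \<le> 1.62 * 0.39" using a golden_bounds by (intro mult_mono) auto
  hence "slope k * (1/4 + a) + (1/4 + b) < golden" using a b golden_bounds by (cases k) auto
  moreover have "x = z + w * (of_real (1/4 + a) + of_real (1/4 + b) * \<eta>)"
    unfolding x ee by (simp add: algebra_simps)
  ultimately show "x \<in> open_cell (k, z, w) \<eta>" using a b unfolding open_cell.simps
    by (intro CollectI exI[of _ "1/4 + a"] exI[of _ "1/4 + b"]) auto
qed

definition halves_in :: "tile set \<Rightarrow> real \<Rightarrow> real \<Rightarrow> real \<Rightarrow> real \<Rightarrow> (tile \<times> complex) set" where
  "halves_in P x a y b = {(T, \<eta>) \<in> P \<times> turns.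
     x \<le> Re (tip_of T) \<and> Re (tip_of T) \<le> x + a \<and> y \<le> Im (tip_of T) \<and> Im (tip_of T) \<le> y + b}"

context packed
begin

lemma centre_separated:
  assumes "T \<in> P" "T' \<in> P" "\<eta> \<in> turns" "\<theta> \<in> turns" "(T, \<eta>) \<noteq> (T', \<theta>)"
  shows "r / 20 \<le> dist (centre T \<eta>) (centre T' \<theta>)"
proof (rule ccontr)
  assume *: "\<not> ?thesis"
  have b: "ball (centre U \<iota>) (r / 20) \<subseteq> interior (cell U \<iota>)" if "U \<in> P" "\<iota> \<in> turns" for U \<iota>
  proof -
    obtain k z w where U: "U = (k, z, w)" by (cases U)
    show ?thesis using ball_subset_cell[OF that(2), of w k z] size w_nonzero that(1) unfolding U by metis
  qed
  from * have "centre T \<eta> \<in> ball (centre T' \<theta>) (r / 20)" "centre T \<eta> \<in> ball (centre T \<eta>) (r / 20)"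
    using r_pos by (auto simp: dist_commute)
  with b[OF assms(1,3)] b[OF assms(2,4)] disjoint[OF assms] show False by blast
qed

lemma centre_near_tip:
  assumes "T \<in> P" "\<eta> \<in> turns" shows "norm (centre T \<eta> - tip_of T) \<le> r / 2"
proof -
  obtain k z w where T: "T = (k, z, w)" by (cases T)
  have "norm (1/4 + \<eta> / 4) \<le> 1/2"
    by (rule order_trans[OF norm_triangle_ineq]) (simp add: norm_divide turn_norm[OF assms(2)])
  hence "norm w * norm (1/4 + \<eta> / 4) \<le> norm w * (1/2)" by (intro mult_left_mono) auto
  thus ?thesis using size assms(1) unfolding T by (simp add: centre_def tip_of_def norm_mult)
qed

text \<open>A half tile with its tip in the box has its centre in the box enlarged by r / 2 on every
  side. Packing at separation r / 20 then gives the factor 2 (a + r) / (r / 20) + 1 = 40 a / r +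
  41.\<close>

lemma count_halves:
  assumes "0 \<le> a" "0 \<le> b"
  shows "finite (halves_in P x a y b)"
    "real (card (halves_in P x a y b)) \<le> (40 * a / r + 41) * (40 * b / r + 41)"
proof -
  let ?I = "halves_in P x a y b"
  have sep: "r / 20 \<le> dist (case_prod centre i) (case_prod centre j)" if "i \<in> ?I" "j \<in> ?I" "i \<noteq> j" for i j
  proof -
    obtain T \<eta> U \<theta> where "i = (T, \<eta>)" "j = (U, \<theta>)" by (cases i, cases j)
    with centre_separated[of T U \<eta> \<theta>] that show ?thesis unfolding halves_in_def by simp
  qed
  have box: "x - r/2 \<le> Re (case_prod centre i) \<and> Re (case_prod centre i) \<le> x - r/2 + (a + r) \<and>
     y - r/2 \<le> Im (case_prod centre i) \<and> Im (case_prod centre i) \<le> y - r/2 + (b + r)" if i: "i \<in> ?I" for i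
  proof -
    obtain T \<eta> where i': "i = (T, \<eta>)" by (cases i)
    have T: "T \<in> P" "\<eta> \<in> turns" "x \<le> Re (tip_of T)" "Re (tip_of T) \<le> x + a" "y \<le> Im (tip_of T)" "Im (tip_of T) \<le> y + b"
      using i unfolding i' halves_in_def by auto
    have "\<bar>Re (centre T \<eta> - tip_of T)\<bar> \<le> r / 2" "\<bar>Im (centre T \<eta> - tip_of T)\<bar> \<le> r / 2"
      using centre_near_tip[OF T(1,2)] abs_Re_le_cmod abs_Im_le_cmod order_trans by blast+
    thus ?thesis using T unfolding i' minus_complex.simps abs_le_iff by auto
  qed
  have d: "r / 20 > 0" "0 \<le> a + r" "0 \<le> b + r" using r_pos assms by auto
  show "finite ?I" by (rule packing(1)[OF d(1) _ _ d(2,3)]) (fact sep, fact box)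
  have p: "real (card ?I) \<le> (2 * (a + r) / (r / 20) + 1) * (2 * (b + r) / (r / 20) + 1)"
    by (rule packing(2)[OF d(1) _ _ d(2,3)]) (fact sep, fact box)
  have "2 * (u + r) / (r / 20) + 1 = 40 * u / r + 41" for u using r_pos by (simp add: field_simps)
  with p show "real (card ?I) \<le> (40 * a / r + 41) * (40 * b / r + 41)" by (simp only:)
qed

end

section \<open>Flows between square blocks\<close>

text \<open>
  \<open>v j k\<close> is the flow upwards into the block \<open>(j, k)\<close> through its lower side and \<open>h j k\<close> the flow
  to the right through its left side; \<open>q\<close> is the excess that has to be carried away.
\<close>

definition flowable :: "real \<Rightarrow> (int \<Rightarrow> int \<Rightarrow> real) \<Rightarrow> bool" where
  "flowable F q \<longleftrightarrow> (\<exists>v h. (\<forall>j k. \<bar>v j k\<bar> \<le> F \<and> \<bar>h j k\<bar> \<le> F) \<and>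
     (\<forall>j k. q j k = v j (k + 1) - v j k + h (j + 1) k - h j k))"

lemma flowable_add:
  assumes "flowable F q" "flowable F' q'"
  shows "flowable (F + F') (\<lambda>j k. q j k + q' j k)"
proof -
  obtain v h v' h' where *: "\<And>j k. \<bar>v j k\<bar> \<le> F \<and> \<bar>h j k\<bar> \<le> F" "\<And>j k. q j k = v j (k + 1) - v j k + h (j + 1) k - h j k"
    "\<And>j k. \<bar>v' j k\<bar> \<le> F' \<and> \<bar>h' j k\<bar> \<le> F'" "\<And>j k. q' j k = v' j (k + 1) - v' j k + h' (j + 1) k - h' j k"
    using assms unfolding flowable_def by metis
  show ?thesis unfolding flowable_def
    by (rule exI[of _ "\<lambda>j k. v j k + v' j k"], rule exI[of _ "\<lambda>j k. h j k + h' j k"])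
      (use * in \<open>auto intro!: order_trans[OF abs_triangle_ineq] add_mono\<close>)
qed

lemma flowable_mono: "flowable F q \<Longrightarrow> F \<le> F' \<Longrightarrow> flowable F' q"
  unfolding flowable_def by (meson order_trans)

lemma flowable_cmult: assumes "flowable F q" shows "flowable (\<bar>c\<bar> * F) (\<lambda>j k. c * q j k)"
proof -
  obtain v h where *: "\<And>j k. \<bar>v j k\<bar> \<le> F \<and> \<bar>h j k\<bar> \<le> F" "\<And>j k. q j k = v j (k + 1) - v j k + h (j + 1) k - h j k"
    using assms unfolding flowable_def by metis
  show ?thesis unfolding flowable_def
  proof (intro exI conjI allI)
    fix j k
    show "\<bar>c * v j k\<bar> \<le> \<bar>c\<bar> * F" "\<bar>c * h j k\<bar> \<le> \<bar>c\<bar> * F"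
      unfolding abs_mult using *(1)[of j k] by (intro mult_left_mono; simp)+
    show "c * q j k = c * v j (k + 1) - c * v j k + c * h (j + 1) k - c * h j k"
      unfolding *(2) by (simp add: algebra_simps)
  qed
qed

lemma flowable_sums:
  assumes "\<And>n. flowable (F n) (q n)" "summable F" "\<And>j k. (\<lambda>n. q n j k) sums Q j k"
  shows "flowable (suminf F) Q"
proof -
  have "\<forall>n. \<exists>v h. (\<forall>j k. \<bar>v j k\<bar> \<le> F n \<and> \<bar>h j k\<bar> \<le> F n) \<and>
     (\<forall>j k. q n j k = v j (k + 1) - v j k + h (j + 1) k - h j k)"
    using assms(1) unfolding flowable_def by blast
  then obtain v h where *: "\<And>n j k. \<bar>v n j k\<bar> \<le> F n" "\<And>n j k. \<bar>h n j k\<bar> \<le> F n"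
    "\<And>n j k. q n j k = v n j (k + 1) - v n j k + h n (j + 1) k - h n j k"
    by metis
  have sv: "summable (\<lambda>n. v n j k)" "summable (\<lambda>n. h n j k)" for j k
    by (rule summable_comparison_test'[OF assms(2), of 0]; simp add: *(1,2))+
  have bv: "\<bar>\<Sum>n. v n j k\<bar> \<le> suminf F" "\<bar>\<Sum>n. h n j k\<bar> \<le> suminf F" for j k
    using norm_suminf_le[of "\<lambda>n. v n j k" F, OF _ assms(2)]
      norm_suminf_le[of "\<lambda>n. h n j k" F, OF _ assms(2)] *(1,2) by simp_all
  have "Q j k = (\<Sum>n. v n j (k + 1)) - (\<Sum>n. v n j k) + (\<Sum>n. h n (j + 1) k) - (\<Sum>n. h n j k)" for j k
  proof -
    have "(\<lambda>n. q n j k) sums ((\<Sum>n. v n j (k + 1)) - (\<Sum>n. v n j k) + (\<Sum>n. h n (j + 1) k) - (\<Sum>n. h n j k))"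
      unfolding *(3) by (intro sums_diff sums_add summable_sums sv)
    thus ?thesis using assms(3) sums_unique2 by blast
  qed
  thus ?thesis unfolding flowable_def using bv
    by (intro exI[of _ "\<lambda>j k. \<Sum>n. v n j k"] exI[of _ "\<lambda>j k. \<Sum>n. h n j k"]) auto
qed

definition block :: "real \<Rightarrow> complex \<Rightarrow> int \<times> int" where
  "block M z = (\<lfloor>Re z / M\<rfloor>, \<lfloor>Im z / M\<rfloor>)"

lemma floor_divide_le: "M > 0 \<Longrightarrow> \<lfloor>x / M\<rfloor> = k \<Longrightarrow> of_int k * M \<le> x \<and> x < of_int k * M + M" for M x :: real
  by (auto simp: floor_eq_iff field_simps)

text \<open>Families of tiles are infinite, so flows are defined as sums over supports. Replacing a
  support by a larger finite set gives several such sums a common index set.\<close>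

lemma sum_support:
  fixes g :: "'i \<Rightarrow> real"
  assumes "finite R" "R \<subseteq> I" "\<And>i. i \<in> I - R \<Longrightarrow> g i = 0"
  shows "sum g {i \<in> I. g i \<noteq> 0} = sum g R"
proof (rule sum.mono_neutral_left)
  show "{i \<in> I. g i \<noteq> 0} \<subseteq> R" "\<forall>i\<in>R - {i \<in> I. g i \<noteq> 0}. g i = 0" using assms by blast+
qed fact

lemma sum_support_le:
  fixes g :: "'i \<Rightarrow> real"
  assumes "finite R" "R \<subseteq> I" "\<And>i. i \<in> I - R \<Longrightarrow> g i = 0" "\<And>i. i \<in> I \<Longrightarrow> \<bar>g i\<bar> \<le> c" "real (card R) \<le> N" "0 \<le> c"
  shows "\<bar>sum g {i \<in> I. g i \<noteq> 0}\<bar> \<le> N * c"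
proof -
  have "\<bar>sum g R\<bar> \<le> (\<Sum>i\<in>R. c)" using assms by (intro order_trans[OF sum_abs] sum_mono) auto
  also have "\<dots> \<le> N * c" using assms by (simp add: mult_right_mono)
  finally show ?thesis using sum_support[OF assms(1-3)] by simp
qed

text \<open>The mass \<open>t i\<close> travels from \<open>p i\<close> to \<open>p' i\<close>, first vertically and then horizontally.\<close>

lemma flowable_transfer:
  fixes p p' :: "'i \<Rightarrow> complex" and t :: "'i \<Rightarrow> real"
  assumes M: "M > 0" and D: "D \<ge> 0" and c: "c \<ge> 0"
    and near: "\<And>i. i \<in> I \<Longrightarrow> norm (p i - p' i) \<le> D"
    and bound: "\<And>i. i \<in> I \<Longrightarrow> \<bar>t i\<bar> \<le> c"
    and count: "\<And>x a y b. 0 \<le> a \<Longrightarrow> 0 \<le> b \<Longrightarrow>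
      finite {i\<in>I. x \<le> Re (p i) \<and> Re (p i) \<le> x + a \<and> y \<le> Im (p i) \<and> Im (p i) \<le> y + b} \<and>
      real (card {i\<in>I. x \<le> Re (p i) \<and> Re (p i) \<le> x + a \<and> y \<le> Im (p i) \<and> Im (p i) \<le> y + b}) \<le> N a b"
    and F: "N M (2 * D) * c \<le> F" "N (4 * D) (M + 2 * D) * c \<le> F"
  shows "flowable F (\<lambda>j k. sum t {i\<in>I. block M (p i) = (j, k)} - sum t {i\<in>I. block M (p' i) = (j, k)})"
proof -
  define R where "R x a y b = {i\<in>I. x \<le> Re (p i) \<and> Re (p i) \<le> x + a \<and> y \<le> Im (p i) \<and> Im (p i) \<le> y + b}" for x a y b
  have R: "finite (R x a y b)" "real (card (R x a y b)) \<le> N a b" "R x a y b \<subseteq> I" if "0 \<le> a" "0 \<le> b" for x a y b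
    using count[OF that] unfolding R_def by auto
  define X where "X i = \<lfloor>Re (p i) / M\<rfloor>" for i
  define Y where "Y i = \<lfloor>Im (p i) / M\<rfloor>" for i
  define X' where "X' i = \<lfloor>Re (p' i) / M\<rfloor>" for i
  define Y' where "Y' i = \<lfloor>Im (p' i) / M\<rfloor>" for i
  \<comment> \<open>The vertical move takes place in the column of the source, the horizontal one in
    the row of the destination. \<open>gv\<close> is the signed mass crossing the lower side of
    block (j, k) upwards, \<open>gh\<close> the one crossing its left side to the right.\<close>
  define gv where "gv j k i = t i * (of_bool (X i = j) * (of_bool (Y i < k) - of_bool (Y' i < k)))" for j k i
  define gh where "gh j k i = t i * (of_bool (Y' i = k) * (of_bool (X i < j) - of_bool (X' i < j)))" for j k i
  define v where "v j k = sum (gv j k) {i\<in>I. gv j k i \<noteq> 0}" for j k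
  define h where "h j k = sum (gh j k) {i\<in>I. gh j k i \<noteq> 0}" for j k
  have dX: "\<bar>Re (p i) - Re (p' i)\<bar> \<le> D" "\<bar>Im (p i) - Im (p' i)\<bar> \<le> D" if "i \<in> I" for i
    using near[OF that] abs_Re_le_cmod[of "p i - p' i"] abs_Im_le_cmod[of "p i - p' i"] by auto
  have fl: "of_int n * M \<le> x \<longleftrightarrow> n \<le> \<lfloor>x / M\<rfloor>" "x < of_int n * M \<longleftrightarrow> \<lfloor>x / M\<rfloor> < n" for n x
    using M by (auto simp: le_floor_iff floor_less_iff field_simps)
  have cross: "\<bar>x - of_int n * M\<bar> \<le> \<bar>x - x'\<bar>" if "(\<lfloor>x / M\<rfloor> < n) \<noteq> (\<lfloor>x' / M\<rfloor> < n)" for x x' n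
    using that unfolding fl(2)[symmetric] by linarith
  \<comment> \<open>A coordinate crosses a grid line only if the source is within D of it. For
    \<open>gh\<close> the row is that of the destination, so the window extends by D beyond both
    ends of the side.\<close>
  have gvR: "gv j k i = 0" if "i \<in> I - R (of_int j * M) M (of_int k * M - D) (2 * D)" for i j k
  proof (rule ccontr)
    assume "gv j k i \<noteq> 0"
    hence "X i = j" "(Y i < k) \<noteq> (Y' i < k)" unfolding gv_def by (auto split: if_splits)
    with that floor_divide_le[OF M, of "Re (p i)" j] cross[of "Im (p i)" k "Im (p' i)"] dX[of i] show False
      unfolding R_def X_def Y_def Y'_def by auto
  qed
  have ghR: "gh j k i = 0" if "i \<in> I - R (of_int j * M - 2 * D) (4 * D) (of_int k * M - D) (M + 2 * D)" for i j k
  proof (rule ccontr)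
    assume "gh j k i \<noteq> 0"
    hence "Y' i = k" "(X i < j) \<noteq> (X' i < j)" unfolding gh_def by (auto split: if_splits)
    with that floor_divide_le[OF M, of "Im (p' i)" k] cross[of "Re (p i)" j "Re (p' i)"] dX[of i] D show False
      unfolding R_def X_def X'_def Y'_def by auto
  qed
  have gb: "\<bar>gv j k i\<bar> \<le> c" "\<bar>gh j k i\<bar> \<le> c" if "i \<in> I" for i j k
    using bound[OF that] c unfolding gv_def gh_def by auto
  have "\<bar>v j k\<bar> \<le> N M (2 * D) * c" for j k
    unfolding v_def by (rule sum_support_le[OF R(1,3) gvR gb(1) R(2) c]) (use M D in auto)
  moreover have "\<bar>h j k\<bar> \<le> N (4 * D) (M + 2 * D) * c" for j k
    unfolding h_def by (rule sum_support_le[OF R(1,3) ghR gb(2) R(2) c]) (use M D in auto)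
  moreover have "sum t {i\<in>I. block M (p i) = (j, k)} - sum t {i\<in>I. block M (p' i) = (j, k)} =
      v j (k + 1) - v j k + h (j + 1) k - h j k" for j k
  proof -
    \<comment> \<open>One finite window holds every mass that matters for this block, so the balance
      reduces to an identity between indicators for each i separately.\<close>
    define S where "S = R (of_int j * M - 2 * D) (M + 4 * D) (of_int k * M - 2 * D) (M + 4 * D)"
    have S: "finite S" "S \<subseteq> I" unfolding S_def by (rule R; use M D in simp)+
    have sub: "R (of_int j * M) M (of_int k * M - D) (2 * D) \<subseteq> S"
      "R (of_int j * M) M (of_int (k + 1) * M - D) (2 * D) \<subseteq> S"
      "R (of_int j * M - 2 * D) (4 * D) (of_int k * M - D) (M + 2 * D) \<subseteq> S"
      "R (of_int (j + 1) * M - 2 * D) (4 * D) (of_int k * M - D) (M + 2 * D) \<subseteq> S"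
      unfolding S_def R_def using M D by (auto simp: algebra_simps)
    have v: "v j k = sum (gv j k) S" "v j (k + 1) = sum (gv j (k + 1)) S"
      "h j k = sum (gh j k) S" "h (j + 1) k = sum (gh (j + 1) k) S"
      unfolding v_def h_def by (rule sum_support[OF S]; use gvR ghR sub in blast)+
    have "i \<in> S" if "i \<in> I" "block M (p i) = (j, k) \<or> block M (p' i) = (j, k)" for i
      using that floor_divide_le[OF M, of "Re (p i)" j] floor_divide_le[OF M, of "Im (p i)" k]
        floor_divide_le[OF M, of "Re (p' i)" j] floor_divide_le[OF M, of "Im (p' i)" k] dX[of i] M D
      unfolding S_def R_def block_def by auto
    hence 1: "{i\<in>I. block M (p i) = (j, k)} = {i\<in>S. X i = j \<and> Y i = k}"
      "{i\<in>I. block M (p' i) = (j, k)} = {i\<in>S. X' i = j \<and> Y' i = k}"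
      using S(2) unfolding block_def X_def Y_def X'_def Y'_def by auto
    have 2: "sum t {i\<in>S. Q i} = (\<Sum>i\<in>S. t i * of_bool (Q i))" for Q
      using sum.inter_filter[OF S(1), of t Q] by (simp add: of_bool_def if_distrib cong: if_cong)
    show ?thesis unfolding v 1 2 sum_subtractf[symmetric] sum.distrib[symmetric]
      by (rule sum.cong) (auto simp: gv_def gh_def of_bool_def)
  qed
  ultimately show ?thesis unfolding flowable_def using F by (intro exI[of _ v] exI[of _ h]) (meson order_trans)
qed

section \<open>Transport of charge up the hierarchy\<close>

text \<open>
  The weights of half tiles form an eigenvector of the substitution for its eigenvalue
  \<open>2 - golden = 1 / golden\<^sup>2\<close>.
\<close>

definition weight :: "tile \<Rightarrow> real" where
  "weight T = (case fst T of Kite \<Rightarrow> 1/2 | Dart \<Rightarrow> - golden / 2)"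

definition charge :: "real \<Rightarrow> tile set \<Rightarrow> int \<Rightarrow> int \<Rightarrow> real" where
  "charge M P j k = (\<Sum>i\<in>{i \<in> P \<times> turns. block M (tip_of (fst i)) = (j, k)}. weight (fst i))"

lemma weight_abs: "\<bar>weight T\<bar> \<le> 1"
  using golden_bounds by (auto simp: weight_def split: tile_kind.split)

lemma sum_children:
  assumes "\<eta> \<in> turns"
  shows "(\<Sum>i\<in>children V \<eta>. weight (fst i)) = (2 - golden) * weight V"
proof -
  obtain k z W where V: "V = (k, z, W)" by (cases V)
  obtain u where W: "W = G * u" using scale_G by blast
  show ?thesis
  proof (cases k)
    case Kite
    have "\<eta> \<noteq> G - \<eta>" using turn_other(2)[OF assms] by simp
    thus ?thesis unfolding V W Kite children_G by (auto simp: weight_def field_simps)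
  next
    case Dart
    show ?thesis unfolding V W Dart children_G by (auto simp: weight_def field_simps golden_rules)
  qed
qed

lemma block_halves:
  assumes "M > 0"
  shows "{i \<in> P \<times> turns. block M (tip_of (fst i)) = (j, k)} \<subseteq> halves_in P (of_int j * M) M (of_int k * M) M"
proof
  fix i assume "i \<in> {i \<in> P \<times> turns. block M (tip_of (fst i)) = (j, k)}"
  thus "i \<in> halves_in P (of_int j * M) M (of_int k * M) M"
    using floor_divide_le[OF assms, of "Re (tip_of (fst i))" j] floor_divide_le[OF assms, of "Im (tip_of (fst i))" k]
    unfolding halves_in_def block_def by auto
qed

text \<open>The bound is uniform in the scale \<open>r\<close>, so multiplied by the factor of the
  n-th generation it tends to 0.\<close>

lemma (in packed) charge_bound:
  assumes "M \<ge> 1" "r \<ge> 1"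
  shows "\<bar>charge M P j k\<bar> \<le> (81 * M) * (81 * M)"
proof -
  let ?S = "{i \<in> P \<times> turns. block M (tip_of (fst i)) = (j, k)}"
  have M: "0 \<le> M" "M > 0" using assms by auto
  note c = count_halves[OF M(1) M(1), of "of_int j * M" "of_int k * M"]
  have "\<bar>charge M P j k\<bar> \<le> (\<Sum>i\<in>?S. 1)"
    unfolding charge_def using weight_abs by (intro order_trans[OF sum_abs] sum_mono) auto
  also have "\<dots> \<le> real (card (halves_in P (of_int j * M) M (of_int k * M) M))"
    using card_mono[OF c(1) block_halves[OF M(2)]] by simp
  also have "\<dots> \<le> (40 * M / r + 41) * (40 * M / r + 41)" by (rule c(2))
  also have "\<dots> \<le> (81 * M) * (81 * M)"
  proof -
    have "40 * M / r \<le> 40 * M / 1" using assms by (intro divide_left_mono) auto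
    hence "40 * M / r + 41 \<le> 81 * M" using assms by simp
    thus ?thesis using assms by (intro mult_mono) auto
  qed
  finally show ?thesis .
qed

context matched
begin

definition parent :: "tile \<times> complex \<Rightarrow> tile \<times> complex" where
  "parent i = (SOME V. V \<in> inflate P \<times> turns \<and> i \<in> children (fst V) (snd V))"

lemma parent:
  assumes "i \<in> P \<times> turns"
  shows "parent i \<in> inflate P \<times> turns" "i \<in> children (fst (parent i)) (snd (parent i))"
proof -
  obtain T \<theta> where i: "i = (T, \<theta>)" "T \<in> P" "\<theta> \<in> turns" using assms by auto
  from parent_exists[OF i(2,3)] obtain V \<eta> where "V \<in> inflate P" "\<eta> \<in> turns" "i \<in> children V \<eta>" unfolding i by blast
  hence "\<exists>V. V \<in> inflate P \<times> turns \<and> i \<in> children (fst V) (snd V)" by (intro exI[of _ "(V, \<eta>)"]) simp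
  from someI_ex[OF this] show "parent i \<in> inflate P \<times> turns" "i \<in> children (fst (parent i)) (snd (parent i))"
    unfolding parent_def by auto
qed

lemma parent_eq:
  assumes "V \<in> inflate P \<times> turns" "i \<in> children (fst V) (snd V)"
  shows "i \<in> P \<times> turns" "parent i = V"
proof -
  obtain T \<theta> where i: "i = (T, \<theta>)" by (cases i)
  show p: "i \<in> P \<times> turns"
    using children_in[of "fst V" "snd V" T \<theta>] assms unfolding i by auto
  show "parent i = V"
    using parent_unique[of "fst V" "snd V" T \<theta> "fst (parent i)" "snd (parent i)"] parent[OF p] assms unfolding i
    by (auto simp: prod_eq_iff mem_Times_iff)
qed

text \<open>A child has its tip at the tip or at a wing of its parent, and the long edge of the
  parent has length \<open>golden * golden * r\<close>.\<close>

lemma child_near: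
  assumes "V \<in> inflate P" "\<eta> \<in> turns" "i \<in> children V \<eta>"
  shows "norm (tip_of (fst i) - tip_of V) \<le> (golden + 1) * r"
proof -
  obtain k z W where V: "V = (k, z, W)" by (cases V)
  obtain u where W: "W = G * u" using scale_G by blast
  have "golden * norm u = golden * r" using inflate_size[of k z W] assms(1) golden_pos unfolding V W by (simp add: norm_mult)
  hence u: "norm u = r" using golden_pos by simp
  have n: "norm (G * G * u * \<eta>) = (golden + 1) * r"
    unfolding G_sq norm_mult u turn_norm[OF assms(2)] using golden_pos norm_of_real[of "golden + 1", where 'a = complex] by simp
  have "tip_of (fst i) = z \<or> tip_of (fst i) = z + G * G * u * \<eta>"
    using assms(3) unfolding V W by (cases k) (auto simp only: children_G tip_of_def fst_conv snd_conv insert_iff empty_iff)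
  thus ?thesis using n r_pos golden_pos unfolding V by (auto simp: tip_of_def)
qed

text \<open>
  Each half tile sends its weight to the tip of its parent, at distance at most \<open>(golden + 1) r\<close>. About
  \<open>M / r + 1\<close> half tiles are that close to a side of a block.
\<close>

lemma level_flow:
  assumes M: "M \<ge> 1" and r: "r \<ge> 1"
  shows "flowable (140000 * M) (\<lambda>j k. charge M P j k - (2 - golden) * charge M (inflate P) j k)"
proof -
  interpret up: matched "golden * r" "inflate P" by (rule matched_inflate)
  let ?I = "P \<times> turns" and ?D = "(golden + 1) * r"
  have M0: "M > 0" "0 \<le> M" using M by auto
  \<comment> \<open>Grouped by parents, the mass arriving at an inflated half tile is the total
    weight of its children, which is \<open>2 - golden\<close> times its own weight.\<close>
  have eq: "(\<Sum>i\<in>{i \<in> ?I. block M (tip_of (fst (parent i))) = (j, k)}. weight (fst i)) =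
      (2 - golden) * charge M (inflate P) j k" for j k
  proof -
    let ?J = "{V \<in> inflate P \<times> turns. block M (tip_of (fst V)) = (j, k)}"
    have fin: "finite ?J"
      using finite_subset[OF block_halves[OF M0(1)] up.count_halves(1)[OF M0(2) M0(2)]] .
    have "{i \<in> ?I. block M (tip_of (fst (parent i))) = (j, k)} = (\<Union>V\<in>?J. children (fst V) (snd V))" (is "?L = ?R")
    proof (intro equalityI subsetI)
      fix i assume "i \<in> ?L"
      hence "parent i \<in> ?J" "i \<in> children (fst (parent i)) (snd (parent i))" using parent[of i] by (simp_all del: children.simps)
      thus "i \<in> ?R" by (rule UN_I)
    next
      fix i assume "i \<in> ?R"
      then obtain V where V: "V \<in> ?J" "i \<in> children (fst V) (snd V)" by blast
      hence "i \<in> ?I" "parent i = V" using parent_eq[of V i] by simp_all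
      thus "i \<in> ?L" using V(1) by simp
    qed
    moreover have dis: "children (fst V) (snd V) \<inter> children (fst V') (snd V') = {}"
      if "V \<in> ?J" "V' \<in> ?J" "V \<noteq> V'" for V V'
    proof (rule ccontr)
      assume "children (fst V) (snd V) \<inter> children (fst V') (snd V') \<noteq> {}"
      then obtain i where "i \<in> children (fst V) (snd V)" "i \<in> children (fst V') (snd V')" by blast
      with that parent_eq(2)[of V i] parent_eq(2)[of V' i] show False by simp
    qed
    moreover have "(\<Sum>i\<in>?R. weight (fst i)) = (\<Sum>V\<in>?J. \<Sum>i\<in>children (fst V) (snd V). weight (fst i))"
    proof (rule sum.UNION_disjoint)
      show "finite ?J" by (rule fin)
      show "\<forall>V\<in>?J. finite (children (fst V) (snd V))" by (simp add: finite_children)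
      show "\<forall>V\<in>?J. \<forall>V'\<in>?J. V \<noteq> V' \<longrightarrow> children (fst V) (snd V) \<inter> children (fst V') (snd V') = {}"
        by (intro ballI impI) (rule dis)
    qed
    ultimately have "(\<Sum>i\<in>?L. weight (fst i)) = (\<Sum>V\<in>?J. \<Sum>i\<in>children (fst V) (snd V). weight (fst i))"
      by (simp only:)
    also have "\<dots> = (\<Sum>V\<in>?J. (2 - golden) * weight (fst V))"
      by (rule sum.cong) (auto simp: sum_children)
    finally show ?thesis unfolding charge_def sum_distrib_left .
  qed
  \<comment> \<open>Since \<open>?D / r\<close> is constant and \<open>r\<close> is at least 1, both
    counts are linear in M. The larger one is at most 461 * 300 M = 138300 M, hence the constant
    140000.\<close>
  have "40 * M / r \<le> 40 * M / 1" using M r by (intro divide_left_mono) auto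
  hence Mr: "40 * M / r \<le> 40 * M" by simp
  have d: "40 * (c * ?D) / r = 40 * c * (golden + 1)" for c using r_pos by simp
  have F1: "(40 * M / r + 41) * (40 * (2 * ?D) / r + 41) \<le> 140000 * M"
  proof -
    have "(40 * M / r + 41) * (40 * (2 * ?D) / r + 41) \<le> (81 * M) * 300"
      unfolding d using Mr M r golden_bounds by (intro mult_mono) auto
    thus ?thesis using M by simp
  qed
  have F2: "(40 * (4 * ?D) / r + 41) * (40 * (M + 2 * ?D) / r + 41) \<le> 140000 * M"
  proof -
    have "40 * (M + 2 * ?D) / r + 41 = 40 * M / r + 40 * 2 * (golden + 1) + 41"
      unfolding distrib_left add_divide_distrib using r_pos by simp
    moreover have "\<dots> \<le> 300 * M" using Mr M golden_bounds by simp
    ultimately have "(40 * (4 * ?D) / r + 41) * (40 * (M + 2 * ?D) / r + 41) \<le> 461 * (300 * M)"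
      unfolding d using M r golden_bounds by (intro mult_mono) auto
    thus ?thesis using M by simp
  qed
  have "flowable (140000 * M) (\<lambda>j k. (\<Sum>i\<in>{i \<in> ?I. block M (tip_of (fst i)) = (j, k)}. weight (fst i)) -
      (\<Sum>i\<in>{i \<in> ?I. block M (tip_of (fst (parent i))) = (j, k)}. weight (fst i)))"
  proof (rule flowable_transfer[where D = ?D and c = 1 and N = "\<lambda>a b. (40 * a / r + 41) * (40 * b / r + 41)"])
    fix i assume "i \<in> ?I"
    from parent[OF this] show "norm (tip_of (fst i) - tip_of (fst (parent i))) \<le> ?D"
      by (intro child_near[of _ "snd (parent i)"]) auto
  next
    fix x a y b :: real assume ab: "0 \<le> a" "0 \<le> b"
    have "{i \<in> ?I. x \<le> Re (tip_of (fst i)) \<and> Re (tip_of (fst i)) \<le> x + a \<and> y \<le> Im (tip_of (fst i)) \<and> Im (tip_of (fst i)) \<le> y + b}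
       = halves_in P x a y b" unfolding halves_in_def by auto
    with count_halves[OF ab, of x y]
    show "finite {i \<in> ?I. x \<le> Re (tip_of (fst i)) \<and> Re (tip_of (fst i)) \<le> x + a \<and> y \<le> Im (tip_of (fst i)) \<and> Im (tip_of (fst i)) \<le> y + b} \<and>
      real (card {i \<in> ?I. x \<le> Re (tip_of (fst i)) \<and> Re (tip_of (fst i)) \<le> x + a \<and> y \<le> Im (tip_of (fst i)) \<and> Im (tip_of (fst i)) \<le> y + b})
        \<le> (40 * a / r + 41) * (40 * b / r + 41)" by simp
  qed (use M0 r_pos golden_pos weight_abs F1 F2 in auto)
  thus ?thesis unfolding eq charge_def .
qed

lemma matched_iterate: "matched (golden ^ n * r) ((inflate ^^ n) P)"
proof (induction n)
  case 0
  show ?case by (simp add: matched_axioms)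
next
  case (Suc n)
  from matched.matched_inflate[OF this] show ?case by (simp add: mult.assoc)
qed

text \<open>The differences \<open>Q n - Q (Suc n)\<close> telescope to \<open>Q 0\<close>, because
  \<open>Q n\<close> tends to 0 in every block. Their costs form a geometric series of ratio q <
  1/2, which at most doubles the cost of one level.\<close>

theorem charge_flowable:
  assumes M: "M \<ge> 1" and r: "r \<ge> 1"
  shows "flowable (280000 * M) (charge M P)"
proof -
  define q where "q = 2 - golden"
  have q: "0 < q" "q < 1/2" using golden_bounds by (simp_all add: q_def)
  define Q where "Q n j k = q ^ n * charge M ((inflate ^^ n) P) j k" for n j k
  have r': "1 \<le> golden ^ n * r" for n
    using mult_mono[of 1 "golden ^ n" 1 r] r golden_pos by simp
  have 1: "flowable (q ^ n * (140000 * M)) (\<lambda>j k. Q n j k - Q (Suc n) j k)" for n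
  proof -
    interpret l: matched "golden ^ n * r" "(inflate ^^ n) P" by (rule matched_iterate)
    have "\<bar>q ^ n\<bar> = q ^ n" using q by simp
    with flowable_cmult[OF l.level_flow[OF M r'], of "q ^ n"] show ?thesis
      unfolding Q_def q_def by (simp add: algebra_simps)
  qed
  have s: "(\<lambda>n. q ^ n * (140000 * M)) sums (1 / (1 - q) * (140000 * M))"
    using q by (intro sums_mult2 geometric_sums) simp
  have "(\<lambda>n. Q n j k) \<longlonglongrightarrow> 0" for j k
  proof (rule Lim_null_comparison)
    show "(\<lambda>n. q ^ n * ((81 * M) * (81 * M))) \<longlonglongrightarrow> 0"
      using q by (intro tendsto_mult_left_zero LIMSEQ_realpow_zero) auto
    show "\<forall>\<^sub>F n in sequentially. norm (Q n j k) \<le> q ^ n * ((81 * M) * (81 * M))"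
      unfolding real_norm_def
    proof (rule always_eventually, rule allI)
      fix n
      interpret l: matched "golden ^ n * r" "(inflate ^^ n) P" by (rule matched_iterate)
      show "\<bar>Q n j k\<bar> \<le> q ^ n * ((81 * M) * (81 * M))"
        unfolding Q_def abs_mult using q l.charge_bound[OF M r'] by (intro mult_mono) auto
    qed
  qed
  hence "(\<lambda>n. Q n j k - Q (Suc n) j k) sums (Q 0 j k - 0)" for j k
    by (rule telescope_sums')
  from flowable_sums[OF 1 sums_summable[OF s] this] have "flowable (1 / (1 - q) * (140000 * M)) (Q 0)"
    using sums_unique[OF s] by simp
  moreover have "1 / (1 - q) \<le> 1 / (1/2)" using q by (intro divide_left_mono) auto
  hence "1 / (1 - q) * (140000 * M) \<le> 2 * (140000 * M)" using M by (intro mult_right_mono) auto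
  ultimately have "flowable (280000 * M) (Q 0)" by (elim flowable_mono) simp
  moreover have "Q 0 = charge M P" by (intro ext) (simp add: Q_def)
  ultimately show ?thesis by simp
qed

end

section \<open>Rounding a flow\<close>

lemma int_antidifference:
  fixes f :: "int \<Rightarrow> 'a::ab_group_add"
  shows "\<exists>S. S 0 = 0 \<and> (\<forall>j. S (j + 1) = S j + f j)"
proof -
  define S where "S j = (if j \<ge> 0 then sum f {0..<j} else - sum f {j..<0})" for j
  have "S (j + 1) = S j + f j" for j
  proof (cases "j \<ge> 0")
    case True
    hence "{0..<j + 1} = insert j {0..<j}" by auto
    thus ?thesis using True by (simp add: S_def add.commute)
  next
    case False
    hence "{j..<0} = insert j {j + 1..<0}" by auto
    hence "sum f {j..<0} = f j + sum f {j + 1..<0}" by simp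
    thus ?thesis using False by (auto simp: S_def)
  qed
  thus ?thesis by (intro exI[of _ S]) (simp add: S_def)
qed

lemma int_const:
  fixes g :: "int \<Rightarrow> 'a"
  assumes "\<And>j. g (j + 1) = g j"
  shows "g j = g 0"
proof (induction j rule: int_induct[of _ 0])
  case (step2 i)
  thus ?case using assms[of "i - 1"] by simp
qed (use assms in auto)

text \<open>
  The vertical flow is rounded so that its partial sums along each row change by less than 1; the
  horizontal flow that restores the balance then stays bounded.
\<close>

lemma flow_rounding:
  fixes d :: "int \<Rightarrow> int \<Rightarrow> int"
  assumes "flowable F (\<lambda>j k. real_of_int (d j k))"
  obtains v h :: "int \<Rightarrow> int \<Rightarrow> int"
  where "\<And>j k. \<bar>real_of_int (v j k)\<bar> \<le> 2 * F + 2" "\<And>j k. \<bar>real_of_int (h j k)\<bar> \<le> 2 * F + 2"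
    "\<And>j k. d j k = v j (k + 1) - v j k + h (j + 1) k - h j k"
proof -
  obtain fv fh where F: "\<And>j k. \<bar>fv j k\<bar> \<le> F" "\<And>j k. \<bar>fh j k\<bar> \<le> F"
    and d: "\<And>j k. real_of_int (d j k) = fv j (k + 1) - fv j k + fh (j + 1) k - fh j k"
    using assms unfolding flowable_def by metis
  have F0: "0 \<le> F" using F(1)[of 0 0] by linarith
  have "\<forall>k. \<exists>S. S 0 = 0 \<and> (\<forall>j. S (j + 1) = S j + fv j k)" by (intro allI int_antidifference)
  then obtain S where S: "\<And>k. S k 0 = 0" "\<And>k j. S k (j + 1) = S k j + fv j k" by metis
  \<comment> \<open>Being differences of floors of partial sums, consecutive values along a row add
    up to the real flow with an error below 1.\<close>
  define v where "v j k = \<lfloor>S k (j + 1)\<rfloor> - \<lfloor>S k j\<rfloor>" for j k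
  define e where "e j k = d j k - v j (k + 1) + v j k" for j k
  have "\<forall>k. \<exists>H. H 0 = 0 \<and> (\<forall>j. H (j + 1) = H j + e j k)" by (intro allI int_antidifference)
  then obtain H where H: "\<And>k. H k 0 = 0" "\<And>k j. H k (j + 1) = H k j + e j k" by metis
  \<comment> \<open>\<open>g\<close> compares the integer horizontal flow with its prediction from
    the real one; it is constant in j and vanishes at j = 0. The normalisation
    \<open>H k 0 = 0\<close> brings in the term \<open>fh 0 k\<close>, whence 2 F in the
    bound.\<close>
  define g where "g k j = real_of_int (H k j) - (fh j k - fh 0 k + frac (S (k + 1) j) - frac (S k j))" for k j
  have "g k (j + 1) = g k j" for j k
    unfolding g_def by (simp add: H e_def v_def frac_def d S(2))
  hence "g k j = g k 0" for j k using int_const[of "g k"] by blast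
  hence eq: "real_of_int (H k j) = fh j k - fh 0 k + frac (S (k + 1) j) - frac (S k j)" for j k
    unfolding g_def by (simp add: H S)
  have fr: "0 \<le> frac x" "frac x < 1" for x :: real by (simp_all add: frac_lt_1)
  show ?thesis
  proof (rule that[of v "\<lambda>j k. H k j"])
    fix j k
    have "real_of_int (v j k) = fv j k - frac (S k (j + 1)) + frac (S k j)" by (simp add: v_def frac_def S)
    thus "\<bar>real_of_int (v j k)\<bar> \<le> 2 * F + 2"
      using F(1)[of j k] F0 fr[of "S k (j + 1)"] fr[of "S k j"] by linarith
    show "\<bar>real_of_int (H k j)\<bar> \<le> 2 * F + 2"
      unfolding eq using F(2)[of j k] F(2)[of 0 k] fr[of "S (k + 1) j"] fr[of "S k j"] by linarith
    show "d j k = v j (k + 1) - v j k + H k (j + 1) - H k j" by (simp add: H e_def)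
  qed
qed

section \<open>Moving points between neighbouring blocks\<close>

lemma subset_with_card: "n \<le> card A \<Longrightarrow> \<exists>B. B \<subseteq> A \<and> card B = n"
  by (meson obtain_subset_with_card_n)

lemma four_subsets:
  assumes "finite A" "n1 + n2 + n3 + n4 \<le> card A"
  shows "\<exists>A1 A2 A3 A4. A1 \<subseteq> A \<and> A2 \<subseteq> A - A1 \<and> A3 \<subseteq> A - A1 - A2 \<and> A4 \<subseteq> A - A1 - A2 - A3 \<and>
    card A1 = n1 \<and> card A2 = n2 \<and> card A3 = n3 \<and> card A4 = n4"
proof -
  have "n1 \<le> card (A)" using assms by linarith
  then obtain A1 where 1: "A1 \<subseteq> A" "card A1 = n1" using subset_with_card by blast
  have c1: "card (A - A1) = card A - n1" using 1 assms by (metis card_Diff_subset finite_subset)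
  have "n2 \<le> card (A - A1)" using assms c1 by linarith
  then obtain A2 where 2: "A2 \<subseteq> A - A1" "card A2 = n2" using subset_with_card by blast
  have c2: "card (A - A1 - A2) = card A - n1 - n2"
    using 2 c1 assms by (metis card_Diff_subset finite_Diff finite_subset)
  have "n3 \<le> card (A - A1 - A2)" using assms c2 by linarith
  then obtain A3 where 3: "A3 \<subseteq> A - A1 - A2" "card A3 = n3" using subset_with_card by blast
  have c3: "card (A - A1 - A2 - A3) = card A - n1 - n2 - n3"
    using 3 c2 assms by (metis card_Diff_subset finite_Diff finite_subset)
  have "n4 \<le> card (A - A1 - A2 - A3)" using assms c3 by linarith
  then obtain A4 where 4: "A4 \<subseteq> A - A1 - A2 - A3" "card A4 = n4" using subset_with_card by blast
  show ?thesis using 1 2 3 4 by blast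
qed

text \<open>The factor 8 bounds the four flows at a block by N / 2 together. So every block holds at
  least N / 2 points, and all points that leave it can be chosen among its original ones; no point
  moves by more than one block.\<close>

lemma redistribute:
  fixes A :: "int \<Rightarrow> int \<Rightarrow> 'a set" and d v h :: "int \<Rightarrow> int \<Rightarrow> int"
  assumes fin: "\<And>j k. finite (A j k)"
    and disj: "\<And>j k j' k'. (j, k) \<noteq> (j', k') \<Longrightarrow> A j k \<inter> A j' k' = {}"
    and card: "\<And>j k. int (card (A j k)) = N + (v j (k + 1) - v j k + h (j + 1) k - h j k)"
    and bound: "\<And>j k. 8 * \<bar>v j k\<bar> \<le> N" "\<And>j k. 8 * \<bar>h j k\<bar> \<le> N"
  obtains Z :: "int \<Rightarrow> int \<Rightarrow> 'a set" where
    "\<And>j k. finite (Z j k)" "\<And>j k. int (card (Z j k)) = N"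
    "\<And>y j k. y \<in> A j k \<Longrightarrow> \<exists>!(j', k'). y \<in> Z j' k'"
    "\<And>y j k. y \<in> Z j k \<Longrightarrow> \<exists>j' k'. y \<in> A j' k' \<and> \<bar>j - j'\<bar> \<le> 1 \<and> \<bar>k - k'\<bar> \<le> 1"
proof -
  have N: "N \<ge> 0" using bound(1)[of 0 0] by linarith
  have "\<exists>A1 A2 A3 A4. A1 \<subseteq> A j k \<and> A2 \<subseteq> A j k - A1 \<and> A3 \<subseteq> A j k - A1 - A2 \<and> A4 \<subseteq> A j k - A1 - A2 - A3 \<and>
    card A1 = nat (v j (k + 1)) \<and> card A2 = nat (- v j k) \<and> card A3 = nat (h (j + 1) k) \<and> card A4 = nat (- h j k)" for j k
    by (rule four_subsets[OF fin])
      (use card[of j k] bound(1)[of j "k + 1"] bound(1)[of j k] bound(2)[of "j + 1" k] bound(2)[of j k] N in linarith)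
  hence "\<forall>j k. \<exists>A1 A2 A3 A4. A1 \<subseteq> A j k \<and> A2 \<subseteq> A j k - A1 \<and> A3 \<subseteq> A j k - A1 - A2 \<and> A4 \<subseteq> A j k - A1 - A2 - A3 \<and>
    card A1 = nat (v j (k + 1)) \<and> card A2 = nat (- v j k) \<and> card A3 = nat (h (j + 1) k) \<and> card A4 = nat (- h j k)"
    by blast
  from this[unfolded choice_iff]
  obtain A1 A2 A3 A4 where sub: "\<And>j k. A1 j k \<subseteq> A j k" "\<And>j k. A2 j k \<subseteq> A j k - A1 j k"
      "\<And>j k. A3 j k \<subseteq> A j k - A1 j k - A2 j k" "\<And>j k. A4 j k \<subseteq> A j k - A1 j k - A2 j k - A3 j k"
    and c: "\<And>j k. card (A1 j k) = nat (v j (k + 1))" "\<And>j k. card (A2 j k) = nat (- v j k)"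
      "\<And>j k. card (A3 j k) = nat (h (j + 1) k)" "\<And>j k. card (A4 j k) = nat (- h j k)"
    by blast
  define B where "B j k = A j k - (A1 j k \<union> A2 j k \<union> A3 j k \<union> A4 j k)" for j k
  \<comment> \<open>\<open>B\<close> stays, \<open>A1\<close> moves up, \<open>A2\<close> down,
    \<open>A3\<close> right and \<open>A4\<close> left; the shifted indices name the block of
    origin.\<close>
  define Z where "Z j k = B j k \<union> (A1 j (k - 1) \<union> (A2 j (k + 1) \<union> (A3 (j - 1) k \<union> A4 (j + 1) k)))" for j k
  have fins: "finite (A1 j k)" "finite (A2 j k)" "finite (A3 j k)" "finite (A4 j k)" "finite (B j k)" for j k
    using fin[of j k] sub[of j k] unfolding B_def by (auto intro: finite_subset)
  have BA: "B j k \<subseteq> A j k" "A2 j k \<subseteq> A j k" "A3 j k \<subseteq> A j k" "A4 j k \<subseteq> A j k" for j k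
    using sub[of j k] unfolding B_def by auto
  have cardB: "int (card (B j k)) = int (card (A j k)) - int (card (A1 j k)) - int (card (A2 j k)) - int (card (A3 j k)) - int (card (A4 j k))" for j k
  proof -
    have "A j k = B j k \<union> (A1 j k \<union> (A2 j k \<union> (A3 j k \<union> A4 j k)))" using sub[of j k] unfolding B_def by blast
    hence "card (A j k) = card (B j k \<union> (A1 j k \<union> (A2 j k \<union> (A3 j k \<union> A4 j k))))" by simp
    also have "\<dots> = card (B j k) + (card (A1 j k) + (card (A2 j k) + (card (A3 j k) + card (A4 j k))))"
    proof -
      have "A3 j k \<inter> A4 j k = {}" "A2 j k \<inter> (A3 j k \<union> A4 j k) = {}" "A1 j k \<inter> (A2 j k \<union> (A3 j k \<union> A4 j k)) = {}"
        "B j k \<inter> (A1 j k \<union> (A2 j k \<union> (A3 j k \<union> A4 j k))) = {}"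
        using sub[of j k] unfolding B_def by blast+
      thus ?thesis by (simp add: card_Un_disjoint fins)
    qed
    finally show ?thesis by simp
  qed
  have cardZ: "int (card (Z j k)) = N" for j k
  proof -
    have "card (Z j k) = card (B j k) + (card (A1 j (k - 1)) + (card (A2 j (k + 1)) + (card (A3 (j - 1) k) + card (A4 (j + 1) k))))"
    proof -
      have dd: "A j' k' \<inter> A j'' k'' = {}" if "j' \<noteq> j'' \<or> k' \<noteq> k''" for j' k' j'' k'' using disj that by blast
      have sep: "X \<inter> X' = {}" if "X \<subseteq> A j' k'" "X' \<subseteq> A j'' k''" "j' \<noteq> j'' \<or> k' \<noteq> k''" for X X' j' k' j'' k''
        using that(1,2) dd[OF that(3)] by blast
      have d1: "A3 (j - 1) k \<inter> A4 (j + 1) k = {}" by (rule sep[OF BA(3,4)]) simp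
      have d2: "A2 j (k + 1) \<inter> (A3 (j - 1) k \<union> A4 (j + 1) k) = {}"
        unfolding Int_Un_distrib Un_empty by (intro conjI sep[OF BA(2) BA(3)] sep[OF BA(2) BA(4)]) simp_all
      have d3: "A1 j (k - 1) \<inter> (A2 j (k + 1) \<union> (A3 (j - 1) k \<union> A4 (j + 1) k)) = {}"
        unfolding Int_Un_distrib Un_empty
        by (intro conjI sep[OF sub(1) BA(2)] sep[OF sub(1) BA(3)] sep[OF sub(1) BA(4)]) simp_all
      have d4: "B j k \<inter> (A1 j (k - 1) \<union> (A2 j (k + 1) \<union> (A3 (j - 1) k \<union> A4 (j + 1) k))) = {}"
        unfolding Int_Un_distrib Un_empty
        by (intro conjI sep[OF BA(1) sub(1)] sep[OF BA(1) BA(2)] sep[OF BA(1) BA(3)] sep[OF BA(1) BA(4)]) simp_all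
      show ?thesis unfolding Z_def
        by (simp add: card_Un_disjoint d1 d2 d3 d4 fins)
    qed
    hence "int (card (Z j k)) = int (card (B j k)) + int (nat (v j k)) + int (nat (- v j (k + 1)))
        + int (nat (h j k)) + int (nat (- h (j + 1) k))"
      by (simp add: c)
    moreover have n: "int (nat x) - int (nat (- x)) = x" for x by simp
    ultimately show ?thesis
      using cardB[of j k, unfolded c] card[of j k] n[of "v j k"] n[of "v j (k + 1)"] n[of "h j k"] n[of "h (j + 1) k"]
      by linarith
  qed
  have near: "\<exists>j' k'. y \<in> A j' k' \<and> \<bar>j - j'\<bar> \<le> 1 \<and> \<bar>k - k'\<bar> \<le> 1" if "y \<in> Z j k" for y j k
  proof -
    from that consider "y \<in> A j k" | "y \<in> A j (k - 1)" | "y \<in> A j (k + 1)" | "y \<in> A (j - 1) k" | "y \<in> A (j + 1) k"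
      using BA(1)[of j k] sub(1)[of j "k - 1"] BA(2)[of j "k + 1"] BA(3)[of "j - 1" k] BA(4)[of "j + 1" k]
      unfolding Z_def by (elim UnE) blast+
    thus ?thesis
    proof cases
      case 1 thus ?thesis by (intro exI[of _ j] exI[of _ k]) simp
    next
      case 2 thus ?thesis by (intro exI[of _ j] exI[of _ "k - 1"]) simp
    next
      case 3 thus ?thesis by (intro exI[of _ j] exI[of _ "k + 1"]) simp
    next
      case 4 thus ?thesis by (intro exI[of _ "j - 1"] exI[of _ k]) simp
    next
      case 5 thus ?thesis by (intro exI[of _ "j + 1"] exI[of _ k]) simp
    qed
  qed
  have uniq: "\<exists>!(j', k'). y \<in> Z j' k'" if y: "y \<in> A j k" for y j k
  proof -
    have 1: "y \<notin> A j' k'" if "(j', k') \<noteq> (j, k)" for j' k' using disj[OF that] y by blast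
    have o: "y \<in> B j' k' \<longleftrightarrow> j' = j \<and> k' = k \<and> y \<in> B j k" "y \<in> A1 j' k' \<longleftrightarrow> j' = j \<and> k' = k \<and> y \<in> A1 j k"
      "y \<in> A2 j' k' \<longleftrightarrow> j' = j \<and> k' = k \<and> y \<in> A2 j k" "y \<in> A3 j' k' \<longleftrightarrow> j' = j \<and> k' = k \<and> y \<in> A3 j k"
      "y \<in> A4 j' k' \<longleftrightarrow> j' = j \<and> k' = k \<and> y \<in> A4 j k" for j' k'
      using BA[of j' k'] sub(1)[of j' k'] 1[of j' k'] by (cases "(j', k') = (j, k)"; auto)+
    have Z: "y \<in> Z j' k' \<longleftrightarrow> j' = j \<and> k' = k \<and> y \<in> B j k \<or> j' = j \<and> k' = k + 1 \<and> y \<in> A1 j k \<or>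
        j' = j \<and> k' = k - 1 \<and> y \<in> A2 j k \<or> j' = j + 1 \<and> k' = k \<and> y \<in> A3 j k \<or> j' = j - 1 \<and> k' = k \<and> y \<in> A4 j k" for j' k'
      unfolding Z_def Un_iff o(1)[of j' k'] o(2)[of j' "k' - 1"] o(3)[of j' "k' + 1"] o(4)[of "j' - 1" k'] o(5)[of "j' + 1" k']
      by (simp only: diff_eq_eq eq_diff_eq)
    have "y \<in> B j k \<and> y \<notin> A1 j k \<and> y \<notin> A2 j k \<and> y \<notin> A3 j k \<and> y \<notin> A4 j k \<or>
      y \<notin> B j k \<and> y \<in> A1 j k \<and> y \<notin> A2 j k \<and> y \<notin> A3 j k \<and> y \<notin> A4 j k \<or>
      y \<notin> B j k \<and> y \<notin> A1 j k \<and> y \<in> A2 j k \<and> y \<notin> A3 j k \<and> y \<notin> A4 j k \<or>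
      y \<notin> B j k \<and> y \<notin> A1 j k \<and> y \<notin> A2 j k \<and> y \<in> A3 j k \<and> y \<notin> A4 j k \<or>
      y \<notin> B j k \<and> y \<notin> A1 j k \<and> y \<notin> A2 j k \<and> y \<notin> A3 j k \<and> y \<in> A4 j k"
      using sub[of j k] y unfolding B_def by blast
    moreover have "\<exists>!(j', k'). j' = a \<and> k' = b" for a b :: int by auto
    ultimately show ?thesis unfolding Z by (elim disjE) simp_all
  qed
  show ?thesis
    by (rule that[of Z]) (use cardZ near uniq fins in \<open>auto simp: Z_def\<close>)
qed

section \<open>From balanced blocks to a biLipschitz map\<close>

definition lattice_point :: "int \<times> int \<Rightarrow> real^2" where
  "lattice_point p = vector [of_int (fst p), of_int (snd p)]"

lemma lattice_point_bij: "bij_betw lattice_point UNIV integer_lattice"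
  unfolding bij_betw_def
proof
  show "inj lattice_point"
    by (rule injI) (auto simp: lattice_point_def vec_eq_iff forall_2 prod_eq_iff)
  show "range lattice_point = integer_lattice"
  proof (intro equalityI subsetI)
    fix v assume "v \<in> integer_lattice"
    then obtain a b where "v $ 1 = of_int a" "v $ 2 = of_int b" unfolding integer_lattice_def mem_Collect_eq by (metis Ints_cases)
    hence "v = lattice_point (a, b)" by (simp add: lattice_point_def vec_eq_iff forall_2)
    thus "v \<in> range lattice_point" by simp
  qed (auto simp: integer_lattice_def lattice_point_def forall_2)
qed

lemma dist_plane_le: "dist x y \<le> \<bar>x $ 1 - y $ 1\<bar> + \<bar>x $ 2 - y $ 2\<bar>" for x y :: "real^2"
  using L2_set_le_sum_abs[of "\<lambda>i. dist (x $ i) (y $ i)" UNIV] by (simp add: dist_vec_def sum_2 dist_real_def)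

lemma component_dist_le: "\<bar>x $ i - y $ i\<bar> \<le> dist x y" for x y :: "real^2"
  using dist_vec_nth_le[of x i y] by (simp add: dist_real_def)

lemma integer_lattice_separated:
  assumes "x \<in> integer_lattice" "y \<in> integer_lattice" "x \<noteq> y" shows "1 \<le> dist x y"
proof -
  obtain i where i: "x $ i \<noteq> y $ i" using assms(3) by (auto simp: vec_eq_iff)
  obtain a b where "x $ i = of_int a" "y $ i = of_int b"
    using assms(1,2) unfolding integer_lattice_def mem_Collect_eq by (metis Ints_cases)
  with i have "1 \<le> \<bar>x $ i - y $ i\<bar>" by simp
  thus ?thesis using component_dist_le[of x i y] by linarith
qed

text \<open>After scaling, distances change by at most 2 C. This additive error is absorbed by the
  separation c of \<open>Y\<close> in the upper estimate and by the separation 1 of the lattice in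
  the lower one.\<close>

lemma bounded_displacement_bilipschitz:
  fixes f :: "real^2 \<Rightarrow> real^2"
  assumes f: "bij_betw f Y integer_lattice" and near: "\<And>y. y \<in> Y \<Longrightarrow> dist (f y) (s *\<^sub>R y) \<le> C"
    and s: "s > 0" and c: "c > 0" "\<And>x y. x \<in> Y \<Longrightarrow> y \<in> Y \<Longrightarrow> x \<noteq> y \<Longrightarrow> c \<le> dist x y"
    and C: "C \<ge> 0"
  shows "\<exists>L \<ge> 1. \<forall>x\<in>Y. \<forall>y\<in>Y. (1 / L) * dist x y \<le> dist (f x) (f y) \<and> dist (f x) (f y) \<le> L * dist x y"
proof -
  define L where "L = max 1 (max (s + 2 * C / c) ((1 + 2 * C) / s))"
  have L: "L \<ge> 1" "s + 2 * C / c \<le> L" "(1 + 2 * C) / s \<le> L" by (simp_all add: L_def)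
  have "(1 / L) * dist x y \<le> dist (f x) (f y) \<and> dist (f x) (f y) \<le> L * dist x y" if xy: "x \<in> Y" "y \<in> Y" for x y
  proof (cases "x = y")
    case False
    have ds: "dist (s *\<^sub>R x) (s *\<^sub>R y) = s * dist x y"
      using s by (simp add: dist_norm flip: scaleR_diff_right)
    have t1: "dist (f x) (f y) \<le> s * dist x y + 2 * C"
      using near[OF xy(1)] near[OF xy(2)] dist_triangle[of "f x" "f y" "s *\<^sub>R x"]
        dist_triangle[of "s *\<^sub>R x" "f y" "s *\<^sub>R y"] ds by (simp add: dist_commute)
    have t2: "s * dist x y \<le> dist (f x) (f y) + 2 * C"
      using near[OF xy(1)] near[OF xy(2)] dist_triangle[of "s *\<^sub>R x" "s *\<^sub>R y" "f x"]
        dist_triangle[of "f x" "s *\<^sub>R y" "f y"] ds by (simp add: dist_commute)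
    have "2 * C = (2 * C / c) * c" using c by simp
    also have "\<dots> \<le> (2 * C / c) * dist x y" using c xy False C by (intro mult_left_mono) auto
    finally have "dist (f x) (f y) \<le> (s + 2 * C / c) * dist x y" using t1 by (simp add: algebra_simps)
    also have "\<dots> \<le> L * dist x y" using L by (intro mult_right_mono) auto
    finally have u: "dist (f x) (f y) \<le> L * dist x y" .
    have "f x \<in> integer_lattice" "f y \<in> integer_lattice" "f x \<noteq> f y"
      using f xy False unfolding bij_betw_def inj_on_def by auto
    hence "1 \<le> dist (f x) (f y)" by (rule integer_lattice_separated)
    hence "2 * C * 1 \<le> 2 * C * dist (f x) (f y)" using C by (intro mult_left_mono) auto
    hence "s * dist x y \<le> (1 + 2 * C) * dist (f x) (f y)" using t2 by (simp add: algebra_simps)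
    hence "dist x y \<le> (1 + 2 * C) / s * dist (f x) (f y)" using s by (simp add: field_simps)
    also have "\<dots> \<le> L * dist (f x) (f y)" using L by (intro mult_right_mono) auto
    finally have "(1 / L) * dist x y \<le> dist (f x) (f y)" using L by (simp add: field_simps)
    with u show ?thesis by blast
  qed simp
  thus ?thesis using L(1) by blast
qed

text \<open>The block \<open>a y\<close> has to be near \<open>y\<close> but may differ from the one
  containing it. After redistribution each block holds m * m points, matched with an m by m square
  of lattice points. The bound \<open>small\<close> combines the rounding estimate 2 F + 2 with the
  factor 8 of \<open>redistribute\<close>.\<close>

lemma bilipschitz_from_blocks:
  fixes Y :: "(real^2) set" and a :: "real^2 \<Rightarrow> int \<times> int" and m :: nat
  assumes M: "M > 0" and m: "m > 0" and R: "R \<ge> 0"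
    and near: "\<And>y. y \<in> Y \<Longrightarrow> \<bar>y $ 1 - M * of_int (fst (a y))\<bar> \<le> R \<and> \<bar>y $ 2 - M * of_int (snd (a y))\<bar> \<le> R"
    and fin: "\<And>b. finite {y \<in> Y. a y = b}"
    and flow: "flowable F (\<lambda>j k. real (card {y \<in> Y. a y = (j, k)}) - real (m * m))"
    and small: "16 * F + 16 \<le> real (m * m)"
    and c: "c > 0" "\<And>x y. x \<in> Y \<Longrightarrow> y \<in> Y \<Longrightarrow> x \<noteq> y \<Longrightarrow> c \<le> dist x y"
  shows "\<exists>f :: real^2 \<Rightarrow> real^2. \<exists>L :: real. bij_betw f Y integer_lattice \<and> L \<ge> 1 \<and>
    (\<forall>x\<in>Y. \<forall>y\<in>Y. (1 / L) * dist x y \<le> dist (f x) (f y) \<and> dist (f x) (f y) \<le> L * dist x y)"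
proof -
  define A where "A j k = {y \<in> Y. a y = (j, k)}" for j k
  define d where "d j k = int (card (A j k)) - int (m * m)" for j k
  have "flowable F (\<lambda>j k. real_of_int (d j k))" using flow unfolding d_def A_def by simp
  from flow_rounding[OF this] obtain v h :: "int \<Rightarrow> int \<Rightarrow> int"
    where vh: "\<And>j k. \<bar>real_of_int (v j k)\<bar> \<le> 2 * F + 2" "\<And>j k. \<bar>real_of_int (h j k)\<bar> \<le> 2 * F + 2"
      and d: "\<And>j k. d j k = v j (k + 1) - v j k + h (j + 1) k - h j k" by blast
  have bnd: "8 * \<bar>x\<bar> \<le> int (m * m)" if "\<bar>real_of_int x\<bar> \<le> 2 * F + 2" for x
  proof -
    have "real_of_int (8 * \<bar>x\<bar>) \<le> real_of_int (int (m * m))" using that small by simp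
    thus ?thesis by (simp only: of_int_le_iff)
  qed
  obtain Z :: "int \<Rightarrow> int \<Rightarrow> (real^2) set" where Z: "\<And>j k. finite (Z j k)" "\<And>j k. int (card (Z j k)) = int (m * m)"
    "\<And>y j k. y \<in> A j k \<Longrightarrow> \<exists>!(j', k'). y \<in> Z j' k'"
    "\<And>y j k. y \<in> Z j k \<Longrightarrow> \<exists>j' k'. y \<in> A j' k' \<and> \<bar>j - j'\<bar> \<le> 1 \<and> \<bar>k - k'\<bar> \<le> 1"
    by (rule redistribute[of A "int (m * m)" v h])
      (use fin bnd vh d in \<open>auto simp: A_def d_def algebra_simps\<close>)
  define B where "B j k = {int m * j..<int m * j + int m} \<times> {int m * k..<int m * k + int m}" for j k :: int
  have B: "finite (B j k)" "card (B j k) = m * m" for j k by (simp_all add: B_def card_cartesian_product)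
  have inB: "x \<in> B j k \<longleftrightarrow> j = fst x div int m \<and> k = snd x div int m" for x j k
  proof -
    have "int m * j \<le> n \<and> n < int m * j + int m \<longleftrightarrow> j = n div int m" for n j
    proof
      show "j = n div int m" if "int m * j \<le> n \<and> n < int m * j + int m"
        using m that int_div_pos_eq[of n "int m" j "n - int m * j"] by simp
      show "int m * j \<le> n \<and> n < int m * j + int m" if "j = n div int m"
        using m pos_mod_sign[of "int m" n] pos_mod_bound[of "int m" n] mult_div_mod_eq[of "int m" n]
        unfolding that by linarith
    qed
    thus ?thesis unfolding B_def by (cases x) auto
  qed
  have "\<exists>\<beta>. bij_betw \<beta> (Z j k) (B j k)" for j k
    using Z(1)[of j k] Z(2)[of j k, unfolded of_nat_eq_iff] B[of j k] by (intro finite_same_card_bij) simp_all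
  then obtain \<beta> where \<beta>: "\<And>j k. bij_betw (\<beta> j k) (Z j k) (B j k)" by metis
  define g where "g y = (let p = (THE p. y \<in> Z (fst p) (snd p)) in \<beta> (fst p) (snd p) y)" for y
  have gZ: "g y = \<beta> j k y" if y: "y \<in> Z j k" for y j k
  proof -
    obtain j' k' where "y \<in> A j' k'" using Z(4)[OF y] by blast
    from Z(3)[OF this] have "\<exists>!p. y \<in> Z (fst p) (snd p)" by (simp only: case_prod_unfold)
    hence "(THE p. y \<in> Z (fst p) (snd p)) = (j, k)" using y by (intro the1_equality) auto
    thus ?thesis by (simp add: g_def)
  qed
  have Yex: "\<exists>j k. y \<in> Z j k" if "y \<in> Y" for y
    using Z(3)[of y "fst (a y)" "snd (a y)"] that unfolding A_def by auto
  have ZY: "y \<in> Y" if "y \<in> Z j k" for y j k using Z(4)[OF that] unfolding A_def by auto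
  have gB: "g y \<in> B j k" if "y \<in> Z j k" for y j k
    using gZ[OF that] \<beta>[of j k] that unfolding bij_betw_def by auto
  have "bij_betw g Y UNIV" unfolding bij_betw_def
  proof
    show "inj_on g Y"
    proof (rule inj_onI)
      fix x y assume xy: "x \<in> Y" "y \<in> Y" "g x = g y"
      obtain j k j' k' where jk: "x \<in> Z j k" "y \<in> Z j' k'" using Yex xy by metis
      have "j' = j" "k' = k" using gB[OF jk(1)] gB[OF jk(2)] xy(3) unfolding inB by auto
      thus "x = y" using xy(3) jk gZ \<beta>[of j k] unfolding bij_betw_def inj_on_def by metis
    qed
    show "g ` Y = UNIV"
    proof (intro equalityI subsetI)
      fix p :: "int \<times> int"
      have "p \<in> B (fst p div int m) (snd p div int m)" unfolding inB by simp
      then obtain y where y: "y \<in> Z (fst p div int m) (snd p div int m)" "p = \<beta> (fst p div int m) (snd p div int m) y"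
        using \<beta>[of "fst p div int m" "snd p div int m"] unfolding bij_betw_def by blast
      thus "p \<in> g ` Y" using gZ[OF y(1)] ZY[OF y(1)] by auto
    qed simp
  qed
  hence bij: "bij_betw (lattice_point \<circ> g) Y integer_lattice" using lattice_point_bij by (rule bij_betw_trans)
  define s where "s = real m / M"
  have s: "s > 0" using m M by (simp add: s_def)
  have coord: "\<bar>of_int n - s * x\<bar> \<le> 2 * real m + s * R"
    if n: "int m * j \<le> n" "n < int m * j + int m" and j: "\<bar>j - j'\<bar> \<le> 1" and x: "\<bar>x - M * of_int j'\<bar> \<le> R" for n j j' x
  proof -
    have "real_of_int (int m * j) \<le> of_int n" "real_of_int n < real_of_int (int m * j + int m)"
      using n by (simp_all only: of_int_le_iff of_int_less_iff)
    hence 1: "\<bar>of_int n - real m * of_int j\<bar> \<le> real m" by simp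
    have "real m * \<bar>real_of_int (j - j')\<bar> \<le> real m * 1" using j by (intro mult_left_mono) linarith+
    hence 2: "\<bar>real m * of_int j - real m * of_int j'\<bar> \<le> real m"
      by (simp add: abs_mult flip: right_diff_distrib of_int_diff)
    have "s * \<bar>x - M * of_int j'\<bar> \<le> s * R" using s x by (intro mult_left_mono) auto
    hence "\<bar>s * (x - M * of_int j')\<bar> \<le> s * R" using s by (simp add: abs_mult)
    moreover have "s * (x - M * of_int j') = s * x - real m * of_int j'" using M by (simp add: s_def field_simps)
    ultimately show ?thesis using 1 2 by linarith
  qed
  have "dist ((lattice_point \<circ> g) y) (s *\<^sub>R y) \<le> 2 * (2 * real m + s * R)" if y: "y \<in> Y" for y
  proof -
    obtain j k where jk: "y \<in> Z j k" using Yex[OF y] by blast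
    obtain j' k' where "y \<in> A j' k'" "\<bar>j - j'\<bar> \<le> 1" "\<bar>k - k'\<bar> \<le> 1" using Z(4)[OF jk] by blast
    moreover from this have "a y = (j', k')" unfolding A_def by simp
    moreover note gB[OF jk] near[OF y]
    ultimately have "\<bar>of_int (fst (g y)) - s * (y $ 1)\<bar> \<le> 2 * real m + s * R"
      "\<bar>of_int (snd (g y)) - s * (y $ 2)\<bar> \<le> 2 * real m + s * R"
      unfolding B_def by (intro coord[of j _ j'] coord[of k _ k']; auto)+
    thus ?thesis
      using dist_plane_le[of "lattice_point (g y)" "s *\<^sub>R y"] by (simp add: lattice_point_def)
  qed
  from bounded_displacement_bilipschitz[OF bij this s c] R s bij show ?thesis
    by (intro exI[of _ "lattice_point \<circ> g"]) auto
qed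

section \<open>Copies of the prototiles in complex coordinates\<close>

definition pl :: "complex \<Rightarrow> real^2" where
  "pl c = vector [Re c, Im c]"

definition cx :: "real^2 \<Rightarrow> complex" where
  "cx v = Complex (v $ 1) (v $ 2)"

lemma pl_components [simp]: "pl c $ 1 = Re c" "pl c $ 2 = Im c"
  by (simp_all add: pl_def)

lemma cx_components [simp]: "Re (cx v) = v $ 1" "Im (cx v) = v $ 2"
  by (simp_all add: cx_def)

lemma pl_cx [simp]: "pl (cx v) = v" "cx (pl c) = c"
  by (simp_all add: vec_eq_iff forall_2 complex_eq_iff)

lemma pl_eq_iff [simp]: "pl a = pl b \<longleftrightarrow> a = b"
  by (metis pl_cx(2))

lemma dist_pl [simp]: "dist (pl a) (pl b) = dist a b"
  by (simp add: dist_vec_def L2_set_def sum_2 dist_norm cmod_def)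

lemma bij_pl: "bij pl"
  by (rule o_bij[of cx]) (auto simp: fun_eq_iff)

lemma linear_pl: "linear pl"
  by (rule linearI) (simp_all add: vec_eq_iff forall_2)

lemma interior_pl: "interior (pl ` S) = pl ` interior S"
  using interior_bijective_linear_image[OF linear_pl bij_pl] .

fun inner_pos :: "tile_kind \<Rightarrow> real" where
  "inner_pos Kite = golden" | "inner_pos Dart = 1"

fun tip_label :: "tile_kind \<Rightarrow> corner_label" where
  "tip_label Kite = Label_T" | "tip_label Dart = Label_H"

fun wing_label :: "tile_kind \<Rightarrow> corner_label" where
  "wing_label Kite = Label_H" | "wing_label Dart = Label_T"

definition creg :: "tile \<Rightarrow> complex set" where
  "creg T = (\<Union>\<eta>\<in>turns. cell T \<eta>)"

definition region :: "tile \<Rightarrow> (real^2) set" where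
  "region T = pl ` creg T"

lemma inner_pos: "inner_pos k > 0" "slope k * inner_pos k = golden"
  using golden_pos by (cases k; simp)+

lemma cis_turns: "cis (pi/5) \<in> turns" "cnj (cis (pi/5)) \<in> turns"
  by (simp_all add: turns_def)

lemma proto_corners:
  "tip = pl 0" "wing1 = pl (G * cis (pi/5))" "wing2 = pl (G * cnj (cis (pi/5)))"
  "kite_tail = pl G" "dart_reflex = pl 1"
  by (simp_all add: tip_def wing1_def wing2_def kite_tail_def dart_reflex_def vec_eq_iff forall_2)

lemma corners_pl:
  "corners k = [(pl 0, tip_label k), (pl (G * cis (pi/5)), wing_label k),
     (pl (of_real (inner_pos k)), tip_label k), (pl (G * cnj (cis (pi/5))), wing_label k)]"
  by (cases k) (simp_all add: proto_corners)

lemma pl_scaleR: "a *\<^sub>R pl b = pl (of_real a * b)"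
  by (simp add: vec_eq_iff forall_2)

lemma pl_add: "pl a + pl b = pl (a + b)"
  by (simp add: vec_eq_iff forall_2)

lemma triangle_cell:
  assumes t: "\<eta> \<in> turns"
  shows "convex hull {pl 0, pl (G * \<eta>), pl (of_real (inner_pos k))} = pl ` cell (k, 0, 1) \<eta>"
proof (intro equalityI subsetI)
  fix x assume "x \<in> convex hull {pl 0, pl (G * \<eta>), pl (of_real (inner_pos k))}"
  then obtain u v s where uvs: "0 \<le> u" "0 \<le> v" "0 \<le> s" "u + v + s = 1"
    and x: "x = u *\<^sub>R pl 0 + v *\<^sub>R pl (G * \<eta>) + s *\<^sub>R pl (of_real (inner_pos k))"
    unfolding convex_hull_3 by blast
  have "x = pl (0 + 1 * (of_real (s * inner_pos k) + of_real (v * golden) * \<eta>))"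
    unfolding x pl_scaleR pl_add by (simp add: algebra_simps)
  moreover have "slope k * (s * inner_pos k) + v * golden \<le> golden"
  proof -
    have "slope k * (s * inner_pos k) + v * golden = (s + v) * golden"
      using inner_pos(2)[of k] by (metis distrib_right mult.left_commute)
    also have "\<dots> \<le> 1 * golden" using uvs golden_pos by (intro mult_right_mono) auto
    finally show ?thesis by simp
  qed
  moreover have "0 \<le> s * inner_pos k" "0 \<le> v * golden" using uvs golden_pos inner_pos(1)[of k] by auto
  ultimately show "x \<in> pl ` cell (k, 0, 1) \<eta>" using cell_memI[OF _ _ _ refl] by (metis imageI)
next
  fix x assume "x \<in> pl ` cell (k, 0, 1) \<eta>"
  then obtain a b where ab: "0 \<le> a" "0 \<le> b" "slope k * a + b \<le> golden"
    and x: "x = pl (of_real a + of_real b * \<eta>)" by auto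
  define s where "s = a / inner_pos k"
  define v where "v = b / golden"
  have "s = slope k * a / golden" using inner_pos[of k] slope_pos[of k] golden_pos by (simp add: s_def field_simps)
  hence "v + s = (slope k * a + b) / golden" by (simp add: v_def add_divide_distrib)
  hence vs: "v + s \<le> 1" using ab golden_pos by simp
  show "x \<in> convex hull {pl 0, pl (G * \<eta>), pl (of_real (inner_pos k))}"
    unfolding convex_hull_3
  proof (intro CollectI exI conjI)
    show "x = (1 - v - s) *\<^sub>R pl 0 + v *\<^sub>R pl (G * \<eta>) + s *\<^sub>R pl (of_real (inner_pos k))"
      unfolding x pl_scaleR pl_add using inner_pos(1)[of k] golden_pos by (simp add: s_def v_def)
  qed (use ab vs inner_pos(1)[of k] golden_pos in \<open>auto simp: s_def v_def\<close>)
qed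

lemma prototile_region: "prototile k = region (k, 0, 1)"
proof (cases k)
  case Dart
  show ?thesis unfolding Dart prototile.simps region_def creg_def turns_def proto_corners
    using triangle_cell[OF cis_turns(1), of Dart] triangle_cell[OF cis_turns(2), of Dart] by (simp add: image_Un)
next
  case Kite
  let ?z = "cis (pi/5)"
  note t = cis_turns(1)
  have cn: "cnj ?z = G - ?z" by (rule turn_cnj[OF t])
  have sub: "convex hull {tip, wing1, kite_tail, wing2} \<subseteq> region (Kite, 0, 1)"
  proof
    fix x assume "x \<in> convex hull {tip, wing1, kite_tail, wing2}"
    then obtain u v b where ub: "0 \<le> u" "0 \<le> v" "u + v = 1" "x = u *\<^sub>R tip + v *\<^sub>R b" "b \<in> convex hull {wing1, kite_tail, wing2}"
      by (subst (asm) convex_hull_insert) auto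
    from ub(5) obtain p q r where pqr: "0 \<le> p" "0 \<le> q" "0 \<le> r" "p + q + r = 1"
      "b = p *\<^sub>R wing1 + q *\<^sub>R kite_tail + r *\<^sub>R wing2" unfolding convex_hull_3 by blast
    define P where "P = v * p" define Q where "Q = v * q" define R where "R = v * r"
    have "P + Q + R = v * (p + q + r)" by (simp add: P_def Q_def R_def algebra_simps)
    hence le: "0 \<le> P" "0 \<le> Q" "0 \<le> R" "P + Q + R \<le> 1"
      using ub pqr by (simp_all add: P_def Q_def R_def)
    have x: "x = pl (of_real P * (G * ?z) + of_real Q * G + of_real R * (G * (G - ?z)))"
      unfolding ub(4) pqr(5) proto_corners scaleR_right_distrib pl_scaleR pl_add cn[symmetric]
      by (simp add: P_def Q_def R_def algebra_simps)
    have small: "golden * (P + Q) + R \<le> golden" "golden * (R + Q) + P \<le> golden"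
      using le golden_pos mult_left_mono[of "P + Q + R" 1 golden] mult_right_mono[of 1 golden R] mult_right_mono[of 1 golden P]
      by (simp_all add: algebra_simps)
    show "x \<in> region (Kite, 0, 1)"
    \<comment> \<open>As the two turns add up to \<open>G\<close>, equal amounts of both wings
      amount to a multiple of the axis. What remains lies on the side of the wing with the larger
      coefficient.\<close>
    proof (cases "R \<le> P")
      case True
      have "of_real P * (G * ?z) + of_real Q * G + of_real R * (G * (G - ?z)) \<in> cell (Kite, 0, 1) ?z"
      proof (rule cell_memI)
        show "0 \<le> golden * Q + (golden + 1) * R" "0 \<le> golden * (P - R)" using le True golden_pos by auto
        show "slope Kite * (golden * Q + (golden + 1) * R) + golden * (P - R) \<le> golden"
          using small by (simp add: algebra_simps)
      qed (simp add: algebra_simps turn_rules[OF t])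
      thus ?thesis using t unfolding x region_def creg_def by blast
    next
      case False
      have "of_real P * (G * ?z) + of_real Q * G + of_real R * (G * (G - ?z)) \<in> cell (Kite, 0, 1) (G - ?z)"
      proof (rule cell_memI)
        show "0 \<le> golden * Q + (golden + 1) * P" "0 \<le> golden * (R - P)" using le False golden_pos by auto
        show "slope Kite * (golden * Q + (golden + 1) * P) + golden * (R - P) \<le> golden"
          using small by (simp add: algebra_simps)
      qed (simp add: algebra_simps turn_rules[OF t])
      thus ?thesis using turn_other(1)[OF t] unfolding x region_def creg_def by blast
    qed
  qed
  have "pl ` cell (Kite, 0, 1) \<eta> \<subseteq> convex hull {tip, wing1, kite_tail, wing2}" if "\<eta> \<in> turns" for \<eta>
    unfolding triangle_cell[OF that, symmetric] proto_corners using that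
    by (intro hull_mono) (auto simp: turns_def)
  with sub show ?thesis unfolding Kite prototile.simps region_def creg_def by blast
qed

text \<open>After normalisation the isometry \<open>k\<close> fixes 0 and 1, so distances to these
  points determine the real part, and the imaginary part up to sign. Comparison with
  \<open>k \<i>\<close> makes the sign the same for all points.\<close>

lemma plane_isometry_complex:
  assumes "plane_isometry f"
  obtains z w where "norm w = 1" "(\<forall>x. f (pl x) = pl (z + w * x)) \<or> (\<forall>x. f (pl x) = pl (z + w * cnj x))"
proof -
  define g where "g x = cx (f (pl x))" for x
  have g: "norm (g x - g y) = norm (x - y)" for x y
  proof -
    have "dist (pl (g x)) (pl (g y)) = dist (pl x) (pl y)"
      using assms unfolding plane_isometry_def g_def by simp
    thus ?thesis unfolding dist_pl by (simp only: dist_norm)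
  qed
  define z where "z = g 0"
  define w where "w = g 1 - z"
  have w: "norm w = 1" using g[of 1 0] by (simp add: w_def z_def)
  hence w0: "w \<noteq> 0" by auto
  define k where "k x = (g x - z) / w" for x
  have k: "norm (k x - k y) = norm (x - y)" for x y
    unfolding k_def using g[of x y] w by (simp add: norm_divide flip: diff_divide_distrib)
  have k01: "k 0 = 0" "k 1 = 1" using w0 by (simp_all add: k_def z_def w_def)
  have sq: "(Re (k x - k y))\<^sup>2 + (Im (k x - k y))\<^sup>2 = (Re (x - y))\<^sup>2 + (Im (x - y))\<^sup>2" for x y
    using k[of x y] by (metis cmod_power2)
  have Re: "Re (k x) = Re x" for x
    using sq[of x 0] sq[of x 1] by (simp add: k01 power2_eq_square algebra_simps)
  have Im2: "(Im (k x))\<^sup>2 = (Im x)\<^sup>2" for x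
    using sq[of x 0] by (simp add: k01 Re)
  have gx: "f (pl x) = pl (z + w * k x)" for x
    using w0 by (simp add: k_def g_def)
  have prod: "Im (k x) * Im (k \<i>) = Im x" for x
    using sq[of x \<i>] Im2[of x] Im2[of \<i>] by (simp add: Re power2_eq_square algebra_simps)
  have "Im (k \<i>) = 1 \<or> Im (k \<i>) = -1" using Im2[of \<i>] by (simp add: power2_eq_1_iff)
  thus ?thesis
  proof
    assume "Im (k \<i>) = 1"
    hence "k x = x" for x using prod[of x] Re[of x] by (simp add: complex_eq_iff)
    thus ?thesis using that[OF w, of z] gx by simp
  next
    assume "Im (k \<i>) = -1"
    hence "k x = cnj x" for x using prod[of x] Re[of x] by (simp add: complex_eq_iff)
    thus ?thesis using that[OF w, of z] gx by simp
  qed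
qed

lemma image_setcompr2: "f ` {g a b | a b. Q a b} = {f (g a b) | a b. Q a b}"
  by blast

lemma cell_affine: "(\<lambda>x. z + w * x) ` cell (k, 0, 1) \<eta> = cell (k, z, w) \<eta>"
  unfolding cell.simps image_setcompr2 by simp

lemma creg_affine: "(\<lambda>x. z + w * x) ` creg (k, 0, 1) = creg (k, z, w)"
  unfolding creg_def image_UN cell_affine ..

lemma creg_cnj: "cnj ` creg (k, 0, 1) = creg (k, 0, 1)"
proof -
  have c: "cnj ` cell (k, 0, 1) \<eta> = cell (k, 0, 1) (cnj \<eta>)" for \<eta>
    unfolding cell.simps image_setcompr2 by simp
  show ?thesis unfolding creg_def image_UN c turns_def by auto
qed

text \<open>Conjugation preserves the region of the prototile, so a reflected copy has the same
  description by z and w as a rotated one.\<close>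

lemma is_copyE:
  assumes "is_copy k f S"
  obtains z w where "norm w = 1" "S = region (k, z, w)"
    "(\<forall>x. f (pl x) = pl (z + w * x)) \<or> (\<forall>x. f (pl x) = pl (z + w * cnj x))"
proof -
  obtain z w where zw: "norm w = 1" "(\<forall>x. f (pl x) = pl (z + w * x)) \<or> (\<forall>x. f (pl x) = pl (z + w * cnj x))"
    using plane_isometry_complex assms unfolding is_copy_def by blast
  have S: "S = f ` pl ` creg (k, 0, 1)" using assms unfolding is_copy_def prototile_region region_def by simp
  from zw(2) have "S = region (k, z, w)"
  proof
    assume "\<forall>x. f (pl x) = pl (z + w * x)"
    hence "S = pl ` (\<lambda>x. z + w * x) ` creg (k, 0, 1)" unfolding S image_image by simp
    thus ?thesis unfolding region_def creg_affine .
  next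
    assume "\<forall>x. f (pl x) = pl (z + w * cnj x)"
    hence "S = pl ` (\<lambda>x. z + w * x) ` cnj ` creg (k, 0, 1)" unfolding S image_image by simp
    thus ?thesis unfolding region_def creg_cnj creg_affine .
  qed
  with zw that show ?thesis by blast
qed

lemma is_copy_region:
  assumes "norm w = 1"
  shows "is_copy k (\<lambda>x. pl (z + w * cx x)) (region (k, z, w))"
proof -
  have 1: "dist (pl (z + w * cx x)) (pl (z + w * cx y)) = dist x y" for x y
  proof -
    have "dist (z + w * cx x) (z + w * cx y) = dist (cx x) (cx y)"
      using assms by (simp add: dist_norm norm_mult flip: right_diff_distrib)
    also have "\<dots> = dist x y" using dist_pl[of "cx x" "cx y"] by simp
    finally show ?thesis by simp
  qed
  have 2: "region (k, z, w) = (\<lambda>x. pl (z + w * cx x)) ` prototile k"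
    unfolding prototile_region region_def creg_affine[symmetric, of k z w] image_image pl_cx ..
  show ?thesis unfolding is_copy_def plane_isometry_def by (intro conjI allI 1 2)
qed

section \<open>A tile is determined by its region\<close>

lemma mem_cell:
  assumes "w \<noteq> 0" "\<eta> \<in> turns"
  shows "z + w * (of_real a + of_real b * \<eta>) \<in> cell (k, z, w) \<eta> \<longleftrightarrow> 0 \<le> a \<and> 0 \<le> b \<and> slope k * a + b \<le> golden"
proof
  assume "z + w * (of_real a + of_real b * \<eta>) \<in> cell (k, z, w) \<eta>"
  then obtain a' b' where e: "z + w * (of_real a + of_real b * \<eta>) = z + w * (of_real a' + of_real b' * \<eta>)"
    and "0 \<le> a' \<and> 0 \<le> b' \<and> slope k * a' + b' \<le> golden" unfolding cell.simps by blast
  thus "0 \<le> a \<and> 0 \<le> b \<and> slope k * a + b \<le> golden" using coords_inj[OF assms e] by simp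
qed (use cell_memI[OF _ _ _ refl] in blast)

lemma mem_creg:
  assumes "w \<noteq> 0" "\<eta> \<in> turns"
  shows "z + w * (of_real a + of_real b * \<eta>) \<in> creg (k, z, w) \<longleftrightarrow>
    0 \<le> a \<and> 0 \<le> b \<and> slope k * a + b \<le> golden \<or>
    b \<le> 0 \<and> 0 \<le> a + golden * b \<and> slope k * (a + golden * b) - b \<le> golden"
proof -
  have "z + w * (of_real a + of_real b * \<eta>) = z + w * (of_real (a + golden * b) + of_real (- b) * (G - \<eta>))"
    by (simp add: algebra_simps)
  hence "z + w * (of_real a + of_real b * \<eta>) \<in> cell (k, z, w) (G - \<eta>) \<longleftrightarrow>
      0 \<le> a + golden * b \<and> 0 \<le> - b \<and> slope k * (a + golden * b) + - b \<le> golden"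
    by (simp only: mem_cell[OF assms(1) turn_other(1)[OF assms(2)]])
  thus ?thesis unfolding creg_def turns_eq[OF assms(2)] using mem_cell[OF assms, of z a b k]
    by (auto simp del: cell.simps)
qed

lemma creg_hull:
  assumes t: "\<eta> \<in> turns" and w: "w \<noteq> 0"
  shows "creg (k, z, w) \<subseteq> convex hull {z, z + G * w, z + G * w * \<eta>, z + G * w * (G - \<eta>)}"
proof
  fix x assume "x \<in> creg (k, z, w)"
  then obtain \<theta> a b where s: "\<theta> \<in> turns" and ab: "0 \<le> a" "0 \<le> b" "slope k * a + b \<le> golden"
    and x: "x = z + w * (of_real a + of_real b * \<theta>)" unfolding creg_def by auto
  have "1 \<le> slope k" using golden_pos by (cases k) auto
  hence "1 * a \<le> slope k * a" using ab by (intro mult_right_mono) auto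
  hence le: "a + b \<le> golden" using ab by simp
  have "x = (1 - (a + b) / golden) *\<^sub>R z + (a / golden) *\<^sub>R (z + G * w) + (b / golden) *\<^sub>R (z + G * w * \<theta>)"
    unfolding x scaleR_conv_of_real using G_nonzero by (simp add: field_simps)
  moreover have "(a + b) / golden \<le> 1" using le golden_pos by simp
  hence "0 \<le> 1 - (a + b) / golden" "0 \<le> a / golden" "0 \<le> b / golden"
    "1 - (a + b) / golden + a / golden + b / golden = 1"
    using ab golden_pos by (auto simp: add_divide_distrib)
  ultimately have "x \<in> convex hull {z, z + G * w, z + G * w * \<theta>}"
    unfolding convex_hull_3 by blast
  thus "x \<in> convex hull {z, z + G * w, z + G * w * \<eta>, z + G * w * (G - \<eta>)}"
    using turn_cases[OF t s] hull_mono[of "{z, z + G * w, z + G * w * \<theta>}" "{z, z + G * w, z + G * w * \<eta>, z + G * w * (G - \<eta>)}" convex]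
    by blast
qed

lemma wing_distance_gt: assumes "\<eta> \<in> turns" shows "golden < 2 * golden * \<bar>Im \<eta>\<bar>"
  using turn_Im_abs[OF assms] golden_pos by simp

lemma wing_difference:
  assumes "\<eta> \<in> turns" "norm w = 1"
  shows "norm (G * w * \<eta> - G * w * (G - \<eta>)) = 2 * golden * \<bar>Im \<eta>\<bar>"
proof -
  have "G * w * \<eta> - G * w * (G - \<eta>) = G * w * (2 * \<i> * of_real (Im \<eta>))"
    using turn_Re[OF assms(1)] by (simp add: complex_eq_iff algebra_simps)
  thus ?thesis using assms(2) golden_pos by (simp add: norm_mult)
qed

lemma norm_turn_minus_1: assumes "\<eta> \<in> turns" shows "norm (\<eta> - 1) \<le> 1"
proof -
  have "(norm (\<eta> - 1))\<^sup>2 = (golden / 2 - 1)\<^sup>2 + Im \<eta> * Im \<eta>"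
    unfolding cmod_power2 minus_complex.simps turn_Re[OF assms] by (simp add: power2_eq_square)
  also have "\<dots> = 2 - golden" using turn_Im[OF assms] golden_sq by (simp add: power2_eq_square field_simps)
  also have "\<dots> \<le> 1\<^sup>2" using golden_pos by simp
  finally show ?thesis by (rule power2_le_imp_le) simp
qed

text \<open>The hull of the tip, the wings and \<open>z + G * w\<close> contains the tile for either
  kind, and the wings are its only vertices further apart than \<open>golden\<close>. As longest
  segments of a polytope end in vertices, the region determines its pair of wings.\<close>

lemma wings_diametral:
  assumes t: "\<eta> \<in> turns" and w: "norm w = 1" and x: "x \<in> creg (k, z, w)" and y: "y \<in> creg (k, z, w)"
    and far: "2 * golden * \<bar>Im \<eta>\<bar> \<le> norm (x - y)"
  shows "{x, y} = {z + G * w * \<eta>, z + G * w * (G - \<eta>)}"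
proof -
  let ?S = "{z, z + G * w, z + G * w * \<eta>, z + G * w * (G - \<eta>)}"
  let ?D = "2 * golden * \<bar>Im \<eta>\<bar>"
  note t' = turn_other(1)[OF t]
  have w0: "w \<noteq> 0" using w by auto
  have e: "norm (G * w) = golden" using w golden_pos by (simp add: norm_mult)
  have e': "norm (G * w * \<theta>) = golden" "norm (G * w * \<theta> - G * w) \<le> golden" "norm (G * w - G * w * \<theta>) \<le> golden"
    if "\<theta> \<in> turns" for \<theta>
  proof -
    have "G * w * \<theta> - G * w = G * w * (\<theta> - 1)" by (simp add: algebra_simps)
    hence "norm (G * w * \<theta> - G * w) = golden * norm (\<theta> - 1)" by (simp only: norm_mult[of "G * w"] e)
    also have "\<dots> \<le> golden * 1" using norm_turn_minus_1[OF that] golden_pos by (intro mult_left_mono) auto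
    finally show "norm (G * w * \<theta> - G * w) \<le> golden" by simp
    thus "norm (G * w - G * w * \<theta>) \<le> golden" by (simp add: norm_minus_commute)
    show "norm (G * w * \<theta>) = golden" unfolding norm_mult[of "G * w"] e using turn_norm[OF that] by simp
  qed
  have pair: "norm (u - v) \<le> golden \<or> {u, v} = {z + G * w * \<eta>, z + G * w * (G - \<eta>)}" if "u \<in> ?S" "v \<in> ?S" for u v
    using that e e'[OF t] e'[OF t'] golden_pos by (auto simp: norm_minus_commute)
  have D: "golden < ?D" by (rule wing_distance_gt[OF t])
  have pairD: "norm (u - v) \<le> ?D" if "u \<in> ?S" "v \<in> ?S" for u v
  proof (cases "norm (u - v) \<le> golden")
    case False
    hence "u = z + G * w * \<eta> \<and> v = z + G * w * (G - \<eta>) \<or> v = z + G * w * \<eta> \<and> u = z + G * w * (G - \<eta>)"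
      using pair[OF that] by (auto simp: doubleton_eq_iff)
    thus ?thesis using wing_difference[OF t w]
      by (elim disjE conjE) (simp_all add: norm_minus_commute)
  qed (use D in simp)
  have "\<exists>u\<in>?S. \<exists>v\<in>?S. \<forall>x\<in>convex hull ?S. \<forall>y\<in>convex hull ?S. norm (x - y) \<le> norm (u - v)"
    by (rule simplex_extremal_le) auto
  hence hullD: "norm (x - y) \<le> ?D" if "x \<in> convex hull ?S" "y \<in> convex hull ?S" for x y
    using that pairD by (meson order_trans)
  have inS: "x \<in> ?S" if "x \<in> convex hull ?S" "y \<in> convex hull ?S" "?D \<le> norm (x - y)" for x y
  proof (rule ccontr)
    assume "x \<notin> ?S"
    have fin: "finite ?S" by simp
    from bspec[OF simplex_furthest_lt[OF fin, of y] that(1)] \<open>x \<notin> ?S\<close>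
    obtain y' where "y' \<in> convex hull ?S" "norm (x - y) < norm (y' - y)" by (meson bexE)
    with hullD[of y' y] that show False by simp
  qed
  have h: "x \<in> convex hull ?S" "y \<in> convex hull ?S" using x y creg_hull[OF t w0] by blast+
  have "x \<in> ?S" using inS[OF h far] .
  moreover have "y \<in> ?S" using inS[OF h(2,1)] far by (simp add: norm_minus_commute)
  ultimately show ?thesis using pair[of x y] far D by linarith
qed

text \<open>Equal regions have equal pairs of wings. If the wings correspond in order, tip and axis
  agree, and the tail of the kite, which is outside the dart, tells the kind. If they are swapped,
  the axes are opposite and one tip would lie at distance \<open>golden + 1\<close> on the axis of
  the other tile, outside of it.\<close>

lemma creg_inj:
  assumes w: "norm w = 1" "norm w' = 1" and eq: "creg (k, z, w) = creg (k', z', w')"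
  shows "(k, z, w) = (k', z', w')"
proof -
  define \<eta> where "\<eta> = cis (pi/5)"
  have t: "\<eta> \<in> turns" by (simp add: \<eta>_def turns_def)
  note t' = turn_other(1)[OF t]
  have w0: "w \<noteq> 0" "w' \<noteq> 0" using w by auto
  have wing: "z' + G * w' * \<theta> \<in> creg (k', z', w')" if "\<theta> \<in> turns" for \<theta>
    using mem_creg[OF w0(2) that, of z' 0 golden k'] golden_pos by (simp add: mult.assoc mult.left_commute)
  have "{z' + G * w' * \<eta>, z' + G * w' * (G - \<eta>)} = {z + G * w * \<eta>, z + G * w * (G - \<eta>)}"
    by (rule wings_diametral[where k = k, OF t w(1)]) (use wing[OF t] wing[OF t'] eq wing_difference[OF t w(2)] in simp_all)
  hence "z' + G * w' * \<eta> = z + G * w * \<eta> \<and> z' + G * w' * (G - \<eta>) = z + G * w * (G - \<eta>) \<or>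
     z' + G * w' * \<eta> = z + G * w * (G - \<eta>) \<and> z' + G * w' * (G - \<eta>) = z + G * w * \<eta>"
    by (simp add: doubleton_eq_iff)
  thus ?thesis
  proof
    assume *: "z' + G * w' * \<eta> = z + G * w * \<eta> \<and> z' + G * w' * (G - \<eta>) = z + G * w * (G - \<eta>)"
    hence "G * (2 * \<eta> - G) * w' = G * (2 * \<eta> - G) * w" by algebra
    moreover have nz: "G * (2 * \<eta> - G) \<noteq> 0" using G_nonzero turn_other(2)[OF t] by auto
    ultimately have ww: "w' = w" by simp
    hence zz: "z' = z" using * by simp
    have "k = k'"
    proof (rule ccontr)
      assume "k \<noteq> k'"
      moreover have False if "creg (Kite, z, w) = creg (Dart, z, w)"
      proof -
        have "z + w * (of_real golden + of_real 0 * \<eta>) \<in> creg (Kite, z, w)"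
          unfolding mem_creg[OF w0(1) t] using golden_pos by simp
        hence "golden * golden \<le> golden" unfolding that mem_creg[OF w0(1) t] by simp
        thus False using golden_sq by simp
      qed
      ultimately show False using eq unfolding ww zz by (cases k; cases k') auto
    qed
    thus ?thesis using ww zz by simp
  next
    assume *: "z' + G * w' * \<eta> = z + G * w * (G - \<eta>) \<and> z' + G * w' * (G - \<eta>) = z + G * w * \<eta>"
    hence "G * (2 * \<eta> - G) * w' = G * (2 * \<eta> - G) * (- w)" by algebra
    moreover have nz: "G * (2 * \<eta> - G) \<noteq> 0" using G_nonzero turn_other(2)[OF t] by auto
    ultimately have ww: "w' = - w" using mult_left_cancel[OF nz] by blast
    have zz: "z = z' + w' * (of_real (golden + 1) + of_real 0 * \<eta>)" using * G_sq unfolding ww by (simp, algebra)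
    have "z + w * (of_real 0 + of_real 0 * \<eta>) \<in> creg (k, z, w)"
      unfolding mem_creg[OF w0(1) t] using golden_pos by simp
    hence "z' + w' * (of_real (golden + 1) + of_real 0 * \<eta>) \<in> creg (k', z', w')"
      unfolding eq[symmetric] using zz by simp
    hence "slope k' * (golden + 1) \<le> golden" unfolding mem_creg[OF w0(2) t] by auto
    moreover have "slope k' * (golden + 1) \<ge> 1 * (golden + 1)" using golden_pos by (intro mult_right_mono) (cases k'; simp)+
    ultimately show ?thesis by simp
  qed
qed

lemma region_inj:
  assumes "norm w = 1" "norm w' = 1" "region (k, z, w) = region (k', z', w')"
  shows "(k, z, w) = (k', z', w')"
proof (rule creg_inj[OF assms(1,2)])
  show "creg (k, z, w) = creg (k', z', w')"
    using assms(3) unfolding region_def using bij_pl by (metis bij_is_inj inj_image_eq_iff)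
qed

lemma copy_of_region:
  assumes "norm w = 1" "is_copy k' f (region (k, z, w))"
  shows "k' = k" "(\<forall>x. f (pl x) = pl (z + w * x)) \<or> (\<forall>x. f (pl x) = pl (z + w * cnj x))"
proof -
  obtain z' w' where *: "norm w' = 1" "region (k, z, w) = region (k', z', w')"
    "(\<forall>x. f (pl x) = pl (z' + w' * x)) \<or> (\<forall>x. f (pl x) = pl (z' + w' * cnj x))"
    by (rule is_copyE[OF assms(2)])
  from region_inj[OF assms(1) *(1,2)] * show "k' = k"
    "(\<forall>x. f (pl x) = pl (z + w * x)) \<or> (\<forall>x. f (pl x) = pl (z + w * cnj x))" by auto
qed

text \<open>Corners are defined through all isometries producing the region. By
  \<open>copy_of_region\<close> these differ by the reflection in the axis only, so labels can be
  read off k, z and w.\<close>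

lemma has_corner_region:
  assumes w: "norm w = 1"
  shows "has_corner (region (k, z, w)) v l \<longleftrightarrow>
    l = tip_label k \<and> (v = pl z \<or> v = pl (z + of_real (inner_pos k) * w)) \<or>
    l = wing_label k \<and> (\<exists>\<eta>\<in>turns. v = pl (z + G * w * \<eta>))" (is "_ \<longleftrightarrow> ?R")
proof
  assume "has_corner (region (k, z, w)) v l"
  then obtain k' f x where f: "is_copy k' f (region (k, z, w))" and x: "(x, l) \<in> set (corners k')" "v = f x"
    unfolding has_corner_def by blast
  note k = copy_of_region[OF w f]
  from x k(2) show ?R unfolding corners_pl k(1) turns_def
    by (auto simp: mult.commute mult.left_commute)
next
  assume R: ?R
  let ?f = "\<lambda>x. pl (z + w * cx x)"
  have "\<exists>x. (x, l) \<in> set (corners k) \<and> v = ?f x"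
    using R unfolding corners_pl turns_def by (auto simp: mult.commute mult.left_commute)
  thus "has_corner (region (k, z, w)) v l" using is_copy_region[OF w] unfolding has_corner_def by blast
qed

lemma tile_edges_region:
  assumes w: "norm w = 1"
  shows "tile_edges (region (k, z, w)) =
    (\<lambda>\<eta>. closed_segment (pl z) (pl (z + G * w * \<eta>))) ` turns \<union>
    (\<lambda>\<eta>. closed_segment (pl (z + G * w * \<eta>)) (pl (z + of_real (inner_pos k) * w))) ` turns" (is "_ = ?R")
proof -
  let ?z = "cis (pi/5)"
  have r: "z + G * w * \<eta> = z + w * (G * \<eta>)" "z + of_real (inner_pos k) * w = z + w * of_real (inner_pos k)" for \<eta>
    by simp_all
  have R: "?R = {closed_segment (pl z) (pl (z + w * (G * ?z))), closed_segment (pl z) (pl (z + w * (G * cnj ?z))),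
      closed_segment (pl (z + w * (G * ?z))) (pl (z + w * of_real (inner_pos k))),
      closed_segment (pl (z + w * (G * cnj ?z))) (pl (z + w * of_real (inner_pos k)))}"
    unfolding r turns_def by blast
  have edge: "(\<exists>i<4. e = closed_segment (f (fst (corners k ! i))) (f (fst (corners k ! ((i + 1) mod 4))))) \<longleftrightarrow>
      e \<in> {closed_segment (f (pl 0)) (f (pl (G * ?z))), closed_segment (f (pl (G * ?z))) (f (pl (of_real (inner_pos k)))),
        closed_segment (f (pl (of_real (inner_pos k)))) (f (pl (G * cnj ?z))), closed_segment (f (pl (G * cnj ?z))) (f (pl 0))}"
    for e f
  proof -
    have "(\<exists>i<4. Q i) \<longleftrightarrow> Q 0 \<or> Q 1 \<or> Q 2 \<or> Q 3" for Q :: "nat \<Rightarrow> bool"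
      by (simp add: numeral_eq_Suc Ex_less_Suc2)
    thus ?thesis unfolding corners_pl by simp
  qed
  show ?thesis
  proof (intro equalityI subsetI)
    fix e assume "e \<in> tile_edges (region (k, z, w))"
    then obtain k' f where f: "is_copy k' f (region (k, z, w))"
      and "\<exists>i<4. e = closed_segment (f (fst (corners k' ! i))) (f (fst (corners k' ! ((i + 1) mod 4))))"
      unfolding tile_edges_def by blast
    hence "e \<in> {closed_segment (f (pl 0)) (f (pl (G * ?z))), closed_segment (f (pl (G * ?z))) (f (pl (of_real (inner_pos k)))),
        closed_segment (f (pl (of_real (inner_pos k)))) (f (pl (G * cnj ?z))), closed_segment (f (pl (G * cnj ?z))) (f (pl 0))}"
      unfolding copy_of_region(1)[OF w f] edge by blast
    with copy_of_region(2)[OF w f] show "e \<in> ?R" unfolding R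
      by (elim disjE insertE emptyE) (simp_all add: closed_segment_commute del: closed_segment_eq)
  next
    fix e assume "e \<in> ?R"
    hence "\<exists>i<4. e = closed_segment (pl (z + w * cx (fst (corners k ! i)))) (pl (z + w * cx (fst (corners k ! ((i + 1) mod 4)))))"
      unfolding edge[of e "\<lambda>x. pl (z + w * cx x)"] R
      by (elim insertE emptyE) (simp_all add: closed_segment_commute del: closed_segment_eq)
    then obtain i where "i < 4" "e = closed_segment (pl (z + w * cx (fst (corners k ! i)))) (pl (z + w * cx (fst (corners k ! ((i + 1) mod 4)))))"
      by blast
    with is_copy_region[OF w, of k z] show "e \<in> tile_edges (region (k, z, w))" unfolding tile_edges_def
      by (intro CollectI exI[of _ k] exI[of _ "\<lambda>x. pl (z + w * cx x)"] exI[of _ i] conjI)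
  qed
qed

section \<open>The tiles of a Penrose tiling form a matched family\<close>

definition tiles_of :: "(real^2) set set \<Rightarrow> tile set" where
  "tiles_of \<tau> = {(k, z, w) | k z w. norm w = 1 \<and> region (k, z, w) \<in> \<tau>}"

lemma creg_near_tip:
  assumes "norm w = 1" "x \<in> creg (k, z, w)" shows "norm (x - z) \<le> 2"
proof -
  obtain \<theta> a b where s: "\<theta> \<in> turns" and ab: "0 \<le> a" "0 \<le> b" "slope k * a + b \<le> golden"
    and x: "x = z + w * (of_real a + of_real b * \<theta>)" using assms(2) unfolding creg_def by auto
  have "1 * a \<le> slope k * a" using ab golden_pos by (intro mult_right_mono) (cases k; simp)+
  hence le: "a + b \<le> 2" using ab golden_bounds by simp
  have "norm (x - z) = norm (of_real a + of_real b * \<theta>)" using assms(1) by (simp add: x norm_mult)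
  also have "\<dots> \<le> a + b" by (rule order_trans[OF norm_triangle_ineq]) (use ab turn_norm[OF s] in \<open>simp add: norm_mult\<close>)
  finally show ?thesis using le by simp
qed

lemma closed_creg: "norm w = 1 \<Longrightarrow> closed (creg (k, z, w))"
  unfolding creg_def by (intro closed_UN finite_turns ballI closed_cell) auto

text \<open>Common points of the two halves lie on the line of the axis, which contains no
  disc.\<close>

lemma cells_of_tile_disjoint:
  assumes w: "norm w = 1" and t: "\<eta> \<in> turns"
  shows "interior (cell (k, z, w) \<eta>) \<inter> interior (cell (k, z, w) (G - \<eta>)) = {}"
proof (rule ccontr)
  assume "interior (cell (k, z, w) \<eta>) \<inter> interior (cell (k, z, w) (G - \<eta>)) \<noteq> {}"
  then obtain x where "x \<in> interior (cell (k, z, w) \<eta>) \<inter> interior (cell (k, z, w) (G - \<eta>))" by blast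
  then obtain e where e: "e > 0" "ball x e \<subseteq> interior (cell (k, z, w) \<eta>) \<inter> interior (cell (k, z, w) (G - \<eta>))"
    by (metis open_Int open_contains_ball open_interior)
  have w0: "w \<noteq> 0" using w by auto
  have z: "Im ((y - z) / w) = 0" if "y \<in> ball x e" for y
  proof -
    have y: "y \<in> cell (k, z, w) \<eta>" "y \<in> cell (k, z, w) (G - \<eta>)" using that e(2) interior_subset by blast+
    have "0 \<le> Im ((y - z) / w) / Im \<eta>" using y(1) unfolding cell_alt[OF w0 t] by blast
    moreover have "0 \<le> Im ((y - z) / w) / Im (G - \<eta>)" using y(2) unfolding cell_alt[OF w0 turn_other(1)[OF t]] by blast
    ultimately show ?thesis using turn_Im_nonzero[OF t] by (auto simp: divide_le_0_iff zero_le_divide_iff)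
  qed
  let ?y = "x + of_real (e / 2) * \<i> * w"
  have "?y \<in> ball x e" using e(1) w by (simp add: dist_norm norm_mult)
  from z[OF this] z[of x] e(1) w0 show False by (simp add: add_divide_distrib diff_divide_distrib)
qed

lemma segment_coords:
  assumes "w \<noteq> 0" "\<eta> \<in> turns"
    "z + w * (of_real a + of_real b * \<eta>) \<in>
      closed_segment (z + w * (of_real a1 + of_real b1 * \<eta>)) (z + w * (of_real a2 + of_real b2 * \<eta>))"
  obtains u where "0 \<le> u" "u \<le> 1" "a = (1 - u) * a1 + u * a2" "b = (1 - u) * b1 + u * b2"
proof -
  obtain u where u: "0 \<le> u" "u \<le> 1" and e: "z + w * (of_real a + of_real b * \<eta>) =
      (1 - u) *\<^sub>R (z + w * (of_real a1 + of_real b1 * \<eta>)) + u *\<^sub>R (z + w * (of_real a2 + of_real b2 * \<eta>))"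
    using assms(3) unfolding in_segment by blast
  have "z + w * (of_real a + of_real b * \<eta>) =
      z + w * (of_real ((1 - u) * a1 + u * a2) + of_real ((1 - u) * b1 + u * b2) * \<eta>)"
    unfolding e scaleR_conv_of_real by (simp add: algebra_simps)
  from coords_inj[OF assms(1,2) this] u that show ?thesis by blast
qed

lemma closed_segment_pl: "pl x \<in> closed_segment (pl a) (pl b) \<longleftrightarrow> x \<in> closed_segment a b"
  using closed_segment_linear_image[OF linear_pl, of a b] by (auto simp: image_iff)

lemma corner_coords:
  "z = z + w * (of_real 0 + of_real 0 * \<eta>)" "z + G * w * \<eta> = z + w * (of_real 0 + of_real golden * \<eta>)"
  "z + G * w * (G - \<eta>) = z + w * (of_real (golden + 1) + of_real (- golden) * \<eta>)"
  "z + of_real c * w = z + w * (of_real c + of_real 0 * \<eta>)"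
  using G_sq by (simp_all add: algebra_simps flip: distrib_left)

lemma not_on_other_edges:
  assumes "w \<noteq> 0" "\<eta> \<in> turns" "0 < b"
  shows "z + w * (of_real a + of_real b * \<eta>) \<notin> closed_segment z (z + G * w * (G - \<eta>))"
    "z + w * (of_real a + of_real b * \<eta>) \<notin> closed_segment (z + G * w * (G - \<eta>)) (z + of_real c * w)"
proof -
  note g = golden_pos and sc = segment_coords[OF assms(1,2), of z a b]
  show "z + w * (of_real a + of_real b * \<eta>) \<notin> closed_segment z (z + G * w * (G - \<eta>))"
  proof
    assume "z + w * (of_real a + of_real b * \<eta>) \<in> closed_segment z (z + G * w * (G - \<eta>))"
    hence "z + w * (of_real a + of_real b * \<eta>) \<in>
      closed_segment (z + w * (of_real 0 + of_real 0 * \<eta>)) (z + w * (of_real (golden + 1) + of_real (- golden) * \<eta>))"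
      unfolding corner_coords(3) by simp
    then obtain u where "0 \<le> u" "b = (1 - u) * 0 + u * - golden" by (elim sc)
    moreover have "0 \<le> u * golden" using \<open>0 \<le> u\<close> g by simp
    ultimately show False using assms(3) by simp
  qed
  show "z + w * (of_real a + of_real b * \<eta>) \<notin> closed_segment (z + G * w * (G - \<eta>)) (z + of_real c * w)"
  proof
    assume "z + w * (of_real a + of_real b * \<eta>) \<in> closed_segment (z + G * w * (G - \<eta>)) (z + of_real c * w)"
    hence "z + w * (of_real a + of_real b * \<eta>) \<in>
      closed_segment (z + w * (of_real (golden + 1) + of_real (- golden) * \<eta>)) (z + w * (of_real c + of_real 0 * \<eta>))"
      unfolding corner_coords(3) by (simp add: mult.commute)
    then obtain u where "u \<le> 1" "b = (1 - u) * - golden + u * 0" by (elim sc)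
    moreover have "0 \<le> (1 - u) * golden" using \<open>u \<le> 1\<close> g by simp
    ultimately show False using assms(3) by simp
  qed
qed

lemma not_on_own_edge:
  assumes "w \<noteq> 0" "\<eta> \<in> turns"
  shows "0 < a \<Longrightarrow> z + w * (of_real a + of_real b * \<eta>) \<notin> closed_segment z (z + G * w * \<eta>)"
    "0 < c \<Longrightarrow> 0 < b \<Longrightarrow> b < golden \<Longrightarrow>
      z + w * (of_real 0 + of_real b * \<eta>) \<notin> closed_segment (z + G * w * \<eta>) (z + of_real c * w)"
proof -
  note sc = segment_coords[OF assms, of z]
  show "z + w * (of_real a + of_real b * \<eta>) \<notin> closed_segment z (z + G * w * \<eta>)" if "0 < a"
  proof
    assume "z + w * (of_real a + of_real b * \<eta>) \<in> closed_segment z (z + G * w * \<eta>)"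
    hence "z + w * (of_real a + of_real b * \<eta>) \<in>
      closed_segment (z + w * (of_real 0 + of_real 0 * \<eta>)) (z + w * (of_real 0 + of_real golden * \<eta>))"
      by (simp add: mult.assoc mult.left_commute)
    then obtain u where "a = (1 - u) * 0 + u * 0" by (elim sc)
    with that show False by simp
  qed
  show "z + w * (of_real 0 + of_real b * \<eta>) \<notin> closed_segment (z + G * w * \<eta>) (z + of_real c * w)"
    if "0 < c" "0 < b" "b < golden"
  proof
    assume "z + w * (of_real 0 + of_real b * \<eta>) \<in> closed_segment (z + G * w * \<eta>) (z + of_real c * w)"
    hence "z + w * (of_real 0 + of_real b * \<eta>) \<in>
      closed_segment (z + w * (of_real 0 + of_real golden * \<eta>)) (z + w * (of_real c + of_real 0 * \<eta>))"
      by (simp add: mult.assoc mult.left_commute mult.commute[of w "of_real c"])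
    then obtain u where "0 = (1 - u) * 0 + u * c" "b = (1 - u) * golden + u * 0" by (elim sc)
    with that show False by simp
  qed
qed

section \<open>The tile on the other side of an edge\<close>

context
  fixes \<tau> :: "(real^2) set set"
  assumes pt: "penrose_tiling \<tau>"
begin

lemma tile_of: assumes "S \<in> \<tau>" obtains T where "T \<in> tiles_of \<tau>" "S = region T"
proof -
  obtain k f where "is_copy k f S" using pt assms unfolding penrose_tiling_def by blast
  then obtain z w where "norm w = 1" "S = region (k, z, w)" by (elim is_copyE) blast
  with assms that show ?thesis unfolding tiles_of_def by blast
qed

lemma region_in: "T \<in> tiles_of \<tau> \<Longrightarrow> region T \<in> \<tau>"
  unfolding tiles_of_def by auto

lemma tile_norm: "(k, z, w) \<in> tiles_of \<tau> \<Longrightarrow> norm w = 1"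
  unfolding tiles_of_def by auto

lemma region_inj_on: "inj_on region (tiles_of \<tau>)"
proof (rule inj_onI)
  fix T T' assume *: "T \<in> tiles_of \<tau>" "T' \<in> tiles_of \<tau>" "region T = region T'"
  obtain k z w k' z' w' where "T = (k, z, w)" "T' = (k', z', w')" by (metis surj_pair)
  with * region_inj tile_norm show "T = T'" by blast
qed

lemma region_image: "region ` tiles_of \<tau> = \<tau>"
  using tile_of region_in by (auto simp: image_iff)

lemma covering: "\<exists>T\<in>tiles_of \<tau>. x \<in> creg T"
proof -
  obtain S where "S \<in> \<tau>" "pl x \<in> S" using pt unfolding penrose_tiling_def plane_tiling_def by blast
  then obtain T where "T \<in> tiles_of \<tau>" "pl x \<in> region T" by (metis tile_of)
  thus ?thesis unfolding region_def by auto
qed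

lemma creg_disjoint:
  assumes "T \<in> tiles_of \<tau>" "T' \<in> tiles_of \<tau>" "T \<noteq> T'"
  shows "interior (creg T) \<inter> interior (creg T') = {}"
proof -
  have "region T \<noteq> region T'" using region_inj_on assms unfolding inj_on_def by blast
  hence "interior (region T) \<inter> interior (region T') = {}"
    using pt region_in assms unfolding penrose_tiling_def plane_tiling_def by blast
  thus ?thesis unfolding region_def interior_pl by auto
qed

lemma packed_tiles: "packed 1 (tiles_of \<tau>)"
proof
  show "norm w = 1" if "(k, z, w) \<in> tiles_of \<tau>" for k z w by (rule tile_norm[OF that])
  fix T T' \<eta> \<theta>
  assume *: "T \<in> tiles_of \<tau>" "T' \<in> tiles_of \<tau>" "\<eta> \<in> turns" "\<theta> \<in> turns" "(T, \<eta>) \<noteq> (T', \<theta>)"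
  show "interior (cell T \<eta>) \<inter> interior (cell T' \<theta>) = {}"
  proof (cases "T = T'")
    case False
    have "interior (cell T \<eta>) \<subseteq> interior (creg T)" "interior (cell T' \<theta>) \<subseteq> interior (creg T')"
      using * unfolding creg_def by (intro interior_mono; blast)+
    thus ?thesis using creg_disjoint[OF *(1,2) False] by blast
  next
    case True
    obtain k z w where T: "T = (k, z, w)" by (cases T)
    have "\<theta> = G - \<eta>" using turn_cases[OF *(3,4)] *(5) True by blast
    thus ?thesis using cells_of_tile_disjoint[OF tile_norm *(3), of k z w] *(1) True unfolding T by blast
  qed
qed simp

interpretation packed 1 "tiles_of \<tau>" by (rule packed_tiles)

lemma finite_near: "finite {T \<in> tiles_of \<tau>. creg T \<inter> ball m 1 \<noteq> {}}"
proof (rule finite_subset)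
  show "finite (fst ` halves_in (tiles_of \<tau>) (Re m - 3) 6 (Im m - 3) 6)"
    by (intro finite_imageI count_halves(1)) auto
  show "{T \<in> tiles_of \<tau>. creg T \<inter> ball m 1 \<noteq> {}} \<subseteq> fst ` halves_in (tiles_of \<tau>) (Re m - 3) 6 (Im m - 3) 6"
  proof
    fix T assume "T \<in> {T \<in> tiles_of \<tau>. creg T \<inter> ball m 1 \<noteq> {}}"
    then obtain x where T: "T \<in> tiles_of \<tau>" and x: "x \<in> creg T" "norm (m - x) < 1" by (auto simp: dist_norm)
    obtain k z w where T': "T = (k, z, w)" by (cases T)
    have "norm (x - z) \<le> 2" using creg_near_tip x(1) tile_norm T unfolding T' by blast
    hence "norm (m - z) \<le> 3" using norm_triangle_ineq[of "m - x" "x - z"] x(2) by simp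
    hence "\<bar>Re (m - z)\<bar> \<le> 3" "\<bar>Im (m - z)\<bar> \<le> 3"
      using abs_Re_le_cmod[of "m - z"] abs_Im_le_cmod[of "m - z"] by linarith+
    hence "(T, cis (pi/5)) \<in> halves_in (tiles_of \<tau>) (Re m - 3) 6 (Im m - 3) 6"
      using T cis_turns(1) unfolding halves_in_def T' tip_of_def by auto
    thus "T \<in> fst ` halves_in (tiles_of \<tau>) (Re m - 3) 6 (Im m - 3) 6" by force
  qed
qed

text \<open>By local finiteness the other tiles near m have a closed union. If it missed m, some
  neighbourhood of m would lie in T.\<close>

lemma another_tile_at:
  assumes "\<And>e. e > 0 \<Longrightarrow> \<exists>x\<in>ball m e. x \<notin> creg T"
  shows "\<exists>T'\<in>tiles_of \<tau>. T' \<noteq> T \<and> m \<in> creg T'"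
proof (rule ccontr)
  assume no: "\<not> ?thesis"
  let ?F = "{T' \<in> tiles_of \<tau>. creg T' \<inter> ball m 1 \<noteq> {}} - {T}"
  have "closed (creg T')" if "T' \<in> tiles_of \<tau>" for T'
    using that closed_creg tile_norm by (metis surj_pair)
  hence "closed (\<Union>T'\<in>?F. creg T')" using finite_near by (intro closed_UN) auto
  moreover have "m \<notin> (\<Union>T'\<in>?F. creg T')" using no by auto
  ultimately have "open (- (\<Union>T'\<in>?F. creg T'))" "m \<in> - (\<Union>T'\<in>?F. creg T')" by (auto simp only: open_Compl Compl_iff)
  then obtain e where e: "e > 0" "ball m e \<subseteq> - (\<Union>T'\<in>?F. creg T')" by (rule openE)
  obtain x where x: "x \<in> ball m (min e 1)" "x \<notin> creg T" using assms[of "min e 1"] e(1) by auto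
  obtain T' where T': "T' \<in> tiles_of \<tau>" "x \<in> creg T'" using covering by blast
  have "x \<in> ball m 1" "x \<in> ball m e" using x(1) by auto
  moreover from this have "T' \<in> ?F" using T' x(2) by blast
  ultimately show False using e(2) T'(2) by blast
qed

lemma shared_edge:
  assumes T: "(k, z, w) \<in> tiles_of \<tau>" and T': "T' \<in> tiles_of \<tau>" "T' \<noteq> (k, z, w)"
    and m: "m \<in> creg (k, z, w)" "m \<in> creg T'"
    and corner: "m \<noteq> z" "m \<noteq> z + of_real (inner_pos k) * w" "\<And>\<eta>. \<eta> \<in> turns \<Longrightarrow> m \<noteq> z + G * w * \<eta>"
  obtains e where "e \<in> tile_edges (region (k, z, w))" "e \<in> tile_edges (region T')" "pl m \<in> e"
proof -
  have S: "region (k, z, w) \<in> \<tau>" "region T' \<in> \<tau>" "region (k, z, w) \<noteq> region T'"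
    using T T' region_in region_inj_on unfolding inj_on_def by blast+
  have "pl m \<in> region (k, z, w) \<inter> region T'" using m unfolding region_def by blast
  also have "\<dots> = (tile_vertices (region (k, z, w)) \<inter> tile_vertices (region T')) \<union>
      \<Union>(tile_edges (region (k, z, w)) \<inter> tile_edges (region T'))"
    using pt S unfolding penrose_tiling_def edge_to_edge_def by blast
  finally have "pl m \<in> tile_vertices (region (k, z, w)) \<or> (\<exists>e. e \<in> tile_edges (region (k, z, w)) \<and> e \<in> tile_edges (region T') \<and> pl m \<in> e)"
    by blast
  moreover have "pl m \<notin> tile_vertices (region (k, z, w))"
    using corner unfolding tile_vertices_def has_corner_region[OF tile_norm[OF T]] by auto
  ultimately show ?thesis using that by blast
qed

lemma corner_labels:
  assumes "(k, z, w) \<in> tiles_of \<tau>" "(k', z', w') \<in> tiles_of \<tau>"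
    "has_corner (region (k, z, w)) v l" "has_corner (region (k', z', w')) v l'"
  shows "l = l'"
  using pt region_in[OF assms(1)] region_in[OF assms(2)] assms(3,4)
  unfolding penrose_tiling_def labels_match_def by blast

text \<open>The point m is the midpoint of the long edge for \<open>a = 0\<close> and of the short
  edge for \<open>a = inner_pos k / 2\<close>. Points outside the tile accumulate at m, so another
  tile contains m; as m is no corner, the two tiles share an edge through it.\<close>

lemma mid_edge_tile:
  assumes T: "(k, z, w) \<in> tiles_of \<tau>" and t: "\<eta> \<in> turns"
    and a: "a = 0 \<or> a = inner_pos k / 2" and m: "m = z + w * (of_real a + of_real (golden / 2) * \<eta>)"
  obtains T' e where "T' \<in> tiles_of \<tau>" "T' \<noteq> (k, z, w)" "e \<in> tile_edges (region T')" "pl m \<in> e"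
    "e = closed_segment (pl z) (pl (z + G * w * \<eta>)) \<or>
     e = closed_segment (pl (z + G * w * \<eta>)) (pl (z + of_real (inner_pos k) * w))"
proof -
  have w: "norm w = 1" "w \<noteq> 0" using tile_norm[OF T] by auto
  have g: "golden > 0" using golden_pos by simp
  have sl: "slope k * (inner_pos k / 2) = golden / 2" using inner_pos(2)[of k] by simp
  hence "slope k * a \<le> golden / 2" using a g by (elim disjE) (simp, simp only: order_refl)
  moreover have "0 \<le> a" using a inner_pos(1)[of k] by auto
  ultimately have a': "0 \<le> a" "slope k * a + golden / 2 \<le> golden" by simp_all
  have mT: "m \<in> creg (k, z, w)" unfolding m mem_creg[OF w(2) t] using g a' by simp
  have "\<exists>x\<in>ball m e. x \<notin> creg (k, z, w)" if e: "e > 0" for e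
  proof -
    \<comment> \<open>A shift along the axis leaves the tile: backwards through the long edge,
      forwards through the short one.\<close>
    define d where "d = (if a = 0 then - e / 2 else e / 2)"
    have d: "\<bar>d\<bar> < e" using e by (simp add: d_def)
    have "z + w * (of_real (a + d) + of_real (golden / 2) * \<eta>) \<notin> creg (k, z, w)"
    proof (cases "a = 0")
      case True
      thus ?thesis unfolding mem_creg[OF w(2) t] using g e by (auto simp: d_def)
    next
      case False
      have "slope k * (a + e / 2) = golden / 2 + slope k * (e / 2)"
        using False a sl by (metis distrib_left)
      moreover have "0 < slope k * (e / 2)" using slope_pos[of k] e by simp
      ultimately show ?thesis unfolding mem_creg[OF w(2) t] using g False by (auto simp: d_def)
    qed
    moreover have "m - (z + w * (of_real (a + d) + of_real (golden / 2) * \<eta>)) = - (w * of_real d)"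
      unfolding m by (simp add: algebra_simps)
    hence "z + w * (of_real (a + d) + of_real (golden / 2) * \<eta>) \<in> ball m e"
      unfolding mem_ball dist_norm using d w(1) by (simp only: norm_mult norm_minus_cancel norm_of_real)
    ultimately show ?thesis by blast
  qed
  from another_tile_at[OF this] obtain T' where T': "T' \<in> tiles_of \<tau>" "T' \<noteq> (k, z, w)" "m \<in> creg T'" by blast
  note inj = coords_inj(2)[OF w(2) t, of z a "golden / 2"]
  have "m \<noteq> z" unfolding m using inj[of 0 0] g by (subst corner_coords(1)[where \<eta> = \<eta>]) auto
  moreover have "m \<noteq> z + of_real (inner_pos k) * w"
    unfolding m corner_coords(4)[where z = z and w = w and c = "inner_pos k" and \<eta> = \<eta>] using inj[of "inner_pos k" 0] g by auto
  moreover have "m \<noteq> z + G * w * \<theta>" if "\<theta> \<in> turns" for \<theta>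
  proof
    assume e: "m = z + G * w * \<theta>"
    from turn_cases[OF t that] show False
    proof
      assume "\<theta> = \<eta>"
      from inj[OF e[unfolded this m corner_coords(2)]] g show False by simp
    next
      assume "\<theta> = G - \<eta>"
      from inj[OF e[unfolded this m corner_coords(3)]] g show False by simp
    qed
  qed
  ultimately obtain e where e: "e \<in> tile_edges (region (k, z, w))" "e \<in> tile_edges (region T')" "pl m \<in> e"
    using shared_edge[OF T T'(1,2) mT T'(3)] by blast
  have "m \<notin> closed_segment z (z + G * w * (G - \<eta>))" "m \<notin> closed_segment (z + G * w * (G - \<eta>)) (z + of_real (inner_pos k) * w)"
    using not_on_other_edges[OF w(2) t, of "golden / 2" z a] g unfolding m by simp_all
  hence "e = closed_segment (pl z) (pl (z + G * w * \<eta>)) \<or>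
     e = closed_segment (pl (z + G * w * \<eta>)) (pl (z + of_real (inner_pos k) * w))"
    using e(1,3) unfolding tile_edges_region[OF w(1)] turns_eq[OF t]
    by (auto simp: closed_segment_pl simp del: closed_segment_eq)
  with that[OF T'(1,2) e(2,3)] show ?thesis by blast
qed

lemma long_edge_tile:
  assumes T: "(k, z, w) \<in> tiles_of \<tau>" and t: "\<eta> \<in> turns"
  obtains T' where "T' \<in> tiles_of \<tau>" "T' \<noteq> (k, z, w)"
    "closed_segment (pl z) (pl (z + G * w * \<eta>)) \<in> tile_edges (region T')"
proof (rule mid_edge_tile[OF T t _ refl, of 0])
  fix T' e
  let ?m = "z + w * (of_real 0 + of_real (golden / 2) * \<eta>)" and ?y = "z + of_real (inner_pos k) * w"
  assume T': "T' \<in> tiles_of \<tau>" "T' \<noteq> (k, z, w)" "e \<in> tile_edges (region T')" and m: "pl ?m \<in> e"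
  assume "e = closed_segment (pl z) (pl (z + G * w * \<eta>)) \<or> e = closed_segment (pl (z + G * w * \<eta>)) (pl ?y)"
  thus thesis
  proof
    assume "e = closed_segment (pl (z + G * w * \<eta>)) (pl ?y)"
    hence "?m \<in> closed_segment (z + G * w * \<eta>) ?y" using m by (simp only: closed_segment_pl)
    moreover have "w \<noteq> 0" using tile_norm[OF T] by auto
    ultimately show thesis
      using not_on_own_edge(2)[OF _ t, of w "inner_pos k" "golden / 2" z] golden_pos inner_pos(1)[of k] by auto
  qed (use that T' in blast)
qed simp

lemma short_edge_tile:
  assumes T: "(k, z, w) \<in> tiles_of \<tau>" and t: "\<eta> \<in> turns"
  obtains T' where "T' \<in> tiles_of \<tau>" "T' \<noteq> (k, z, w)"
    "closed_segment (pl (z + G * w * \<eta>)) (pl (z + of_real (inner_pos k) * w)) \<in> tile_edges (region T')"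
proof (rule mid_edge_tile[OF T t _ refl, of "inner_pos k / 2"])
  fix T' e
  let ?m = "z + w * (of_real (inner_pos k / 2) + of_real (golden / 2) * \<eta>)" and ?y = "z + of_real (inner_pos k) * w"
  assume T': "T' \<in> tiles_of \<tau>" "T' \<noteq> (k, z, w)" "e \<in> tile_edges (region T')" and m: "pl ?m \<in> e"
  assume "e = closed_segment (pl z) (pl (z + G * w * \<eta>)) \<or> e = closed_segment (pl (z + G * w * \<eta>)) (pl ?y)"
  thus thesis
  proof
    assume "e = closed_segment (pl z) (pl (z + G * w * \<eta>))"
    hence "?m \<in> closed_segment z (z + G * w * \<eta>)" using m by (simp only: closed_segment_pl)
    moreover have "w \<noteq> 0" using tile_norm[OF T] by auto
    ultimately show thesis
      using not_on_own_edge(1)[OF _ t, of w "inner_pos k / 2" z "golden / 2"] inner_pos(1)[of k]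
      by (metis half_gt_zero)
  qed (use that T' in blast)
qed simp

end

section \<open>Matching rules from edge lengths, labels and disjointness\<close>

lemma long_edge_length:
  assumes "norm w = 1" "\<eta> \<in> turns" shows "dist z (z + G * w * \<eta>) = golden"
  using assms turn_norm[OF assms(2)] golden_pos by (simp add: dist_norm norm_mult)

lemma short_edge_length:
  assumes "norm w = 1" "\<eta> \<in> turns" shows "dist (z + G * w * \<eta>) (z + of_real (inner_pos k) * w) = 1"
proof (cases k)
  case Kite
  have "G * w * \<eta> - G * w = w * (\<eta> * \<eta> * \<eta>)" by (simp add: algebra_simps turn_rules[OF assms(2)])
  thus ?thesis using assms(1) turn_norm[OF assms(2)] by (simp add: Kite dist_norm norm_mult)
next
  case Dart
  have "G * w * \<eta> - w = w * (\<eta> * \<eta>)" by (simp add: algebra_simps turn_rules[OF assms(2)])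
  thus ?thesis using assms(1) turn_norm[OF assms(2)] by (simp add: Dart dist_norm norm_mult)
qed

lemma dist_doubleton: "{a, b} = {c, d} \<Longrightarrow> dist a b = dist c d"
  by (auto simp: doubleton_eq_iff dist_commute)

lemma label_eq_iff [simp]:
  "tip_label k = tip_label k' \<longleftrightarrow> k = k'" "wing_label k = wing_label k' \<longleftrightarrow> k = k'"
  "tip_label k = wing_label k' \<longleftrightarrow> k \<noteq> k'" "wing_label k = tip_label k' \<longleftrightarrow> k \<noteq> k'"
  by (cases k; cases k'; simp)+

context
  fixes \<tau> :: "(real^2) set set"
  assumes pt: "penrose_tiling \<tau>"
begin

text \<open>Tip and inner vertex carry one label and the wings the other, with the roles exchanged
  between kites and darts. Equal labels at a common vertex therefore relate the kinds of the two
  tiles.\<close>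

lemma corners_agree:
  assumes "(k, z, w) \<in> tiles_of \<tau>" "(k', z', w') \<in> tiles_of \<tau>" "\<eta> \<in> turns" "\<theta> \<in> turns"
  shows "z = z' \<Longrightarrow> k = k'" "z = z' + G * w' * \<theta> \<Longrightarrow> k \<noteq> k'"
    "z + G * w * \<eta> = z' + G * w' * \<theta> \<Longrightarrow> k = k'" "z + G * w * \<eta> = z' + of_real (inner_pos k') * w' \<Longrightarrow> k \<noteq> k'"
proof -
  note h = has_corner_region[OF tile_norm[OF pt assms(1)]] and h' = has_corner_region[OF tile_norm[OF pt assms(2)]]
  note l = corner_labels[OF pt assms(1,2)]
  have c: "has_corner (region (k, z, w)) (pl z) (tip_label k)"
    "has_corner (region (k, z, w)) (pl (z + G * w * \<eta>)) (wing_label k)"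
    unfolding h using assms(3) by blast+
  have c': "has_corner (region (k', z', w')) (pl z') (tip_label k')"
    "has_corner (region (k', z', w')) (pl (z' + G * w' * \<theta>)) (wing_label k')"
    "has_corner (region (k', z', w')) (pl (z' + of_real (inner_pos k') * w')) (tip_label k')"
    unfolding h' using assms(4) by blast+
  show "z = z' \<Longrightarrow> k = k'" "z = z' + G * w' * \<theta> \<Longrightarrow> k \<noteq> k'"
    using l[OF c(1)] c'(1,2) by fastforce+
  show "z + G * w * \<eta> = z' + G * w' * \<theta> \<Longrightarrow> k = k'" "z + G * w * \<eta> = z' + of_real (inner_pos k') * w' \<Longrightarrow> k \<noteq> k'"
    using l[OF c(2)] c'(2,3) by (metis label_eq_iff)+
qed

text \<open>The lengths \<open>golden\<close> and 1 keep a long edge from being glued to a short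
  one. The labels then tie kind to orientation: a neighbour of the same kind shares the tip, one of
  the other kind has its tip at the wing.\<close>

lemma long_neighbour:
  assumes T: "(k, z, w) \<in> tiles_of \<tau>" and t: "\<eta> \<in> turns"
  obtains k' z' w' \<theta> where "(k', z', w') \<in> tiles_of \<tau>" "(k', z', w') \<noteq> (k, z, w)" "\<theta> \<in> turns"
    "k = k' \<and> z' = z \<and> w' * \<theta> = w * \<eta> \<or> k \<noteq> k' \<and> z' = z + G * w * \<eta> \<and> w' * \<theta> = - (w * \<eta>)"
proof -
  obtain T' where T': "T' \<in> tiles_of \<tau>" "T' \<noteq> (k, z, w)"
    "closed_segment (pl z) (pl (z + G * w * \<eta>)) \<in> tile_edges (region T')"
    by (rule long_edge_tile[OF pt T t])
  obtain k' z' w' where e: "T' = (k', z', w')" by (cases T')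
  note T' = T'[unfolded e]
  have w: "norm w = 1" "norm w' = 1" using tile_norm[OF pt] T T'(1) by blast+
  from T'(3)[unfolded tile_edges_region[OF w(2)]] obtain \<theta> where s: "\<theta> \<in> turns"
    and "{z, z + G * w * \<eta>} = {z', z' + G * w' * \<theta>} \<or> {z, z + G * w * \<eta>} = {z' + G * w' * \<theta>, z' + of_real (inner_pos k') * w'}"
    by (auto simp: doubleton_eq_iff)
  moreover have "{z, z + G * w * \<eta>} \<noteq> {z' + G * w' * \<theta>, z' + of_real (inner_pos k') * w'}"
    using long_edge_length[OF w(1) t, of z] short_edge_length[OF w(2) s, of z' k'] golden_pos
    by (metis dist_doubleton less_irrefl)
  ultimately consider "z = z'" "z + G * w * \<eta> = z' + G * w' * \<theta>" | "z = z' + G * w' * \<theta>" "z + G * w * \<eta> = z'"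
    by (auto simp: doubleton_eq_iff)
  thus ?thesis
  proof cases
    case 1
    hence "G * (w * \<eta>) = G * (w' * \<theta>)" by (simp only: mult.assoc add_left_cancel)
    hence "w' * \<theta> = w * \<eta>" using G_nonzero by simp
    with 1 corners_agree(1)[OF T T'(1) t s] that[OF T'(1,2) s] show ?thesis by simp
  next
    case 2
    have "G * (w' * \<theta>) = G * (- (w * \<eta>))" using 2 by algebra
    hence "w' * \<theta> = - (w * \<eta>)" using G_nonzero mult_left_cancel by blast
    with 2 corners_agree(2)[OF T T'(1) t s] that[OF T'(1,2) s] show ?thesis by simp
  qed
qed

lemma short_neighbour:
  assumes T: "(k, z, w) \<in> tiles_of \<tau>" and t: "\<eta> \<in> turns"
  obtains k' z' w' \<theta> where "(k', z', w') \<in> tiles_of \<tau>" "(k', z', w') \<noteq> (k, z, w)" "\<theta> \<in> turns"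
    "k = k' \<and> z' + G * w' * \<theta> = z + G * w * \<eta> \<and> z' + of_real (inner_pos k') * w' = z + of_real (inner_pos k) * w \<or>
     k \<noteq> k' \<and> z' + of_real (inner_pos k') * w' = z + G * w * \<eta> \<and> z' + G * w' * \<theta> = z + of_real (inner_pos k) * w"
proof -
  obtain T' where T': "T' \<in> tiles_of \<tau>" "T' \<noteq> (k, z, w)"
    "closed_segment (pl (z + G * w * \<eta>)) (pl (z + of_real (inner_pos k) * w)) \<in> tile_edges (region T')"
    by (rule short_edge_tile[OF pt T t])
  obtain k' z' w' where e: "T' = (k', z', w')" by (cases T')
  note T' = T'[unfolded e]
  have w: "norm w = 1" "norm w' = 1" using tile_norm[OF pt] T T'(1) by blast+
  let ?x = "z + G * w * \<eta>" and ?y = "z + of_real (inner_pos k) * w"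
  from T'(3)[unfolded tile_edges_region[OF w(2)]] obtain \<theta> where s: "\<theta> \<in> turns"
    and "{?x, ?y} = {z', z' + G * w' * \<theta>} \<or> {?x, ?y} = {z' + G * w' * \<theta>, z' + of_real (inner_pos k') * w'}"
    by (auto simp: doubleton_eq_iff)
  moreover have "{?x, ?y} \<noteq> {z', z' + G * w' * \<theta>}"
    using long_edge_length[OF w(2) s, of z'] short_edge_length[OF w(1) t, of z k] golden_pos
    by (metis dist_doubleton less_irrefl)
  ultimately consider "?x = z' + G * w' * \<theta>" "?y = z' + of_real (inner_pos k') * w'"
    | "?x = z' + of_real (inner_pos k') * w'" "?y = z' + G * w' * \<theta>"
    by (auto simp: doubleton_eq_iff)
  thus ?thesis
  proof cases
    case 1
    with corners_agree(3)[OF T T'(1) t s] that[OF T'(1,2) s] show ?thesis by simp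
  next
    case 2
    with corners_agree(4)[OF T T'(1) t s] that[OF T'(1,2) s] show ?thesis by simp
  qed
qed

interpretation packed 1 "tiles_of \<tau>" by (rule packed_tiles[OF pt])

lemma turn_inverse: "\<eta> \<in> turns \<Longrightarrow> \<eta> * (G - \<eta>) = 1"
  by (simp add: algebra_simps turn_rules)

text \<open>The two choices of \<open>\<theta>\<close> are the two sides of the common edge. For
  equal kinds one of them gives back the tile itself; for different kinds both remain here and are
  told apart later by disjointness.\<close>

lemma long_neighbour_cases:
  assumes T: "(k, z, w) \<in> tiles_of \<tau>" and t: "\<eta> \<in> turns"
  obtains "(k, z, w * \<eta> * \<eta>) \<in> tiles_of \<tau>"
  | k' where "k' \<noteq> k" "(k', z + G * w * \<eta>, - w) \<in> tiles_of \<tau> \<or> (k', z + G * w * \<eta>, - (w * \<eta> * \<eta>)) \<in> tiles_of \<tau>"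
proof (rule long_neighbour[OF T t])
  fix k' z' w' \<theta>
  assume T': "(k', z', w') \<in> tiles_of \<tau>" "(k', z', w') \<noteq> (k, z, w)" and s: "\<theta> \<in> turns"
    and c: "k = k' \<and> z' = z \<and> w' * \<theta> = w * \<eta> \<or> k \<noteq> k' \<and> z' = z + G * w * \<eta> \<and> w' * \<theta> = - (w * \<eta>)"
  note i = turn_inverse[OF t]
  from c show thesis
  proof (elim disjE conjE)
    assume a: "k = k'" "z' = z" "w' * \<theta> = w * \<eta>"
    have "\<theta> \<noteq> \<eta>" using a T' turn_nonzero[OF t] by auto
    hence "w' * (G - \<eta>) = w * \<eta>" using turn_cases[OF t s] a(3) by simp
    hence "w' = w * \<eta> * \<eta>" using i by algebra
    with a T' that(1) show thesis by simp
  next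
    assume a: "k \<noteq> k'" "z' = z + G * w * \<eta>" "w' * \<theta> = - (w * \<eta>)"
    from turn_cases[OF t s] have "w' = - w \<or> w' = - (w * \<eta> * \<eta>)"
    proof
      assume "\<theta> = \<eta>"
      with a(3) have "w' * \<eta> = (- w) * \<eta>" by simp
      thus ?thesis using turn_nonzero[OF t] mult_right_cancel by blast
    next
      assume "\<theta> = G - \<eta>"
      with a(3) have "w' * (G - \<eta>) = - (w * \<eta>)" by simp
      hence "w' = - (w * \<eta> * \<eta>)" using i by algebra
      thus ?thesis ..
    qed
    with a(1,2) T'(1) that(2)[of k'] show thesis by auto
  qed
qed

lemma tiles_kite_long:
  assumes T: "(Kite, z, w) \<in> tiles_of \<tau>" and t: "\<eta> \<in> turns"
  shows "(Kite, z, w * \<eta> * \<eta>) \<in> tiles_of \<tau> \<or> (Dart, z + G * w * \<eta>, - w) \<in> tiles_of \<tau>"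
proof (rule long_neighbour_cases[OF T t])
  fix k' assume "k' \<noteq> Kite" "(k', z + G * w * \<eta>, - w) \<in> tiles_of \<tau> \<or> (k', z + G * w * \<eta>, - (w * \<eta> * \<eta>)) \<in> tiles_of \<tau>"
  thus ?thesis using no_overlap_same_side_long[OF t T] by (cases k') auto
qed simp

lemma tiles_dart_long:
  assumes T: "(Dart, z, w) \<in> tiles_of \<tau>" and t: "\<eta> \<in> turns"
  shows "(Dart, z, w * \<eta> * \<eta>) \<in> tiles_of \<tau> \<or> (Kite, z + G * w * \<eta>, - w) \<in> tiles_of \<tau>"
proof (rule long_neighbour_cases[OF T t])
  have False if "(Kite, z + G * w * \<eta>, - (w * \<eta> * \<eta>)) \<in> tiles_of \<tau>"
    by (rule no_overlap_same_side_long[OF turn_other(1)[OF t] that mem_cong[OF T]]; simp add: algebra_simps turn_rules[OF t])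
  moreover fix k' assume "k' \<noteq> Dart" "(k', z + G * w * \<eta>, - w) \<in> tiles_of \<tau> \<or> (k', z + G * w * \<eta>, - (w * \<eta> * \<eta>)) \<in> tiles_of \<tau>"
  ultimately show ?thesis by (cases k') auto
qed simp

lemma tiles_kite_short:
  assumes T: "(Kite, z, w) \<in> tiles_of \<tau>" and t: "\<eta> \<in> turns"
  shows "(Kite, z + G * w + G * w * \<eta>, - w * \<eta>) \<in> tiles_of \<tau> \<or> (Dart, z + G * G * w * \<eta>, - w * \<eta>) \<in> tiles_of \<tau>"
proof (rule short_neighbour[OF T t])
  fix k' z' w' \<theta>
  assume T': "(k', z', w') \<in> tiles_of \<tau>" "(k', z', w') \<noteq> (Kite, z, w)" and s: "\<theta> \<in> turns"
    and c: "Kite = k' \<and> z' + G * w' * \<theta> = z + G * w * \<eta> \<and> z' + of_real (inner_pos k') * w' = z + of_real (inner_pos Kite) * w \<or>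
     Kite \<noteq> k' \<and> z' + of_real (inner_pos k') * w' = z + G * w * \<eta> \<and> z' + G * w' * \<theta> = z + of_real (inner_pos Kite) * w"
  note R = turn_sq[OF t] G_sq
  show ?thesis
  proof (cases k')
    case Kite
    with c have e: "z' + G * w' * \<theta> = z + G * w * \<eta>" "z' + G * w' = z + G * w" by auto
    from turn_cases[OF t s] show ?thesis
    proof
      assume "\<theta> = \<eta>"
      have "w' = w" using e R unfolding \<open>\<theta> = \<eta>\<close> by algebra
      with e T' Kite show ?thesis by simp
    next
      assume "\<theta> = G - \<eta>"
      have w': "w' = - w * \<eta>" using e R unfolding \<open>\<theta> = G - \<eta>\<close> by algebra
      hence "z' = z + G * w + G * w * \<eta>" using e(2) by (simp add: algebra_simps)
      with w' T' Kite show ?thesis by simp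
    qed
  next
    case Dart
    with c have e: "z' + w' = z + G * w * \<eta>" "z' + G * w' * \<theta> = z + G * w" by auto
    from turn_cases[OF t s] show ?thesis
    proof
      assume "\<theta> = \<eta>"
      have w': "w' = - w * \<eta>" using e R unfolding \<open>\<theta> = \<eta>\<close> by algebra
      hence "z' = z + G * G * w * \<eta>" using e(1) R by algebra
      with w' T' Dart show ?thesis by simp
    next
      assume "\<theta> = G - \<eta>"
      have w': "w' = w" using e R unfolding \<open>\<theta> = G - \<eta>\<close> by algebra
      hence "z' = z + G * w * \<eta> - w" using e(1) by (simp add: algebra_simps)
      with w' T' Dart have "(Dart, z + G * w * \<eta> - w, w) \<in> tiles_of \<tau>" by simp
      from no_overlap_same_side_short[OF t T this] show ?thesis ..
    qed
  qed
qed

lemma tiles_dart_short: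
  assumes T: "(Dart, z, w) \<in> tiles_of \<tau>" and t: "\<eta> \<in> turns"
  shows "(Kite, z + G * G * w, - w * (G - \<eta>)) \<in> tiles_of \<tau>"
proof (rule short_neighbour[OF T t])
  fix k' z' w' \<theta>
  assume T': "(k', z', w') \<in> tiles_of \<tau>" "(k', z', w') \<noteq> (Dart, z, w)" and s: "\<theta> \<in> turns"
    and c: "Dart = k' \<and> z' + G * w' * \<theta> = z + G * w * \<eta> \<and> z' + of_real (inner_pos k') * w' = z + of_real (inner_pos Dart) * w \<or>
     Dart \<noteq> k' \<and> z' + of_real (inner_pos k') * w' = z + G * w * \<eta> \<and> z' + G * w' * \<theta> = z + of_real (inner_pos Dart) * w"
  note R = turn_sq[OF t] G_sq
  show ?thesis
  proof (cases k')
    case Dart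
    with c have e: "z' + G * w' * \<theta> = z + G * w * \<eta>" "z' + w' = z + w" by auto
    from turn_cases[OF t s] show ?thesis
    proof
      assume "\<theta> = \<eta>"
      have "w' = w" using e R unfolding \<open>\<theta> = \<eta>\<close> by algebra
      with e T' Dart show ?thesis by simp
    next
      assume "\<theta> = G - \<eta>"
      have w': "w' = - w * (G - \<eta>)" using e R unfolding \<open>\<theta> = G - \<eta>\<close> by algebra
      hence "z' = z + w + w * (G - \<eta>)" using e(2) by algebra
      with w' T' Dart have "(Dart, z + w + w * (G - \<eta>), - w * (G - \<eta>)) \<in> tiles_of \<tau>" by simp
      from no_overlap_dart_dart[OF t T this] show ?thesis ..
    qed
  next
    case Kite
    with c have e: "z' + G * w' = z + G * w * \<eta>" "z' + G * w' * \<theta> = z + w" by auto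
    from turn_cases[OF t s] show ?thesis
    proof
      assume "\<theta> = \<eta>"
      have w': "w' = - w * (G - \<eta>)" using e R unfolding \<open>\<theta> = \<eta>\<close> by algebra
      hence "z' = z + G * G * w" using e(1) R by algebra
      with w' T' Kite show ?thesis by simp
    next
      assume "\<theta> = G - \<eta>"
      have w': "w' = w" using e R unfolding \<open>\<theta> = G - \<eta>\<close> by algebra
      hence "z' = z + G * w * \<eta> - G * w" using e(1) by (simp add: algebra_simps)
      with w' T' Kite have k: "(Kite, z + G * w * \<eta> - G * w, w) \<in> tiles_of \<tau>" by simp
      have "(Dart, (z + G * w * \<eta> - G * w) + G * w * (G - \<eta>) - w, w) \<in> tiles_of \<tau>"
        by (rule mem_cong[OF T]; simp add: algebra_simps turn_rules[OF t])
      from no_overlap_same_side_short[OF turn_other(1)[OF t] k this] show ?thesis ..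
    qed
  qed
qed

lemma matched_tiles: "matched 1 (tiles_of \<tau>)"
  by unfold_locales (fact tiles_kite_long, fact tiles_dart_long, fact tiles_kite_short, fact tiles_dart_short)

end

section \<open>Areas\<close>

lemma convex_cell: "convex (cell (k, z, w) \<eta>)"
proof (rule convexI)
  fix x y :: complex and u v :: real
  assume x: "x \<in> cell (k, z, w) \<eta>" and y: "y \<in> cell (k, z, w) \<eta>" and uv: "0 \<le> u" "0 \<le> v" "u + v = 1"
  obtain a b where ab: "x = z + w * (of_real a + of_real b * \<eta>)" "0 \<le> a" "0 \<le> b" "slope k * a + b \<le> golden" using x by auto
  obtain c d where cd: "y = z + w * (of_real c + of_real d * \<eta>)" "0 \<le> c" "0 \<le> d" "slope k * c + d \<le> golden" using y by auto
  have v: "v = 1 - u" using uv by simp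
  show "u *\<^sub>R x + v *\<^sub>R y \<in> cell (k, z, w) \<eta>"
  proof (rule cell_memI)
    show "0 \<le> u * a + v * c" "0 \<le> u * b + v * d" using uv ab cd by auto
    have "u * (slope k * a + b) + v * (slope k * c + d) \<le> u * golden + v * golden"
      using uv ab cd by (intro add_mono mult_left_mono) auto
    thus "slope k * (u * a + v * c) + (u * b + v * d) \<le> golden"
      unfolding distrib_right[symmetric] uv(3) by (simp add: algebra_simps)
    show "u *\<^sub>R x + v *\<^sub>R y = z + w * (of_real (u * a + v * c) + of_real (u * b + v * d) * \<eta>)"
      unfolding ab(1) cd(1) v scaleR_conv_of_real by (simp add: algebra_simps)
  qed
qed

text \<open>The intersection of the cells is convex, and a convex set without interior is
  negligible. Hence areas are additive although closed tiles share boundaries.\<close>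

lemma negligible_Int_cells:
  assumes "interior (cell (k, z, w) \<eta>) \<inter> interior (cell (k', z', w') \<theta>) = {}"
  shows "negligible (pl ` cell (k, z, w) \<eta> \<inter> pl ` cell (k', z', w') \<theta>)"
proof -
  have "convex (pl ` cell (k, z, w) \<eta> \<inter> pl ` cell (k', z', w') \<theta>)"
    by (intro convex_Int convex_linear_image linear_pl convex_cell)
  moreover have "interior (pl ` cell (k, z, w) \<eta> \<inter> pl ` cell (k', z', w') \<theta>) = {}"
    unfolding interior_Int interior_pl using assms by auto
  ultimately show ?thesis using negligible_convex_interior by blast
qed

text \<open>This is the area of a dart of scale 1; the area of the kite is \<open>golden\<close>
  times as large.\<close>

definition unit_area :: real where
  "unit_area = golden * \<bar>Im (cis (pi/5))\<bar>"

lemma unit_area_pos: "unit_area > 0"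
  using turn_Im_abs[OF cis_turns(1)] golden_pos unfolding unit_area_def by simp

lemma lmeasurable_triangle_cell:
  assumes "\<eta> \<in> turns" shows "pl ` cell (k, 0, 1) \<eta> \<in> lmeasurable"
  unfolding triangle_cell[OF assms, symmetric] by (intro lmeasurable_compact finite_imp_compact_convex_hull) simp

lemma measure_prototile:
  "prototile k \<in> lmeasurable" "measure lebesgue (prototile k) = inner_pos k * unit_area"
proof -
  have eq: "prototile k = (\<Union>\<eta>\<in>turns. pl ` cell (k, 0, 1) \<eta>)"
    unfolding prototile_region region_def creg_def image_UN ..
  show "prototile k \<in> lmeasurable"
    unfolding eq by (intro fmeasurable.finite_UN finite_turns lmeasurable_triangle_cell)
  have m: "measure lebesgue (pl ` cell (k, 0, 1) \<eta>) = inner_pos k * unit_area / 2" if t: "\<eta> \<in> turns" for \<eta>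
  proof -
    have "measure lborel (pl ` cell (k, 0, 1) \<eta>) = \<bar>inner_pos k * (golden * Im \<eta>)\<bar> / 2"
      unfolding triangle_cell[OF t, symmetric] content_triangle
      by (simp add: abs_minus_commute)
    also have "\<bar>inner_pos k * (golden * Im \<eta>)\<bar> = inner_pos k * unit_area"
      using inner_pos(1)[of k] golden_pos t by (auto simp: unit_area_def abs_mult turns_def)
    finally have "measure lborel (pl ` cell (k, 0, 1) \<eta>) = inner_pos k * unit_area / 2" .
    moreover have "pl ` cell (k, 0, 1) \<eta> \<in> sets lborel"
      unfolding triangle_cell[OF t, symmetric] sets_lborel by (intro borel_compact finite_imp_compact_convex_hull) simp
    ultimately show ?thesis by (simp only: measure_completion)
  qed
  have "measure lebesgue (prototile k) = (\<Sum>\<eta>\<in>turns. measure lebesgue (pl ` cell (k, 0, 1) \<eta>))"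
    unfolding eq
  proof (rule measure_negligible_finite_Union_image[OF finite_turns(1) lmeasurable_triangle_cell])
    show "pairwise (\<lambda>x y. negligible (pl ` cell (k, 0, 1) x \<inter> pl ` cell (k, 0, 1) y)) turns"
    proof (rule pairwiseI)
      fix x y assume "x \<in> turns" "y \<in> turns" "x \<noteq> y"
      hence "y = G - x" using turn_cases by blast
      thus "negligible (pl ` cell (k, 0, 1) x \<inter> pl ` cell (k, 0, 1) y)"
        using negligible_Int_cells cells_of_tile_disjoint[of 1 x k 0] \<open>x \<in> turns\<close> by (metis norm_one)
    qed
  qed
  also have "\<dots> = (\<Sum>\<eta>\<in>turns. inner_pos k * unit_area / 2)" by (intro sum.cong refl m)
  also have "\<dots> = inner_pos k * unit_area" using finite_turns by simp
  finally show "measure lebesgue (prototile k) = inner_pos k * unit_area" .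
qed

lemma measure_region:
  assumes w: "norm w = 1"
  shows "region (k, z, w) \<in> lmeasurable" "measure lebesgue (region (k, z, w)) = inner_pos k * unit_area"
proof -
  define g where "g x = pl (w * cx x)" for x
  have d: "dist (g x) (g y) = dist x y" for x y
  proof -
    have "dist (g x) (g y) = dist (cx x) (cx y)"
      using w by (simp add: g_def dist_norm[of "w * _"] dist_norm[of "cx _"] norm_mult flip: right_diff_distrib)
    also have "\<dots> = dist x y" using dist_pl[of "cx x" "cx y"] by simp
    finally show ?thesis .
  qed
  have "g 0 = 0" by (simp add: g_def vec_eq_iff forall_2 cx_def)
  with d have o: "orthogonal_transformation g" by (simp add: orthogonal_transformation_isometry)
  have "region (k, z, w) = (+) (pl z) ` g ` prototile k"
    unfolding prototile_region region_def creg_affine[symmetric, of k z w] image_image g_def pl_cx pl_add ..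
  with measure_orthogonal_image[OF o measure_prototile(1)] measurable_orthogonal_image[OF o measure_prototile(1)] measure_prototile(2)
  show "region (k, z, w) \<in> lmeasurable" "measure lebesgue (region (k, z, w)) = inner_pos k * unit_area"
    by (simp_all add: measurable_translation measure_translation)
qed

definition square :: "real \<Rightarrow> int \<times> int \<Rightarrow> (real^2) set" where
  "square M b = {v. block M (cx v) = b}"

lemma square_alt:
  assumes "M > 0"
  shows "square M (j, k) = {v. of_int j * M \<le> v $ 1} \<inter> {v. v $ 1 < of_int j * M + M} \<inter>
    ({v. of_int k * M \<le> v $ 2} \<inter> {v. v $ 2 < of_int k * M + M})"
  using assms unfolding square_def block_def by (auto simp: floor_eq_iff field_simps)

lemma measure_square:
  assumes M: "M > 0"
  shows "square M b \<in> lmeasurable" "measure lebesgue (square M b) = M * M"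
proof -
  obtain j k where b: "b = (j, k)" by (cases b)
  define l :: "real^2" where "l = vector [of_int j * M, of_int k * M]"
  define u :: "real^2" where "u = vector [of_int j * M + M, of_int k * M + M]"
  have sub: "box l u \<subseteq> square M b" "square M b \<subseteq> cbox l u"
    unfolding b square_alt[OF M] by (auto simp: mem_box_cart forall_2 l_def u_def)
  have "square M b \<in> sets borel"
    unfolding b square_alt[OF M]
    by (intro sets.Int borel_closed borel_open closed_Collect_le open_Collect_less continuous_intros)
  hence sets: "square M b \<in> sets lebesgue" by (simp add: sets_completionI_sets)
  show meas: "square M b \<in> lmeasurable"
    using bounded_subset[OF bounded_cbox sub(2)] sets by (rule bounded_set_imp_lmeasurable)
  have "cbox l u \<noteq> {}" using M by (auto simp: interval_ne_empty_cart forall_2 l_def u_def)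
  hence c: "measure lebesgue (cbox l u) = M * M"
    by (simp add: content_cbox_cart UNIV_2 l_def u_def)
  have "measure lebesgue (square M b) \<le> measure lebesgue (cbox l u)"
    using sub(2) sets by (intro measure_mono_fmeasurable) auto
  moreover have "measure lebesgue (box l u) \<le> measure lebesgue (square M b)"
    using sub(1) meas by (intro measure_mono_fmeasurable) auto
  moreover have "measure lebesgue (box l u) = measure lebesgue (cbox l u)"
    by (simp add: measure_lborel_box_eq measure_lborel_cbox_eq measure_completion)
  ultimately show "measure lebesgue (square M b) = M * M" using c by simp
qed

section \<open>Counting tiles in blocks\<close>

lemma floor_divide_near:
  fixes x y M :: real
  assumes "M > 0" "\<bar>x - y\<bar> \<le> M" shows "\<bar>\<lfloor>x / M\<rfloor> - \<lfloor>y / M\<rfloor>\<bar> \<le> 1"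
proof -
  have "\<bar>x / M - y / M\<bar> \<le> 1" using assms by (simp add: flip: diff_divide_distrib)
  thus ?thesis by linarith
qed

context
  fixes \<tau> :: "(real^2) set set"
  assumes pt: "penrose_tiling \<tau>"
begin

interpretation packed 1 "tiles_of \<tau>" by (rule packed_tiles[OF pt])

text \<open>These pairs index the pieces into which the grid cuts the tiles. The area of each piece
  is transported from the tip of its tile to the block of the piece.\<close>

definition hits :: "real \<Rightarrow> (tile \<times> int \<times> int) set" where
  "hits M = {(T, b). T \<in> tiles_of \<tau> \<and> (\<exists>x\<in>creg T. block M x = b)}"

lemma tile_near_tip: "T \<in> tiles_of \<tau> \<Longrightarrow> x \<in> creg T \<Longrightarrow> norm (x - tip_of T) \<le> 2"
proof -
  assume *: "T \<in> tiles_of \<tau>" "x \<in> creg T"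
  obtain k z w where T: "T = (k, z, w)" by (cases T)
  from creg_near_tip[of w x k z] tile_norm[OF pt, of k z w] * show ?thesis by (simp add: T tip_of_def)
qed

lemma hits_near:
  assumes "M \<ge> 2" "(T, b) \<in> hits M"
  shows "\<bar>fst b - fst (block M (tip_of T))\<bar> \<le> 1" "\<bar>snd b - snd (block M (tip_of T))\<bar> \<le> 1"
proof -
  obtain x where x: "T \<in> tiles_of \<tau>" "x \<in> creg T" "block M x = b" using assms(2) unfolding hits_def by auto
  have n: "norm (x - tip_of T) \<le> M" using tile_near_tip[OF x(1,2)] assms(1) by simp
  have "\<bar>Re x - Re (tip_of T)\<bar> \<le> M" "\<bar>Im x - Im (tip_of T)\<bar> \<le> M"
    using n abs_Re_le_cmod[of "x - tip_of T"] abs_Im_le_cmod[of "x - tip_of T"] by auto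
  thus "\<bar>fst b - fst (block M (tip_of T))\<bar> \<le> 1" "\<bar>snd b - snd (block M (tip_of T))\<bar> \<le> 1"
    using assms(1) unfolding x(3)[symmetric] block_def by (auto intro!: floor_divide_near)
qed

lemma finite_block_tiles:
  assumes "M > 0" shows "finite {T \<in> tiles_of \<tau>. block M (tip_of T) = b}"
proof -
  obtain j k where b: "b = (j, k)" by (cases b)
  have "finite (fst ` halves_in (tiles_of \<tau>) (of_int j * M) M (of_int k * M) M)"
    using assms by (intro finite_imageI count_halves(1)) auto
  moreover have "{T \<in> tiles_of \<tau>. block M (tip_of T) = b} \<subseteq> fst ` halves_in (tiles_of \<tau>) (of_int j * M) M (of_int k * M) M"
  proof
    fix T assume "T \<in> {T \<in> tiles_of \<tau>. block M (tip_of T) = b}"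
    hence "(T, cis (pi/5)) \<in> {i \<in> tiles_of \<tau> \<times> turns. block M (tip_of (fst i)) = (j, k)}"
      using cis_turns(1) unfolding b by simp
    with block_halves[OF assms] show "T \<in> fst ` halves_in (tiles_of \<tau>) (of_int j * M) M (of_int k * M) M" by force
  qed
  ultimately show ?thesis by (rule finite_subset[rotated])
qed

text \<open>Points of a tile are within 2 \<le> M of its tip, so the tile meets at most the nine
  blocks around that of its tip. \<open>f\<close> records the tile and the offset of the
  block.\<close>

lemma hits_count:
  fixes x a y b :: real
  assumes M: "M \<ge> 2" and ab: "0 \<le> a" "0 \<le> b"
  defines "R \<equiv> {i \<in> hits M. x \<le> Re (tip_of (fst i)) \<and> Re (tip_of (fst i)) \<le> x + a \<and>
     y \<le> Im (tip_of (fst i)) \<and> Im (tip_of (fst i)) \<le> y + b}"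
  shows "finite R \<and> real (card R) \<le> 9 * (40 * a + 41) * (40 * b + 41)"
proof -
  let ?H = "halves_in (tiles_of \<tau>) x a y b"
  have H: "finite ?H" "real (card ?H) \<le> (40 * a + 41) * (40 * b + 41)" using count_halves[OF ab, of x y] by simp_all
  let ?B = "fst ` ?H \<times> {-1..1::int} \<times> {-1..1::int}"
  define f where "f i = (fst i, fst (snd i) - fst (block M (tip_of (fst i))), snd (snd i) - snd (block M (tip_of (fst i))))"
    for i :: "tile \<times> int \<times> int"
  have inj: "inj_on f R" by (rule inj_onI) (auto simp: f_def prod_eq_iff)
  have sub: "f ` R \<subseteq> ?B"
  proof
    fix u assume "u \<in> f ` R"
    then obtain i where i: "i \<in> R" "u = f i" by blast
    have h: "(fst i, snd i) \<in> hits M" using i(1) unfolding R_def by simp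
    hence "fst i \<in> tiles_of \<tau>" unfolding hits_def by auto
    hence "(fst i, cis (pi/5)) \<in> ?H" using i(1) cis_turns(1) unfolding R_def halves_in_def by simp
    hence "fst i \<in> fst ` ?H" by force
    with hits_near[OF M h] show "u \<in> ?B" unfolding i(2) f_def by (auto simp: abs_le_iff)
  qed
  have fin: "finite ?B" using H(1) by simp
  have "card R \<le> card ?B" using card_inj_on_le[OF inj sub fin] .
  also have "card ?B = card (fst ` ?H) * 9" by (simp add: card_cartesian_product)
  also have "\<dots> \<le> card ?H * 9" using card_image_le[OF H(1)] by simp
  finally have "real (card R) \<le> real (card ?H) * 9" by (metis of_nat_le_iff of_nat_mult of_nat_numeral)
  also have "\<dots> \<le> ((40 * a + 41) * (40 * b + 41)) * 9" using H(2) by (intro mult_right_mono) auto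
  finally have "real (card R) \<le> 9 * (40 * a + 41) * (40 * b + 41)" by (simp only: mult_ac)
  moreover have "finite R" using inj sub fin by (metis finite_imageD finite_subset)
  ultimately show ?thesis by blast
qed

lemma region_measure:
  assumes "T \<in> tiles_of \<tau>"
  shows "region T \<in> lmeasurable" "measure lebesgue (region T) = inner_pos (fst T) * unit_area"
  using measure_region tile_norm[OF pt] assms by (cases T; simp)+

lemma negligible_overlap:
  assumes "T \<in> tiles_of \<tau>" "T' \<in> tiles_of \<tau>" "T \<noteq> T'" shows "negligible (region T \<inter> region T')"
proof -
  have n: "negligible (pl ` cell T \<eta> \<inter> pl ` cell T' \<theta>)" if "\<eta> \<in> turns" "\<theta> \<in> turns" for \<eta> \<theta>
    using negligible_Int_cells disjoint[OF assms(1,2) that] assms(3) by (cases T; cases T') blast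
  have "negligible (\<Union>\<eta>\<in>turns. \<Union>\<theta>\<in>turns. pl ` cell T \<eta> \<inter> pl ` cell T' \<theta>)"
  proof (rule negligible_Union)
    fix S assume "S \<in> (\<lambda>\<eta>. \<Union>\<theta>\<in>turns. pl ` cell T \<eta> \<inter> pl ` cell T' \<theta>) ` turns"
    then obtain \<eta> where \<eta>: "\<eta> \<in> turns" and S: "S = (\<Union>\<theta>\<in>turns. pl ` cell T \<eta> \<inter> pl ` cell T' \<theta>)" by blast
    show "negligible S" unfolding S
      by (rule negligible_Union) (use n[OF \<eta>] finite_turns in \<open>auto simp del: cell.simps\<close>)
  qed (use finite_turns in simp)
  moreover have "region T \<inter> region T' = (\<Union>\<eta>\<in>turns. \<Union>\<theta>\<in>turns. pl ` cell T \<eta> \<inter> pl ` cell T' \<theta>)"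
    unfolding region_def creg_def by (simp del: cell.simps) blast
  ultimately show ?thesis by simp
qed

lemma measure_region_split:
  assumes M: "M \<ge> 2" and T: "T \<in> tiles_of \<tau>"
  shows "finite {b. (T, b) \<in> hits M}"
    "(\<Sum>b\<in>{b. (T, b) \<in> hits M}. measure lebesgue (region T \<inter> square M b)) = measure lebesgue (region T)"
proof -
  let ?B = "{b. (T, b) \<in> hits M}" and ?c = "block M (tip_of T)"
  have "?B \<subseteq> {fst ?c - 1..fst ?c + 1} \<times> {snd ?c - 1..snd ?c + 1}"
  proof
    fix b assume "b \<in> ?B"
    with hits_near[OF M, of T b] show "b \<in> {fst ?c - 1..fst ?c + 1} \<times> {snd ?c - 1..snd ?c + 1}"
      by (cases b) (auto simp: abs_le_iff)
  qed
  thus fin: "finite ?B" by (rule finite_subset) simp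
  have "measure lebesgue (\<Union>b\<in>?B. region T \<inter> square M b) = (\<Sum>b\<in>?B. measure lebesgue (region T \<inter> square M b))"
  proof (rule measure_negligible_finite_Union_image[OF fin])
    show "region T \<inter> square M b \<in> lmeasurable" for b
      using region_measure(1)[OF T] measure_square(1)[of M b] M by (intro fmeasurable.Int) auto
    show "pairwise (\<lambda>b b'. negligible ((region T \<inter> square M b) \<inter> (region T \<inter> square M b'))) ?B"
    proof (rule pairwiseI)
      fix b b' :: "int \<times> int" assume "b \<noteq> b'"
      hence "(region T \<inter> square M b) \<inter> (region T \<inter> square M b') = {}" unfolding square_def by auto
      thus "negligible ((region T \<inter> square M b) \<inter> (region T \<inter> square M b'))" by simp
    qed
  qed
  moreover have "(\<Union>b\<in>?B. region T \<inter> square M b) = region T"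
    using T unfolding hits_def region_def square_def by auto
  ultimately show "(\<Sum>b\<in>?B. measure lebesgue (region T \<inter> square M b)) = measure lebesgue (region T)" by simp
qed

lemma measure_square_split:
  assumes M: "M \<ge> 2"
  shows "(\<Sum>T\<in>{T. (T, b) \<in> hits M}. measure lebesgue (region T \<inter> square M b)) = M * M"
proof -
  let ?F = "{T. (T, b) \<in> hits M}"
  obtain j k where b: "b = (j, k)" by (cases b)
  let ?R = "{i \<in> hits M. of_int (j - 1) * M \<le> Re (tip_of (fst i)) \<and> Re (tip_of (fst i)) \<le> of_int (j - 1) * M + 3 * M \<and>
     of_int (k - 1) * M \<le> Im (tip_of (fst i)) \<and> Im (tip_of (fst i)) \<le> of_int (k - 1) * M + 3 * M}"
  have "finite (fst ` ?R)"
    using M hits_count[OF M, of "3 * M" "3 * M"] by (intro finite_imageI) auto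
  moreover have "?F \<subseteq> fst ` ?R"
  proof
    fix T assume "T \<in> ?F"
    then obtain x where h: "(T, b) \<in> hits M" and x: "T \<in> tiles_of \<tau>" "x \<in> creg T" "block M x = (j, k)"
      unfolding hits_def b by auto
    have "\<bar>Re x - Re (tip_of T)\<bar> \<le> M" "\<bar>Im x - Im (tip_of T)\<bar> \<le> M"
      using tile_near_tip[OF x(1,2)] M abs_Re_le_cmod[of "x - tip_of T"] abs_Im_le_cmod[of "x - tip_of T"] by auto
    hence "(T, b) \<in> ?R"
      using h x(3) floor_divide_le[of M "Re x" j] floor_divide_le[of M "Im x" k] M
      unfolding block_def by (auto simp: left_diff_distrib abs_le_iff)
    thus "T \<in> fst ` ?R" by force
  qed
  ultimately have fin: "finite ?F" by (rule finite_subset[rotated])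
  have FT: "T \<in> tiles_of \<tau>" if "T \<in> ?F" for T using that unfolding hits_def by auto
  have "measure lebesgue (\<Union>T\<in>?F. region T \<inter> square M b) = (\<Sum>T\<in>?F. measure lebesgue (region T \<inter> square M b))"
  proof (rule measure_negligible_finite_Union_image[OF fin])
    show "region T \<inter> square M b \<in> lmeasurable" if "T \<in> ?F" for T
      using region_measure(1)[OF FT[OF that]] measure_square(1)[of M b] M by (intro fmeasurable.Int) auto
    show "pairwise (\<lambda>T T'. negligible ((region T \<inter> square M b) \<inter> (region T' \<inter> square M b))) ?F"
    proof (rule pairwiseI)
      fix T T' assume "T \<in> ?F" "T' \<in> ?F" "T \<noteq> T'"
      hence "negligible (region T \<inter> region T')" using negligible_overlap FT by blast
      thus "negligible ((region T \<inter> square M b) \<inter> (region T' \<inter> square M b))" by (rule negligible_subset) blast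
    qed
  qed
  moreover have "(\<Union>T\<in>?F. region T \<inter> square M b) = square M b"
  proof (intro equalityI subsetI)
    fix v assume v: "v \<in> square M b"
    obtain T where T: "T \<in> tiles_of \<tau>" "cx v \<in> creg T" using covering[OF pt] by blast
    hence "(T, b) \<in> hits M" using v unfolding hits_def square_def by auto
    moreover have "v \<in> region T" unfolding region_def using T(2) by (intro image_eqI[of _ pl "cx v"]) simp_all
    ultimately show "v \<in> (\<Union>T\<in>?F. region T \<inter> square M b)" using v by blast
  qed blast
  ultimately show ?thesis using measure_square(2)[of M b] M by simp
qed

text \<open>Initially the area of a tile sits at its tip. Sending each piece to a point
  \<open>p' i\<close> of the tile in the block of the piece moves it by at most 2 and leaves the
  area M * M in every block.\<close>

lemma area_flow:
  assumes M: "M \<ge> 2"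
  shows "flowable (800000 * (golden * unit_area) * M)
    (\<lambda>j k. (\<Sum>T\<in>{T \<in> tiles_of \<tau>. block M (tip_of T) = (j, k)}. measure lebesgue (region T)) - M * M)"
proof -
  define p' where "p' i = (SOME x. x \<in> creg (fst i) \<and> block M x = snd i)" for i :: "tile \<times> int \<times> int"
  have p': "p' i \<in> creg (fst i)" "block M (p' i) = snd i" if "i \<in> hits M" for i
  proof -
    have "\<exists>x. x \<in> creg (fst i) \<and> block M x = snd i" using that unfolding hits_def by auto
    from someI_ex[OF this] show "p' i \<in> creg (fst i)" "block M (p' i) = snd i" unfolding p'_def by auto
  qed
  define t where "t i = measure lebesgue (region (fst i) \<inter> square M (snd i))" for i :: "tile \<times> int \<times> int"
  have M0: "M > 0" using M by simp
  have a: "0 \<le> golden * unit_area" using unit_area_pos golden_pos by simp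
  have fT: "fst i \<in> tiles_of \<tau>" if "i \<in> hits M" for i using that unfolding hits_def by auto
  have "flowable (800000 * (golden * unit_area) * M)
    (\<lambda>j k. sum t {i \<in> hits M. block M (tip_of (fst i)) = (j, k)} - sum t {i \<in> hits M. block M (p' i) = (j, k)})"
  proof (rule flowable_transfer[where D = 2 and c = "golden * unit_area" and N = "\<lambda>a b. 9 * (40 * a + 41) * (40 * b + 41)"])
    fix i assume i: "i \<in> hits M"
    show "norm (tip_of (fst i) - p' i) \<le> 2"
      using tile_near_tip[OF fT[OF i] p'(1)[OF i]] by (simp add: norm_minus_commute)
    have "t i \<le> measure lebesgue (region (fst i))"
      unfolding t_def using region_measure(1)[OF fT[OF i]] measure_square(1)[OF M0, of "snd i"]
      by (intro measure_mono_fmeasurable) (auto intro: fmeasurableD)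
    also have "\<dots> \<le> golden * unit_area"
      unfolding region_measure(2)[OF fT[OF i]] using unit_area_pos golden_pos
      by (intro mult_right_mono) (cases "fst (fst i)"; simp)+
    finally show "\<bar>t i\<bar> \<le> golden * unit_area" by (simp add: t_def)
  next
    show "9 * (40 * M + 41) * (40 * (2 * 2) + 41) * (golden * unit_area) \<le> 800000 * (golden * unit_area) * M"
      using mult_right_mono[OF _ a, of "9 * (40 * M + 41) * 201" "800000 * M"] M by (simp add: algebra_simps)
    show "9 * (40 * (4 * 2) + 41) * (40 * (M + 2 * 2) + 41) * (golden * unit_area) \<le> 800000 * (golden * unit_area) * M"
      using mult_right_mono[OF _ a, of "9 * 361 * (40 * (M + 4) + 41)" "800000 * M"] M by (simp add: algebra_simps)
  qed (use M0 a hits_count[OF M] in auto)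
  moreover have "sum t {i \<in> hits M. block M (tip_of (fst i)) = (j, k)} =
      (\<Sum>T\<in>{T \<in> tiles_of \<tau>. block M (tip_of T) = (j, k)}. measure lebesgue (region T))" for j k
  proof -
    let ?A = "{T \<in> tiles_of \<tau>. block M (tip_of T) = (j, k)}"
    have "{i \<in> hits M. block M (tip_of (fst i)) = (j, k)} = Sigma ?A (\<lambda>T. {b. (T, b) \<in> hits M})"
      unfolding hits_def by auto
    hence "sum t {i \<in> hits M. block M (tip_of (fst i)) = (j, k)} = (\<Sum>T\<in>?A. \<Sum>b\<in>{b. (T, b) \<in> hits M}. t (T, b))"
      using finite_block_tiles[OF M0] measure_region_split(1)[OF M] by (simp add: sum.Sigma)
    also have "\<dots> = (\<Sum>T\<in>?A. measure lebesgue (region T))"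
      by (rule sum.cong) (simp_all add: t_def measure_region_split(2)[OF M])
    finally show ?thesis .
  qed
  moreover have "sum t {i \<in> hits M. block M (p' i) = (j, k)} = M * M" for j k
  proof -
    have "{i \<in> hits M. block M (p' i) = (j, k)} = (\<lambda>T. (T, (j, k))) ` {T. (T, (j, k)) \<in> hits M}"
      using p'(2) by (auto simp: image_iff)
    hence "sum t {i \<in> hits M. block M (p' i) = (j, k)} = (\<Sum>T\<in>{T. (T, (j, k)) \<in> hits M}. t (T, (j, k)))"
      by (simp add: sum.reindex inj_on_def)
    thus ?thesis using measure_square_split[OF M, of "(j, k)"] by (simp add: t_def)
  qed
  ultimately show ?thesis by simp
qed

end

text \<open>
  The constants \<open>c\<close> and \<open>\<alpha>\<close> solve \<open>1 = c h + \<alpha> area\<close> for both kinds of tiles, where \<open>h\<close> is \<open>1\<close> on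
  kites and \<open>- golden\<close> on darts.
\<close>

lemma count_flow:
  assumes pt: "penrose_tiling \<tau>"
  obtains \<alpha> K where "\<alpha> > 0" "K \<ge> 0"
    "\<And>M. M \<ge> 2 \<Longrightarrow> flowable (K * M) (\<lambda>j k. real (card {T \<in> tiles_of \<tau>. block M (tip_of T) = (j, k)}) - \<alpha> * (M * M))"
proof -
  interpret matched 1 "tiles_of \<tau>" by (rule matched_tiles[OF pt])
  define c where "c = (1 - golden) / (2 + golden)"
  define \<alpha> where "\<alpha> = (1 + golden) / (2 + golden) / unit_area"
  define K where "K = \<bar>c\<bar> * 280000 + \<bar>\<alpha>\<bar> * (800000 * (golden * unit_area))"
  have g: "golden > 0" using golden_pos by simp
  have au: "\<alpha> * unit_area = (1 + golden) / (2 + golden)" using unit_area_pos by (simp add: \<alpha>_def)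
  have one: "c * (2 * weight T) + \<alpha> * (inner_pos (fst T) * unit_area) = 1" for T
  proof (cases "fst T")
    case Kite
    have "\<alpha> * (golden * unit_area) = golden * ((1 + golden) / (2 + golden))"
      by (simp only: mult.left_commute[of \<alpha>] au)
    thus ?thesis using g by (simp add: Kite weight_def c_def field_simps golden_rules)
  next
    case Dart
    show ?thesis using g au by (simp add: Dart weight_def c_def field_simps golden_rules)
  qed
  have "flowable (K * M) (\<lambda>j k. real (card {T \<in> tiles_of \<tau>. block M (tip_of T) = (j, k)}) - \<alpha> * (M * M))" if M: "M \<ge> 2" for M
  proof -
    let ?A = "\<lambda>j k. {T \<in> tiles_of \<tau>. block M (tip_of T) = (j, k)}"
    have 1: "flowable (\<bar>c\<bar> * (280000 * M)) (\<lambda>j k. c * charge M (tiles_of \<tau>) j k)"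
      using charge_flowable[of M] M by (intro flowable_cmult) simp
    have 2: "flowable (\<bar>\<alpha>\<bar> * (800000 * (golden * unit_area) * M))
      (\<lambda>j k. \<alpha> * ((\<Sum>T\<in>?A j k. measure lebesgue (region T)) - M * M))"
      by (intro flowable_cmult area_flow[OF pt M])
    have 3: "charge M (tiles_of \<tau>) j k = (\<Sum>T\<in>?A j k. 2 * weight T)" for j k
    proof -
      have "{i \<in> tiles_of \<tau> \<times> turns. block M (tip_of (fst i)) = (j, k)} = ?A j k \<times> turns" by auto
      hence "charge M (tiles_of \<tau>) j k = (\<Sum>T\<in>?A j k. \<Sum>\<eta>\<in>turns. weight T)"
        by (simp only: charge_def sum.cartesian_product case_prod_unfold)
      thus ?thesis using finite_turns by simp
    qed
    have 4: "c * charge M (tiles_of \<tau>) j k + \<alpha> * ((\<Sum>T\<in>?A j k. measure lebesgue (region T)) - M * M) =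
        real (card (?A j k)) - \<alpha> * (M * M)" for j k
    proof -
      have "c * charge M (tiles_of \<tau>) j k + \<alpha> * (\<Sum>T\<in>?A j k. measure lebesgue (region T)) =
          (\<Sum>T\<in>?A j k. c * (2 * weight T) + \<alpha> * (inner_pos (fst T) * unit_area))"
        unfolding 3 sum_distrib_left sum.distrib[symmetric]
        by (rule sum.cong) (simp_all add: region_measure[OF pt])
      also have "\<dots> = real (card (?A j k))" unfolding one by simp
      finally show ?thesis by (simp add: right_diff_distrib)
    qed
    have "\<bar>c\<bar> * (280000 * M) + \<bar>\<alpha>\<bar> * (800000 * (golden * unit_area) * M) = K * M"
      by (simp add: K_def algebra_simps)
    with flowable_add[OF 1 2] show ?thesis unfolding 4 by simp
  qed
  moreover have "\<alpha> > 0" using g unit_area_pos by (simp add: \<alpha>_def)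
  moreover have "K \<ge> 0" using g unit_area_pos by (simp add: K_def)
  ultimately show ?thesis using that by blast
qed

theorem mainTheorem1:
  fixes \<tau>1 :: "(real^2) set set" and Y :: "(real^2) set"
  assumes "penrose_tiling \<tau>1"
    and "net_created_by \<tau>1 Y"
  shows "\<exists>f :: real^2 \<Rightarrow> real^2. \<exists>L :: real.
           bij_betw f Y integer_lattice \<and> L \<ge> 1 \<and>
           (\<forall>x\<in>Y. \<forall>y\<in>Y. (1 / L) * dist x y \<le> dist (f x) (f y) \<and> dist (f x) (f y) \<le> L * dist x y)"
proof -
  note pt = assms(1)
  obtain p c where p: "\<And>S. S \<in> \<tau>1 \<Longrightarrow> p S \<in> S" and Y: "Y = p ` \<tau>1" and c: "c > 0"
    and sep: "\<And>S S'. S \<in> \<tau>1 \<Longrightarrow> S' \<in> \<tau>1 \<Longrightarrow> S \<noteq> S' \<Longrightarrow> c \<le> dist (p S) (p S')"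
    using assms(2) unfolding net_created_by_def by metis
  obtain \<alpha> K where \<alpha>: "\<alpha> > 0" and K: "K \<ge> 0" and flow:
    "\<And>M. M \<ge> 2 \<Longrightarrow> flowable (K * M) (\<lambda>j k. real (card {T \<in> tiles_of \<tau>1. block M (tip_of T) = (j, k)}) - \<alpha> * (M * M))"
    by (rule count_flow[OF pt]) (rule that)
  \<comment> \<open>With M = m / s the target \<alpha> * M * M becomes m * m, the number of points
    in an m by m square of the lattice.\<close>
  define s where "s = sqrt \<alpha>"
  have s: "s > 0" "s * s = \<alpha>" using \<alpha> by (simp_all add: s_def)
  \<comment> \<open>The flow bound \<open>K * M\<close> is K m / s, linear in m, while the target is
    quadratic; the first requirement makes the target large enough. The second one yields M \<ge>
    2.\<close>
  obtain m :: nat where m: "real m \<ge> max (16 * K / s + 16) (2 * s)" using real_arch_simple by blast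
  hence m1: "real m \<ge> 16 * K / s + 16" "real m \<ge> 2 * s" by auto
  have m16: "real m \<ge> 16" using m1(1) K s(1) by (smt (verit) divide_nonneg_pos mult_nonneg_nonneg)
  define M where "M = real m / s"
  have M: "M \<ge> 2" "\<alpha> * (M * M) = real (m * m)" using m1(2) s by (auto simp: M_def field_simps)
  define q where "q T = p (region T)" for T
  have qY: "Y = q ` tiles_of \<tau>1" unfolding q_def Y using region_image[OF pt] by (metis image_image)
  have q_sep: "c \<le> dist (q T) (q T')" if "T \<in> tiles_of \<tau>1" "T' \<in> tiles_of \<tau>1" "T \<noteq> T'" for T T'
    unfolding q_def using that region_in[OF pt] region_inj_on[OF pt] by (intro sep) (auto simp: inj_on_def)
  have q_inj: "inj_on q (tiles_of \<tau>1)"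
    by (rule inj_onI) (use q_sep c in force)
  \<comment> \<open>A net point is assigned to the block of the tip of its tile, not to its own, so
    the counts of \<open>count_flow\<close> carry over to \<open>Y\<close> as they are.\<close>
  define a where "a y = block M (tip_of (the_inv_into (tiles_of \<tau>1) q y))" for y
  have aq: "a (q T) = block M (tip_of T)" if "T \<in> tiles_of \<tau>1" for T
    unfolding a_def using the_inv_into_f_f[OF q_inj that] by simp
  have img: "{y \<in> Y. a y = b} = q ` {T \<in> tiles_of \<tau>1. block M (tip_of T) = b}" for b
    unfolding qY using aq by auto
  have card: "card {y \<in> Y. a y = b} = card {T \<in> tiles_of \<tau>1. block M (tip_of T) = b}" for b
    unfolding img by (rule card_image) (rule inj_on_subset[OF q_inj], blast)
  show ?thesis
  proof (rule bilipschitz_from_blocks[where M = M and m = m and R = "M + 2" and a = a and F = "K * M" and c = c])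
    fix y assume "y \<in> Y"
    then obtain T where T: "T \<in> tiles_of \<tau>1" "y = q T" unfolding qY by blast
    have "y \<in> region T" unfolding T(2) q_def using p region_in[OF pt] T(1) by blast
    then obtain x where x: "x \<in> creg T" "y = pl x" unfolding region_def by blast
    have "norm (x - tip_of T) \<le> 2" using tile_near_tip[OF pt T(1) x(1)] .
    hence d: "\<bar>Re x - Re (tip_of T)\<bar> \<le> 2" "\<bar>Im x - Im (tip_of T)\<bar> \<le> 2"
      using abs_Re_le_cmod[of "x - tip_of T"] abs_Im_le_cmod[of "x - tip_of T"] by auto
    have a: "a y = (\<lfloor>Re (tip_of T) / M\<rfloor>, \<lfloor>Im (tip_of T) / M\<rfloor>)" using aq[OF T(1)] T(2) by (simp add: block_def)
    show "\<bar>y $ 1 - M * of_int (fst (a y))\<bar> \<le> M + 2 \<and> \<bar>y $ 2 - M * of_int (snd (a y))\<bar> \<le> M + 2"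
      using d M(1) floor_divide_le[of M "Re (tip_of T)", OF _ refl] floor_divide_le[of M "Im (tip_of T)", OF _ refl]
      unfolding a unfolding x(2) by (auto simp: abs_le_iff mult.commute)
  next
    show "finite {y \<in> Y. a y = b}" for b
      unfolding img using finite_block_tiles[OF pt] M(1) by (intro finite_imageI) simp
    show "flowable (K * M) (\<lambda>j k. real (card {y \<in> Y. a y = (j, k)}) - real (m * m))"
      unfolding card M(2)[symmetric] by (rule flow[OF M(1)])
    have "16 * (K * M) + 16 \<le> (16 * K / s) * real m + 16 * real m" using m16 by (simp add: M_def)
    also have "\<dots> = (16 * K / s + 16) * real m" by (simp add: distrib_right)
    also have "\<dots> \<le> real m * real m" using m1(1) by (intro mult_right_mono) auto
    finally show "16 * (K * M) + 16 \<le> real (m * m)" by simp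
    show "c \<le> dist x y" if "x \<in> Y" "y \<in> Y" "x \<noteq> y" for x y
      using that q_sep unfolding qY by blast
  qed (use M(1) m16 c in auto)
qed

end
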